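(* Let $c$ be a real number with $1<c<2$. The Thue--Morse sequence along $\lfloor n^c\rfloor$ is simply normal. That is, each of the letters $0$ and $1$ appears with asymptotic frequency $1/2$ in the sequence $n\mapsto\mathbf t(\lfloor n^c\rfloor)$: for each $b\in\{0,1\}$, \[ \lim_{N\to\infty}\frac 1N\bigl\lvert\bigl\{0\leq n<N:\mathbf t(\lfloor n^c\rfloor)=b\bigr\}\bigr\rvert=\frac 12 . \]
   Context: For a nonnegative integer $n$, $s(n)$ denotes the number of $1$s in the binary expansion of $n$. The Thue--Morse sequence $\mathbf t=(\mathbf t(n))_{n\ge 0}$ takes values in $\{0,1\}$, with $\mathbf t(n)=0$ if and only if $s(n)\equiv 0\bmod 2$. *)

theory Defs
  imports "HOL-Analysis.Analysis"
begin

definition binary_ones :: "nat \<Rightarrow> nat" where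
  "binary_ones n = card {i. bit n i}"

lemma finite_binary_ones: "finite {i. bit (n::nat) i}"
proof (rule finite_subset)
  show "{i. bit n i} \<subseteq> {..<n}"
  proof
    fix i assume "i \<in> {i. bit n i}"
    then have "odd (n div 2 ^ i)" by (simp add: bit_iff_odd)
    then have "n div 2 ^ i \<noteq> 0" by (metis even_zero)
    then have "2 ^ i \<le> n" by (metis div_less not_le)
    then show "i \<in> {..<n}" using less_exp[of i] by (simp del: less_exp)
  qed
qed simp

definition thue_morse :: "nat \<Rightarrow> nat" where
  "thue_morse n = (if even (binary_ones n) then 0 else 1)"

end

theory Submission
  imports Defs
begin

text \<open>
  Write \<open>tm n = (-1) ^ s(n)\<close>. Both letters have frequency \<open>1/2\<close> along \<open>\<lfloor>n\<^sup>c\<rfloor>\<close> once the sums of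
  \<open>tm \<lfloor>n\<^sup>c\<rfloor>\<close> over dyadic ranges \<open>N \<le> n < 2 N\<close> are \<open>o(N)\<close>. On a block of length \<open>K = N\<^bsup>(2 - c) / 4\<^esup>\<close> starting at
  \<open>n\<close> the sequence \<open>n\<^sup>c\<close> is, up to a negligible error, an arithmetic progression of slope \<open>\<alpha> n = c n\<^bsup>c - 1\<^esup>\<close>.
  So it suffices that \<open>tm \<lfloor>\<beta> + k \<alpha>\<rfloor>\<close> has a small mean over \<open>k < K\<close>, uniformly in \<open>\<beta>\<close>, for most of the slopes
  that occur. The difficulty is that the slope, of order \<open>D = N\<^bsup>c - 1\<^esup>\<close>, may exceed every fixed power of \<open>K\<close>
  as \<open>c\<close> approaches \<open>2\<close>: the terms have many more digits than \<open>K\<close> terms can equidistribute.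

  The high digits are removed by differencing. Applying the van der Corput inequality in \<open>d\<close> directions
  (\<open>iterated_van_der_Corput\<close>) bounds a power of the mean by an average of products of \<open>tm\<close> over the corners of
  \<open>d\<close>-dimensional cubes, and the sets of shifts in the various directions are at our disposal. If the shift \<open>a\<close>
  is such that \<open>a \<alpha>\<close> is very close to a multiple of \<open>2 ^ l\<close>, then a shift by \<open>a\<close> does not change the digits just
  below position \<open>l\<close>, apart from rare carries, so that these digits contribute each value twice to the product and
  cancel. One direction is used for each of \<open>p\<close> blocks of \<open>\<mu>\<close> digits, and one more direction for the
  digits above and below these blocks (\<open>cube_product_digit_reduction\<close>). By Dirichlet's theorem there are such
  shifts of size \<open>O(2 ^ \<mu>)\<close>, where \<open>2 ^ (p \<mu>)\<close> is about \<open>D\<close>; since \<open>p\<close> is a constant that may be chosen large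
  in terms of \<open>c\<close>, they are much shorter than the block length \<open>K\<close>.

  Only the lowest \<open>L\<close> digits survive, with \<open>L\<close> constant. The shifts can be chosen so that, in addition, the
  \<open>b\<close>-th shift in each direction translates these digits by \<open>b\<close>, for all \<open>b < B\<close>. What is left is the average
  of products of \<open>tm\<close> over all cubes with side parameters in \<open>{..<B}\<close>, a Gowers norm of the Thue--Morse
  sequence in disguise. It tends to \<open>0\<close> as \<open>B\<close> grows (\<open>cube_sum_decay\<close>): each further group of binary digits of
  the parameters contains two choices that yield the same carries but opposite signs.

  It remains to discard the starting points with a bad slope: those for which some small multiple of \<open>\<alpha>\<close> is
  close to a multiple of one of the relevant powers of \<open>2\<close>, which would spoil the rarity of carries, and those for
  which a multiple that Dirichlet's theorem provides is too close to a multiple of \<open>2 ^ L\<close> to reach all residues.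
  Since \<open>\<alpha>\<close> is increasing with small steps, it suffices to cover the bad slopes by few short intervals
  (\<open>card_near\<close>, \<open>card_near_two_levels\<close>). For the second kind, the conditions at the levels \<open>l\<close> and \<open>L\<close> are
  independent as long as \<open>l\<close> exceeds \<open>L\<close> sufficiently, so that the union bound over all \<open>O(2 ^ \<mu>)\<close> multiples does
  not lose anything.
\<close>

section \<open>Cancellation of Thue--Morse over boxes\<close>

definition tm :: "nat \<Rightarrow> real" where
  "tm n = (-1) ^ binary_ones n"

lemma binary_ones_split:
  "binary_ones n = binary_ones (n div 2 ^ T) + binary_ones (n mod 2 ^ T)"
proof -
  have eq: "{i. bit n i} = (\<lambda>i. i + T) ` {i. bit (n div 2 ^ T) i} \<union> {i. bit (n mod 2 ^ T) i}"
  proof (intro set_eqI iffI)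
    fix i assume i: "i \<in> {i. bit n i}"
    show "i \<in> (\<lambda>i. i + T) ` {i. bit (n div 2 ^ T) i} \<union> {i. bit (n mod 2 ^ T) i}"
    proof (cases "i < T")
      case True
      then show ?thesis using i by (simp add: bit_take_bit_iff flip: take_bit_eq_mod)
    next
      case False
      then have "i = (i - T) + T" "bit (n div 2 ^ T) (i - T)"
        using i by (simp_all add: bit_drop_bit_eq flip: drop_bit_eq_div)
      then show ?thesis by blast
    qed
  qed (auto simp: bit_take_bit_iff bit_drop_bit_eq add.commute simp flip: take_bit_eq_mod drop_bit_eq_div)
  have "card {i. bit n i} = card ((\<lambda>i. i + T) ` {i. bit (n div 2 ^ T) i}) + card {i. bit (n mod 2 ^ T) i}"
    unfolding eq
    by (rule card_Un_disjoint)
       (auto simp: finite_binary_ones bit_take_bit_iff simp flip: take_bit_eq_mod)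
  also have "card ((\<lambda>i. i + T) ` {i. bit (n div 2 ^ T) i}) = card {i. bit (n div 2 ^ T) i}"
    by (rule card_image) (auto simp: inj_on_def)
  finally show ?thesis by (simp add: binary_ones_def)
qed

lemma tm_split: "tm n = tm (n div 2 ^ T) * tm (n mod 2 ^ T)"
  unfolding tm_def by (subst binary_ones_split[of n T]) (simp add: power_add)

lemma tm_concat: "b < 2 ^ T \<Longrightarrow> tm (2 ^ T * a + b) = tm a * tm b"
  using tm_split[of "2 ^ T * a + b" T] by simp

lemma tm_0 [simp]: "tm 0 = 1"
  by (simp add: tm_def binary_ones_def)

lemma tm_1 [simp]: "tm (Suc 0) = -1"
proof -
  have "{i. bit (Suc 0) i} = {0}" by (auto simp: bit_Suc_0_iff)
  then show ?thesis by (simp add: tm_def binary_ones_def)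
qed

lemma abs_tm [simp]: "\<bar>tm n\<bar> = 1"
  by (simp add: tm_def)

lemma tm_square [simp]: "tm n * tm n = 1"
  by (simp add: tm_def flip: power_add mult_2)

lemma tm_power_of_2 [simp]: "tm (2 ^ T) = -1"
  using tm_concat[of 0 T "Suc 0"] by simp

lemma tm_even_odd: "tm (2 * k) = tm k" "tm (Suc (2 * k)) = - tm k"
  using tm_concat[of 0 1 k] tm_concat[of 1 1 k] by simp_all

lemma prod_tm_upto_double: "(\<Prod>k<2 * m. tm k) = (-1) ^ m"
proof (induction m)
  case (Suc m)
  have "(\<Prod>k<2 * Suc m. tm k) = (\<Prod>k<2 * m. tm k) * (tm (2 * m) * tm (Suc (2 * m)))"
    by (simp add: mult.assoc)
  then show ?case using Suc by (simp add: tm_even_odd)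
qed simp

text \<open>
  This is where the Thue--Morse sequence shows that it is not a polynomial phase: over the corners
  \<open>1 + \<Sum> {2 ^ j | j \<in> E}\<close> of a cube the signs multiply to \<open>-1\<close>, whereas a sequence with vanishing \<open>d\<close>-th
  differences would give \<open>1\<close>.
\<close>

lemma prod_tm_shifted:
  assumes "d \<ge> 2"
  shows "(\<Prod>k<2 ^ d. tm (Suc k)) = -1"
proof -
  obtain e where d: "d = Suc (Suc e)"
    using assms by (metis Suc_le_D numeral_2_eq_2 Suc_le_mono)
  have "(\<Prod>k<2 ^ d. tm k) = 1"
    using prod_tm_upto_double[of "2 ^ Suc e"] by (simp add: d)
  moreover have "tm 0 * (\<Prod>k<2 ^ d. tm (Suc k)) = (\<Prod>k<2 ^ d. tm k) * tm (2 ^ d)"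
    by (metis prod.lessThan_Suc prod.lessThan_Suc_shift)
  ultimately show ?thesis by simp
qed

lemma prod_Pow_insert:
  fixes \<phi> :: "'b set \<Rightarrow> 'a :: comm_monoid_mult"
  assumes "finite S" "j \<notin> S"
  shows "(\<Prod>E\<in>Pow (insert j S). \<phi> E) = (\<Prod>E\<in>Pow S. \<phi> E * \<phi> (insert j E))"
proof -
  have "(\<Prod>E\<in>Pow (insert j S). \<phi> E) = (\<Prod>E\<in>Pow S. \<phi> E) * (\<Prod>E\<in>insert j ` Pow S. \<phi> E)"
    unfolding Pow_insert by (rule prod.union_disjoint) (use assms in auto)
  also have "(\<Prod>E\<in>insert j ` Pow S. \<phi> E) = (\<Prod>E\<in>Pow S. \<phi> (insert j E))"
    using assms by (subst prod.reindex) (auto simp: inj_on_def insert_ident subset_iff)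
  finally show ?thesis by (simp add: prod.distrib)
qed

lemma prod_Pow_lessThan_Suc:
  fixes \<phi> :: "nat set \<Rightarrow> 'a :: comm_monoid_mult"
  shows "(\<Prod>E\<in>Pow {..<Suc d}. \<phi> E) = (\<Prod>E\<in>Pow {..<d}. \<phi> E * \<phi> (insert d E))"
  unfolding lessThan_Suc by (rule prod_Pow_insert) auto

lemma prod_Pow_binary:
  fixes \<phi> :: "nat \<Rightarrow> 'a :: comm_monoid_mult"
  shows "(\<Prod>E\<in>Pow {..<d}. \<phi> (\<Sum>j\<in>E. 2 ^ j)) = (\<Prod>k<2 ^ d. \<phi> k)"
proof (induction d arbitrary: \<phi>)
  case (Suc d)
  have ins: "(\<Sum>j\<in>insert d E. 2 ^ j) = (2::nat) ^ d + (\<Sum>j\<in>E. 2 ^ j)" if "E \<in> Pow {..<d}" for E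
    using that finite_subset[of E "{..<d}"] by (subst sum.insert) auto
  have "(\<Prod>E\<in>Pow {..<Suc d}. \<phi> (\<Sum>j\<in>E. 2 ^ j))
      = (\<Prod>E\<in>Pow {..<d}. \<phi> (\<Sum>j\<in>E. 2 ^ j) * \<phi> (2 ^ d + (\<Sum>j\<in>E. 2 ^ j)))"
    unfolding prod_Pow_lessThan_Suc by (rule prod.cong) (simp_all add: ins)
  also have "\<dots> = (\<Prod>k<2 ^ d. \<phi> k) * (\<Prod>k<2 ^ d. \<phi> (2 ^ d + k))"
    using Suc[of \<phi>] Suc[of "\<lambda>k. \<phi> (2 ^ d + k)"] by (simp add: prod.distrib)
  also have "(\<Prod>k<2 ^ d. \<phi> (2 ^ d + k)) = (\<Prod>k\<in>{2 ^ d..<2 ^ Suc d}. \<phi> k)"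
    by (rule prod.reindex_bij_witness[of _ "\<lambda>k. k - 2 ^ d" "\<lambda>k. 2 ^ d + k"]) auto
  also have "(\<Prod>k<2 ^ d. \<phi> k) * (\<Prod>k\<in>{2 ^ d..<2 ^ Suc d}. \<phi> k) = (\<Prod>k<2 ^ Suc d. \<phi> k)"
    by (subst prod.union_disjoint [symmetric]) (auto intro!: prod.cong)
  finally show ?case .
qed simp

lemma sum_PiE_digits:
  fixes \<phi> :: "('i \<Rightarrow> nat) \<Rightarrow> real"
  assumes "a > 0"
  shows "(\<Sum>c\<in>PiE I (\<lambda>_. {..<a * b}). \<phi> c)
    = (\<Sum>lo\<in>PiE I (\<lambda>_. {..<a}). \<Sum>hi\<in>PiE I (\<lambda>_. {..<b}). \<phi> (\<lambda>i\<in>I. lo i + a * hi i))"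
proof -
  have ub: "lo + a * hi < a * b" if "lo < a" "hi < b" for lo hi
  proof -
    have "lo + a * hi < a * Suc hi" using that by simp
    also have "\<dots> \<le> a * b" using that by (intro mult_le_mono2) simp
    finally show ?thesis .
  qed
  show ?thesis
    unfolding sum.cartesian_product
    by (rule sum.reindex_bij_witness[of _
          "\<lambda>(lo, hi). \<lambda>i\<in>I. lo i + a * hi i"
          "\<lambda>c. (\<lambda>i\<in>I. c i mod a, \<lambda>i\<in>I. c i div a)"])
       (use assms ub in \<open>auto simp: PiE_iff less_mult_imp_div_less mult.commute[of a b] restrict_PiE_iff
          intro!: arg_cong[where f = \<phi>] extensionalityI[of _ I] cong: restrict_cong\<close>)
qed

text \<open>
  The corner of a cube that is given by the parameter \<open>c j False\<close> or \<open>c j True\<close> in each direction \<open>j\<close>; the set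
  \<open>E\<close> collects the directions in which the second one is taken. Keeping both parameters instead of their
  difference is the form in which the van der Corput inequality produces cubes.
\<close>

definition corner_sum :: "nat \<Rightarrow> (nat \<Rightarrow> bool \<Rightarrow> nat) \<Rightarrow> nat set \<Rightarrow> nat" where
  "corner_sum d c E = (\<Sum>j<d. c j (j \<in> E))"

abbreviation box :: "nat \<Rightarrow> nat \<Rightarrow> (nat \<times> bool \<Rightarrow> nat) set" where
  "box d B \<equiv> PiE ({..<d} \<times> UNIV) (\<lambda>_. {..<B})"

lemma card_box: "card (box d B) = B ^ (2 * d)"
  by (simp add: card_PiE power_mult mult.commute)

lemma finite_box [simp]: "finite (box d B)"
  by (intro finite_PiE) auto

text \<open>
  For constant \<open>W\<close> this is an unnormalised Gowers norm of \<open>tm\<close>, localised to a box. The offsets \<open>W E\<close> are allowed to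
  depend on the corner because a recursion on the digits creates different carries at different corners.
\<close>

definition cube_sum :: "nat \<Rightarrow> nat \<Rightarrow> (nat set \<Rightarrow> nat) \<Rightarrow> real" where
  "cube_sum d B W = (\<Sum>c\<in>box d B. \<Prod>E\<in>Pow {..<d}. tm (W E + corner_sum d (curry c) E))"

lemma abs_cube_sum_le: "\<bar>cube_sum d B W\<bar> \<le> real (B ^ (2 * d))"
proof -
  have "\<bar>cube_sum d B W\<bar> \<le> (\<Sum>c\<in>box d B. \<bar>\<Prod>E\<in>Pow {..<d}. tm (W E + corner_sum d (curry c) E)\<bar>)"
    unfolding cube_sum_def by (rule sum_abs)
  also have "\<dots> = real (card (box d B))" by (simp add: abs_prod)
  finally show ?thesis unfolding card_box .
qed

text \<open>
  Summing first over the lowest \<open>T\<close> digits of all parameters turns the sum into a signed combination of sums of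
  the same kind, in which the carries have been added to the high digits of the offsets.
\<close>

lemma cube_sum_split_digits:
  "cube_sum d (2 ^ T * B) W = (\<Sum>lo\<in>box d (2 ^ T).
      (\<Prod>E\<in>Pow {..<d}. tm ((W E + corner_sum d (curry lo) E) mod 2 ^ T)) *
      cube_sum d B (\<lambda>E. (W E + corner_sum d (curry lo) E) div 2 ^ T))"
proof -
  have *: "tm (W E + corner_sum d (curry (\<lambda>i\<in>{..<d} \<times> UNIV. lo i + 2 ^ T * hi i)) E)
      = tm ((W E + corner_sum d (curry lo) E) mod 2 ^ T) *
        tm ((W E + corner_sum d (curry lo) E) div 2 ^ T + corner_sum d (curry hi) E)" for lo hi E
  proof -
    have "corner_sum d (curry (\<lambda>i\<in>{..<d} \<times> UNIV. lo i + 2 ^ T * hi i)) E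
        = corner_sum d (curry lo) E + 2 ^ T * corner_sum d (curry hi) E"
      by (simp add: corner_sum_def sum.distrib sum_distrib_left)
    then show ?thesis
      using tm_split[of "(W E + corner_sum d (curry lo) E) + 2 ^ T * corner_sum d (curry hi) E" T]
      by (simp only: add.assoc [symmetric] div_mult_self2 mod_mult_self2 power_not_zero mult.commute) (simp add: mult.commute add.commute)
  qed
  show ?thesis
    unfolding cube_sum_def
    by (subst sum_PiE_digits) (simp_all add: * prod.distrib sum_distrib_left)
qed

lemma corner_sum_bound:
  assumes "\<And>j b. j < d \<Longrightarrow> c j b < B"
  shows "corner_sum d c E \<le> d * (B - 1)"
proof -
  have "corner_sum d c E \<le> (\<Sum>j<d. B - 1)"
    unfolding corner_sum_def
  proof (rule sum_mono)
    fix j assume "j \<in> {..<d}"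
    then have "c j (j \<in> E) < B" using assms by simp
    then show "c j (j \<in> E) \<le> B - 1" by simp
  qed
  then show ?thesis by simp
qed

text \<open>
  Offsets that spread by at most \<open>d + 1\<close> still do so after carrying, so the recursion reproduces its hypothesis.
  Among the \<open>2 ^ (2 d T)\<close> terms there are two with equal carries and opposite signs, and these cancel. To find
  them, all corners are first moved by a common \<open>v\<close> to a number that is \<open>2 ^ t\<close> plus a small offset modulo
  \<open>2 ^ (T - 1)\<close>; then all remaining parameters are set to \<open>0\<close>, or else the second parameter in direction \<open>j\<close> is
  raised by \<open>2 ^ (t + j)\<close>. In both cases the offsets stay below \<open>2 ^ t\<close> and the parts that differ from corner to
  corner stay below \<open>2 ^ (T - 1)\<close>, so the carries agree. The signs differ by the factor from
  \<open>prod_tm_shifted\<close>.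
\<close>

lemma cube_sum_contraction_step:
  assumes d: "d \<ge> 2" and t: "d + 1 < 2 ^ t" and T: "T = t + d + 2"
    and W: "\<And>E. w \<le> W E \<and> W E \<le> w + (d + 1)"
    and bd: "\<And>W' w'. (\<And>E. w' \<le> W' E \<and> W' E \<le> w' + (d + 1)) \<Longrightarrow> \<bar>cube_sum d B W'\<bar> \<le> M"
  shows "\<bar>cube_sum d (2 ^ T * B) W\<bar> \<le> (2 ^ (T * (2 * d)) - 2) * M"
proof -
  define U where "U lo E = W E + corner_sum d (curry lo) E" for lo E
  define F where "F lo = (\<Prod>E\<in>Pow {..<d}. tm (U lo E mod 2 ^ T)) *
      cube_sum d B (\<lambda>E. U lo E div 2 ^ T)" for lo
  have F_le: "\<bar>F lo\<bar> \<le> M" if lo: "lo \<in> box d (2 ^ T)" for lo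
  proof -
    have "w div 2 ^ T \<le> U lo E div 2 ^ T \<and> U lo E div 2 ^ T \<le> w div 2 ^ T + (d + 1)" for E
    proof
      show "w div 2 ^ T \<le> U lo E div 2 ^ T"
        unfolding U_def using W[of E] by (intro div_le_mono) simp
      have tT: "(2::nat) ^ t \<le> 2 ^ T" unfolding T by (rule power_increasing) auto
      have "corner_sum d (curry lo) E \<le> d * (2 ^ T - 1)"
        by (rule corner_sum_bound) (use lo in \<open>force simp: PiE_iff\<close>)
      then have "corner_sum d (curry lo) E \<le> d * 2 ^ T" 
        by (meson diff_le_self le_trans mult_le_mono2)
      moreover have "w = 2 ^ T * (w div 2 ^ T) + w mod 2 ^ T" by simp
      moreover have "w mod 2 ^ T < 2 ^ T" by simp
      ultimately have "U lo E < 2 ^ T * (w div 2 ^ T + (d + 1) + 1)"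
        unfolding U_def using W[of E] t tT unfolding add_mult_distrib2 by (simp only: mult.commute) linarith
      then show "U lo E div 2 ^ T \<le> w div 2 ^ T + (d + 1)"
        by (metis Suc_eq_plus1 less_mult_imp_div_less less_Suc_eq_le mult.commute)
    qed
    then have "\<bar>cube_sum d B (\<lambda>E. U lo E div 2 ^ T)\<bar> \<le> M" by (rule bd)
    then show ?thesis by (simp add: F_def abs_mult abs_prod)
  qed
  define v where "v = (2 ^ t + (2 ^ (T - 1) - w mod 2 ^ (T - 1))) mod 2 ^ (T - 1)"
  have v_less: "v < 2 ^ (T - 1)" by (simp add: v_def)
  obtain e where e: "w + v = 2 ^ (T - 1) * e + 2 ^ t"
  proof -
    have tless: "(2::nat) ^ t < 2 ^ (T - 1)" unfolding T by (rule power_strict_increasing) auto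
    have "(w + v) mod 2 ^ (T - 1) = 2 ^ t"
    proof -
      have "(w + v) mod 2 ^ (T - 1) = (w mod 2 ^ (T - 1) + (2 ^ t + (2 ^ (T - 1) - w mod 2 ^ (T - 1)))) mod 2 ^ (T - 1)"
        unfolding v_def by (metis mod_add_eq mod_mod_trivial)
      also have "w mod 2 ^ (T - 1) + (2 ^ t + (2 ^ (T - 1) - w mod 2 ^ (T - 1))) = 2 ^ (T - 1) + 2 ^ t"
      proof -
        have "w mod 2 ^ (T - 1) \<le> 2 ^ (T - 1)" by (intro less_imp_le mod_less_divisor) simp
        then show ?thesis by linarith
      qed
      finally show ?thesis using tless by simp
    qed
    then have "w + v = 2 ^ (T - 1) * ((w + v) div 2 ^ (T - 1)) + 2 ^ t"
      by (metis mult_div_mod_eq)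
    then show ?thesis by (rule that)
  qed
  define lo1 where "lo1 = (\<lambda>i\<in>{..<d} \<times> (UNIV::bool set). if fst i = 0 then v else 0)"
  define lo2 where "lo2 = (\<lambda>i\<in>{..<d} \<times> (UNIV::bool set).
     (if fst i = 0 then v else 0) + (if snd i then 2 ^ (t + fst i) else 0))"
  have TT: "(2::nat) ^ T = 2 * 2 ^ (T - 1)"
    by (simp add: T flip: power_Suc)
  have pw: "(2::nat) ^ (t + j) < 2 ^ (T - 1)" if "j < d" for j
    unfolding T using that by (intro power_strict_increasing) auto
  have lo1_in: "lo1 \<in> box d (2 ^ T)"
    using v_less TT by (auto simp: lo1_def)
  have lo2_in: "lo2 \<in> box d (2 ^ T)"
  proof -
    have "(if fst i = 0 then v else 0) + (if snd i then 2 ^ (t + fst i) else 0) < 2 ^ T"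
      if "i \<in> {..<d} \<times> (UNIV :: bool set)" for i
      using v_less TT pw[of "fst i"] that
      by (cases "snd i"; cases "fst i = 0") (simp_all del: power_strict_increasing_iff add: mem_Times_iff)
    then show ?thesis unfolding lo2_def restrict_PiE_iff lessThan_iff by blast
  qed
  have lo_ne: "lo1 \<noteq> lo2"
  proof
    assume "lo1 = lo2"
    then have "lo1 (1, True) = lo2 (1, True)" by simp
    then show False using d by (simp add: lo1_def lo2_def)
  qed
  have U1: "U lo1 E = 2 ^ (T - 1) * e + (2 ^ t + (W E - w))" for E
  proof -
    have "corner_sum d (curry lo1) E = (\<Sum>j<d. if j = 0 then v else 0)"
      unfolding corner_sum_def by (rule sum.cong) (auto simp: lo1_def)
    then have "corner_sum d (curry lo1) E = v" using d by simp
    then show ?thesis using W[of E] e by (simp add: U_def)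
  qed
  have U2: "U lo2 E = 2 ^ (T - 1) * e + (2 ^ t * Suc (\<Sum>j\<in>E. 2 ^ j) + (W E - w))"
    if E: "E \<in> Pow {..<d}" for E
  proof -
    have "corner_sum d (curry lo2) E = (\<Sum>j<d. (if j = 0 then v else 0) + (if j \<in> E then 2 ^ (t + j) else (0::nat)))"
      unfolding corner_sum_def by (rule sum.cong) (auto simp: lo2_def)
    also have "\<dots> = v + (\<Sum>j<d. if j \<in> E then 2 ^ (t + j) else 0)"
      using d by (simp add: sum.distrib)
    also have "(\<Sum>j<d. if j \<in> E then 2 ^ (t + j) else (0::nat)) = (\<Sum>j\<in>E. 2 ^ (t + j))"
      using E by (simp add: sum.inter_restrict [symmetric] Int_absorb1)
    also have "\<dots> = 2 ^ t * (\<Sum>j\<in>E. 2 ^ j)" by (simp add: power_add sum_distrib_left)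
    finally show ?thesis using W[of E] e unfolding U_def mult_Suc_right by linarith
  qed
  have small: "2 ^ t * Suc (\<Sum>j\<in>E. 2 ^ j) + (W E - w) < 2 ^ (T - 1)" if E: "E \<in> Pow {..<d}" for E
  proof -
    have "(\<Sum>j\<in>E. 2 ^ j) \<le> (\<Sum>j<d. 2 ^ j :: nat)" using E by (intro sum_mono2) auto
    also have "\<dots> = 2 ^ d - 1" by (simp add: sum_power2 lessThan_atLeast0)
    finally have "Suc (\<Sum>j\<in>E. 2 ^ j) \<le> 2 ^ d"
      using one_le_power[of "2::nat" d] by linarith
    then have "2 ^ t * Suc (\<Sum>j\<in>E. 2 ^ j) \<le> 2 ^ t * 2 ^ d" by (rule mult_le_mono2)
    moreover have "W E - w < 2 ^ t" using W[of E] t by linarith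
    moreover have "(2::nat) ^ t * 1 \<le> 2 ^ t * 2 ^ d" by (intro mult_le_mono2) simp
    moreover have "(2::nat) ^ (T - 1) = 2 * (2 ^ t * 2 ^ d)" by (simp add: T power_add)
    ultimately show ?thesis by linarith
  qed
  have small1: "2 ^ t + (W E - w) < 2 ^ (T - 1)" if E: "E \<in> Pow {..<d}" for E
  proof -
    have "2 ^ t * 1 \<le> 2 ^ t * Suc (\<Sum>j\<in>E. 2 ^ j)" by (rule mult_le_mono2) simp
    then show ?thesis using small[OF E] by linarith
  qed
  have high: "(2 ^ (T - 1) * e + z) div 2 ^ T = e div 2"
             "tm ((2 ^ (T - 1) * e + z) mod 2 ^ T) = tm (e mod 2) * tm z"
    if "z < 2 ^ (T - 1)" for z
  proof -
    have "2 ^ (T - 1) * e + z = 2 ^ T * (e div 2) + (2 ^ (T - 1) * (e mod 2) + z)"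
    proof -
      have "2 ^ (T - 1) * e = 2 ^ (T - 1) * (2 * (e div 2) + e mod 2)"
        by (simp only: mult_div_mod_eq)
      also have "\<dots> = 2 ^ T * (e div 2) + 2 ^ (T - 1) * (e mod 2)"
        unfolding TT by (simp only: add_mult_distrib2 mult_ac)
      finally show ?thesis by (simp only: add.assoc)
    qed
    moreover have "2 ^ (T - 1) * (e mod 2) + z < 2 ^ T"
    proof -
      have "e mod 2 \<le> 1" by simp
      then have "2 ^ (T - 1) * (e mod 2) \<le> 2 ^ (T - 1) * 1" by (rule mult_le_mono2)
      then show ?thesis using that TT by linarith
    qed
    ultimately show "(2 ^ (T - 1) * e + z) div 2 ^ T = e div 2"
      "tm ((2 ^ (T - 1) * e + z) mod 2 ^ T) = tm (e mod 2) * tm z"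
      by (simp_all only: div_mult_self4 div_less mod_mult_self4 mod_less tm_concat that)
  qed
  \<comment> \<open>The bit at position \<open>T - 1\<close>, which is the same at all corners, contributes an even power to the sign.\<close>
  have F12: "F lo1 + F lo2 = 0"
  proof -
    have cs_cong: "cube_sum d B f = cube_sum d B g" if "\<And>E. E \<in> Pow {..<d} \<Longrightarrow> f E = g E" for f g
      unfolding cube_sum_def using that by (intro sum.cong prod.cong) auto
    have c1: "cube_sum d B (\<lambda>E. U lo1 E div 2 ^ T) = cube_sum d B (\<lambda>E. e div 2)"
      by (rule cs_cong) (simp only: U1 high small1)
    have c2: "cube_sum d B (\<lambda>E. U lo2 E div 2 ^ T) = cube_sum d B (\<lambda>E. e div 2)"
      by (rule cs_cong) (simp only: U2 high small)
    define P where "P = (\<Prod>E\<in>Pow {..<d}. tm (e mod 2) * tm (W E - w))"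
    have Wt: "W E - w < 2 ^ t" for E using W[of E] t by linarith
    have card: "card (Pow {..<d}) = 2 ^ d" by (simp add: card_Pow)
    have "(\<Prod>E\<in>Pow {..<d}. tm (U lo1 E mod 2 ^ T)) = (\<Prod>E\<in>Pow {..<d}. (-1) * (tm (e mod 2) * tm (W E - w)))"
    proof (rule prod.cong)
      fix E assume E: "E \<in> Pow {..<d}"
      have "tm (2 ^ t + (W E - w)) = - tm (W E - w)"
        using tm_concat[OF Wt, of "Suc 0" E] by simp
      then show "tm (U lo1 E mod 2 ^ T) = (-1) * (tm (e mod 2) * tm (W E - w))"
        by (simp only: U1 high small1[OF E])
    qed simp
    also have "\<dots> = P"
      unfolding P_def prod.distrib[of "\<lambda>_. -1"] using d by (simp add: card)
    finally have s1: "(\<Prod>E\<in>Pow {..<d}. tm (U lo1 E mod 2 ^ T)) = P" .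
    have "(\<Prod>E\<in>Pow {..<d}. tm (U lo2 E mod 2 ^ T))
       = (\<Prod>E\<in>Pow {..<d}. tm (Suc (\<Sum>j\<in>E. 2 ^ j)) * (tm (e mod 2) * tm (W E - w)))"
    proof (rule prod.cong)
      fix E assume E: "E \<in> Pow {..<d}"
      show "tm (U lo2 E mod 2 ^ T) = tm (Suc (\<Sum>j\<in>E. 2 ^ j)) * (tm (e mod 2) * tm (W E - w))"
        by (simp only: U2[OF E] high[OF small[OF E]] tm_concat[OF Wt]) (simp only: mult_ac)
    qed simp
    also have "\<dots> = - P"
      unfolding P_def prod.distrib[of "\<lambda>E. tm (Suc (\<Sum>j\<in>E. 2 ^ j))"]
      using prod_Pow_binary[of "\<lambda>k. tm (Suc k)" d] prod_tm_shifted[OF d] by simp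
    finally have s2: "(\<Prod>E\<in>Pow {..<d}. tm (U lo2 E mod 2 ^ T)) = - P" .
    show ?thesis by (simp add: F_def s1 s2 c1 c2)
  qed
  have "cube_sum d (2 ^ T * B) W = sum F (box d (2 ^ T))"
    by (simp add: cube_sum_split_digits F_def U_def)
  also have "\<dots> = F lo1 + (F lo2 + sum F (box d (2 ^ T) - {lo1} - {lo2}))"
    using lo1_in lo2_in lo_ne
    by (simp add: sum.remove[of "box d (2 ^ T)" lo1] sum.remove[of "box d (2 ^ T) - {lo1}" lo2])
  also have "\<dots> = sum F (box d (2 ^ T) - {lo1} - {lo2})" using F12 by simp
  finally have "\<bar>cube_sum d (2 ^ T * B) W\<bar> \<le> (\<Sum>lo\<in>box d (2 ^ T) - {lo1} - {lo2}. \<bar>F lo\<bar>)"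
    by simp
  also have "\<dots> \<le> real (card (box d (2 ^ T) - {lo1} - {lo2})) * M"
    by (rule sum_bounded_above) (use F_le in auto)
  also have "card (box d (2 ^ T) - {lo1} - {lo2}) = card (box d (2 ^ T)) - 2"
    using lo1_in lo2_in lo_ne by (simp add: card_Diff_subset)
  also have "real (card (box d (2 ^ T)) - 2) = 2 ^ (T * (2 * d)) - 2"
  proof -
    have "card {lo1, lo2} \<le> card (box d (2 ^ T))"
      using lo1_in lo2_in by (intro card_mono) auto
    then have "2 \<le> card (box d (2 ^ T))" using lo_ne by simp
    then show ?thesis by (simp add: card_box of_nat_diff power_mult)
  qed
  finally show ?thesis .
qed

lemma cube_sum_decay:
  assumes d: "d \<ge> 2" and eps: "\<epsilon> > 0"
  obtains l where "\<And>w. \<bar>cube_sum d (2 ^ l) (\<lambda>_. w)\<bar> \<le> \<epsilon> * real ((2 ^ l) ^ (2 * d))"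
proof -
  obtain t where t: "d + 1 < 2 ^ t" using less_exp by blast
  define T where "T = t + d + 2"
  define N where "N = (2::real) ^ (T * (2 * d))"
  have "(2::real) ^ 1 \<le> 2 ^ (T * (2 * d))" using d by (intro power_increasing) (auto simp: T_def)
  then have N: "N \<ge> 2" by (simp add: N_def)
  have dec: "\<bar>cube_sum d (2 ^ (T * q)) W\<bar> \<le> (N - 2) ^ q"
    if "\<And>E. w \<le> W E \<and> W E \<le> w + (d + 1)" for q W w
    using that
  proof (induction q arbitrary: W w)
    case 0
    show ?case using abs_cube_sum_le[of d 1 W] by simp
  next
    case (Suc q)
    have "\<bar>cube_sum d (2 ^ T * 2 ^ (T * q)) W\<bar> \<le> (2 ^ (T * (2 * d)) - 2) * (N - 2) ^ q"
      by (rule cube_sum_contraction_step[OF d t T_def Suc.prems Suc.IH])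
    then show ?case by (simp add: N_def power_add)
  qed
  have "(\<lambda>q. ((N - 2) / N) ^ q) \<longlonglongrightarrow> 0"
    using N by (intro LIMSEQ_realpow_zero) auto
  then have "\<forall>\<^sub>F q in sequentially. ((N - 2) / N) ^ q < \<epsilon>"
    using eps by (rule order_tendstoD)
  then obtain q where q: "((N - 2) / N) ^ q < \<epsilon>" by (meson eventually_happens trivial_limit_sequentially)
  have "\<bar>cube_sum d (2 ^ (T * q)) (\<lambda>_. w)\<bar> \<le> \<epsilon> * real ((2 ^ (T * q)) ^ (2 * d))" for w
  proof -
    have "\<bar>cube_sum d (2 ^ (T * q)) (\<lambda>_. w)\<bar> \<le> (N - 2) ^ q" by (rule dec[of w]) auto
    also have "\<dots> = ((N - 2) / N) ^ q * N ^ q" using N by (simp add: power_divide)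
    also have "\<dots> \<le> \<epsilon> * N ^ q" using q N by (intro mult_right_mono) auto
    also have "N ^ q = real ((2 ^ (T * q)) ^ (2 * d))"
      by (simp add: N_def mult_ac flip: power_mult)
    finally show ?thesis .
  qed
  then show ?thesis by (rule that)
qed

section \<open>Iterated van der Corput inequality\<close>

definition mean :: "nat \<Rightarrow> (nat \<Rightarrow> real) \<Rightarrow> real" where
  "mean K g = (\<Sum>n<K. g n) / real K"

lemma abs_mean_le_1:
  assumes "\<And>n. \<bar>g n\<bar> \<le> 1"
  shows "\<bar>mean K g\<bar> \<le> 1"
proof -
  have "\<bar>\<Sum>n<K. g n\<bar> \<le> (\<Sum>n<K. \<bar>g n\<bar>)" by (rule sum_abs)
  also have "\<dots> \<le> real (card {..<K}) * 1" by (rule sum_bounded_above) (use assms in auto)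
  finally show ?thesis by (cases "K = 0") (simp_all add: mean_def abs_divide)
qed

lemma power2_diff_le:
  fixes x y e :: real
  assumes "\<bar>x\<bar> \<le> 1" "\<bar>y\<bar> \<le> 1" "\<bar>x - y\<bar> \<le> e"
  shows "x\<^sup>2 \<le> y\<^sup>2 + 2 * e"
proof -
  have "x\<^sup>2 - y\<^sup>2 = (x - y) * (x + y)" by (simp add: power2_eq_square algebra_simps)
  also have "\<dots> \<le> \<bar>x - y\<bar> * \<bar>x + y\<bar>" by (metis abs_ge_self abs_mult)
  also have "\<dots> \<le> e * 2" using assms by (intro mult_mono) auto
  finally show ?thesis by simp
qed

text \<open>
  Moving a window by one step changes only its two end terms.
\<close>

lemma sum_shift_diff:
  fixes g :: "nat \<Rightarrow> real"
  assumes "\<And>n. \<bar>g n\<bar> \<le> 1"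
  shows "\<bar>(\<Sum>n<K. g (n + s)) - (\<Sum>n<K. g n)\<bar> \<le> 2 * real s"
proof (induction s)
  case (Suc s)
  have "(\<Sum>n<K. g (Suc n + s)) = (\<Sum>n<K. g (n + s)) + g (K + s) - g (0 + s)"
    using sum.lessThan_Suc_shift[of "\<lambda>n. g (n + s)" K] sum.lessThan_Suc[of "\<lambda>n. g (n + s)" K] by simp
  then show ?case using Suc assms[of "K + s"] assms[of s] by simp
qed simp

lemma mean_shift_diff:
  assumes "\<And>n. \<bar>g n\<bar> \<le> 1"
  shows "\<bar>mean K (\<lambda>n. g (n + s)) - mean K g\<bar> \<le> 2 * real s / real K"
  using divide_right_mono[OF sum_shift_diff[of g s K], of "real K"] assms
  by (simp add: mean_def abs_divide flip: diff_divide_distrib)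

text \<open>
  The shifts may form an arbitrary family, with no relation to one another except for their size. This freedom is
  what makes it possible to adapt them to the slope.
\<close>

lemma van_der_Corput:
  assumes g: "\<And>n. \<bar>g n\<bar> \<le> 1" and B: "B > 0" and K: "K > 0"
    and a: "\<And>b. b < B \<Longrightarrow> a b \<le> A"
  shows "(mean K g)\<^sup>2 \<le> (\<Sum>p<B. \<Sum>q<B. mean K (\<lambda>n. g (n + a p) * g (n + a q))) / real (B ^ 2)
           + 4 * real A / real K"
proof -
  define h where "h n = (\<Sum>p<B. g (n + a p)) / real B" for n
  have h1: "\<bar>h n\<bar> \<le> 1" for n
    using abs_mean_le_1[of "\<lambda>p. g (n + a p)" B] g by (simp add: h_def mean_def)
  have mh: "mean K h = (\<Sum>p<B. mean K (\<lambda>n. g (n + a p))) / real B"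
    unfolding mean_def h_def
    by (simp add: sum_divide_distrib [symmetric] sum.swap[of _ "{..<B}"] mult.commute)
  have "mean K h - mean K g = (\<Sum>p<B. mean K (\<lambda>n. g (n + a p)) - mean K g) / real B"
    using B by (simp add: mh sum_subtractf diff_divide_distrib)
  also have "\<bar>\<dots>\<bar> \<le> (\<Sum>p<B. \<bar>mean K (\<lambda>n. g (n + a p)) - mean K g\<bar>) / real B"
    by (simp add: divide_right_mono)
  also have "\<dots> \<le> (\<Sum>p<B. 2 * real A / real K) / real B"
  proof (intro divide_right_mono sum_mono)
    fix p assume "p \<in> {..<B}"
    then have "2 * real (a p) / real K \<le> 2 * real A / real K"
      using a by (intro divide_right_mono) auto
    then show "\<bar>mean K (\<lambda>n. g (n + a p)) - mean K g\<bar> \<le> 2 * real A / real K"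
      using mean_shift_diff[of g K "a p"] g by fastforce
  qed auto
  finally have "\<bar>mean K g - mean K h\<bar> \<le> 2 * real A / real K" using B by simp
  then have "(mean K g)\<^sup>2 \<le> (mean K h)\<^sup>2 + 2 * (2 * real A / real K)"
    using g h1 by (intro power2_diff_le abs_mean_le_1) auto
  also have "(mean K h)\<^sup>2 \<le> mean K (\<lambda>n. (h n)\<^sup>2)"
    using sum_squared_le_sum_of_squares[of h "{..<K}"] K by (simp add: mean_def power_divide field_simps power2_eq_square)
  also have "mean K (\<lambda>n. (h n)\<^sup>2) = (\<Sum>p<B. \<Sum>q<B. mean K (\<lambda>n. g (n + a p) * g (n + a q))) / real (B ^ 2)"
  proof -
    have "(h n)\<^sup>2 = (\<Sum>p<B. \<Sum>q<B. g (n + a p) * g (n + a q)) / real (B ^ 2)" for n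
      by (simp add: h_def power_divide) (simp add: power2_eq_square sum_product)
    then have "mean K (\<lambda>n. (h n)\<^sup>2)
       = (\<Sum>n<K. \<Sum>p<B. \<Sum>q<B. g (n + a p) * g (n + a q)) / real (B ^ 2) / real K"
      by (simp add: mean_def sum_divide_distrib)
    also have "(\<Sum>n<K. \<Sum>p<B. \<Sum>q<B. g (n + a p) * g (n + a q))
       = (\<Sum>p<B. \<Sum>q<B. \<Sum>n<K. g (n + a p) * g (n + a q))"
      by (subst sum.swap, rule sum.cong [OF refl], subst sum.swap, rule refl)
    finally show ?thesis by (simp add: mean_def sum_divide_distrib mult.commute)
  qed
  finally show ?thesis by simp
qed

lemma sum_PiE_insert:
  assumes "x \<notin> I"
  shows "(\<Sum>c\<in>PiE (insert x I) T. \<phi> c) = (\<Sum>y\<in>T x. \<Sum>c\<in>PiE I T. \<phi> (c(x := y)))"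
  unfolding PiE_insert_eq sum.cartesian_product
  by (subst sum.reindex[OF inj_combinator[OF assms]]) (simp add: case_prod_unfold)

lemma sum_box_Suc:
  "(\<Sum>c\<in>box (Suc d) B. \<phi> c)
   = (\<Sum>c\<in>box d B. \<Sum>p<B. \<Sum>q<B. \<phi> (c((d, True) := q, (d, False) := p)))"
proof -
  have eq: "{..<Suc d} \<times> (UNIV :: bool set) = insert (d, False) (insert (d, True) ({..<d} \<times> UNIV))"
    by (auto simp: less_Suc_eq)
  have "(\<Sum>c\<in>box (Suc d) B. \<phi> c)
    = (\<Sum>p<B. \<Sum>q<B. \<Sum>c\<in>box d B. \<phi> (c((d, True) := q, (d, False) := p)))"
    unfolding eq by (subst sum_PiE_insert, simp, subst sum_PiE_insert, auto)
  also have "\<dots> = (\<Sum>p<B. \<Sum>c\<in>box d B. \<Sum>q<B. \<phi> (c((d, True) := q, (d, False) := p)))"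
    by (rule sum.cong [OF refl], rule sum.swap)
  also have "\<dots> = (\<Sum>c\<in>box d B. \<Sum>p<B. \<Sum>q<B. \<phi> (c((d, True) := q, (d, False) := p)))"
    by (rule sum.swap)
  finally show ?thesis .
qed

definition shift_sum :: "nat \<Rightarrow> (nat \<Rightarrow> nat \<Rightarrow> nat) \<Rightarrow> (nat \<times> bool \<Rightarrow> nat) \<Rightarrow> nat set \<Rightarrow> nat" where
  "shift_sum d a c E = corner_sum d (\<lambda>j b. a j (c (j, b))) E"

text \<open>
  The inequality for a new direction is applied to the products over the cubes of the previous directions, after
  squaring the bound obtained so far and using the Cauchy--Schwarz inequality for the average over the cubes.
  Since all quantities are at most \<open>1\<close>, squaring only doubles the error; hence the constant satisfies
  \<open>e(d + 1) = 2 e(d) + 4\<close>.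
\<close>

theorem iterated_van_der_Corput:
  assumes g: "\<And>n. \<bar>g n\<bar> \<le> 1" and B: "B > 0" and K: "K > 0"
    and a: "\<And>j b. j < d \<Longrightarrow> b < B \<Longrightarrow> a j b \<le> A"
  shows "\<bar>mean K g\<bar> ^ (2 ^ d)
    \<le> \<bar>\<Sum>c\<in>box d B. mean K (\<lambda>n. \<Prod>E\<in>Pow {..<d}. g (n + shift_sum d a c E))\<bar> / real (B ^ (2 * d))
      + (2 ^ (d + 2) - 4) * real A / real K"
  using a
proof (induction d)
  case 0
  show ?case by (simp add: shift_sum_def corner_sum_def)
next
  case (Suc d)
  define G where "G c n = (\<Prod>E\<in>Pow {..<d}. g (n + shift_sum d a c E))" for c n
  define W where "W = (\<Sum>c\<in>box d B. mean K (G c)) / real (B ^ (2 * d))"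
  define y where "y = \<bar>mean K g\<bar> ^ (2 ^ d)"
  define e where "e = (2 ^ (d + 2) - 4) * real A / real K"
  have "(2::real) ^ 2 \<le> 2 ^ (d + 2)" by (rule power_increasing) auto
  then have e0: "e \<ge> 0" by (simp add: e_def)
  have y: "0 \<le> y" "y \<le> 1"
  proof -
    show "0 \<le> y" unfolding y_def by (rule zero_le_power[OF abs_ge_zero])
    show "y \<le> 1" unfolding y_def by (rule power_le_one[OF abs_ge_zero abs_mean_le_1[of g K]]) (rule g)
  qed
  have G1: "\<bar>G c n\<bar> \<le> 1" for c n
    unfolding G_def abs_prod using g by (intro prod_le_1) auto
  have N0: "real (B ^ (2 * d)) > 0" using B by simp
  have W1: "\<bar>W\<bar> \<le> 1"
  proof -
    have "\<bar>\<Sum>c\<in>box d B. mean K (G c)\<bar> \<le> (\<Sum>c\<in>box d B. \<bar>mean K (G c)\<bar>)" by (rule sum_abs)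
    also have "\<dots> \<le> real (card (box d B)) * 1"
      using G1 by (intro sum_bounded_above abs_mean_le_1) auto
    finally show ?thesis using N0 by (simp add: W_def card_box abs_mult field_simps)
  qed
  have yW: "y \<le> \<bar>W\<bar> + e"
    using Suc.IH Suc.prems unfolding y_def W_def G_def e_def abs_divide by auto
  have "y\<^sup>2 \<le> W\<^sup>2 + 2 * e"
  proof (cases "y \<le> \<bar>W\<bar>")
    case True
    then have "y\<^sup>2 \<le> \<bar>W\<bar>\<^sup>2" using y by (intro power_mono) auto
    then show ?thesis using e0 by simp
  next
    case False
    have "y\<^sup>2 \<le> \<bar>W\<bar>\<^sup>2 + 2 * e" using y W1 False yW by (intro power2_diff_le) auto
    then show ?thesis by simp
  qed
  also have "W\<^sup>2 \<le> (\<Sum>c\<in>box d B. (mean K (G c))\<^sup>2) / real (B ^ (2 * d))"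
  proof -
    have "(\<Sum>c\<in>box d B. mean K (G c))\<^sup>2 \<le> real (B ^ (2 * d)) * (\<Sum>c\<in>box d B. (mean K (G c))\<^sup>2)"
      using sum_squared_le_sum_of_squares[of "\<lambda>c. mean K (G c)" "box d B"] by (simp add: card_box mult.commute)
    then have "W\<^sup>2 \<le> real (B ^ (2 * d)) * (\<Sum>c\<in>box d B. (mean K (G c))\<^sup>2) / (real (B ^ (2 * d)))\<^sup>2"
      unfolding W_def power_divide by (rule divide_right_mono) simp
    also have "\<dots> = (\<Sum>c\<in>box d B. (mean K (G c))\<^sup>2) / real (B ^ (2 * d))"
      using N0 by (simp only: power2_eq_square[of "real (B ^ (2 * d))"]) simp
    finally show ?thesis .
  qed
  also have "(\<Sum>c\<in>box d B. (mean K (G c))\<^sup>2) / real (B ^ (2 * d)) \<le>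
     (\<Sum>c\<in>box d B. (\<Sum>p<B. \<Sum>q<B. mean K (\<lambda>n. G c (n + a d p) * G c (n + a d q))) / real (B ^ 2)
           + 4 * real A / real K) / real (B ^ (2 * d))"
    using G1 B K Suc.prems by (intro divide_right_mono sum_mono van_der_Corput) auto
  also have "\<dots> = (\<Sum>c\<in>box d B. \<Sum>p<B. \<Sum>q<B. mean K (\<lambda>n. G c (n + a d p) * G c (n + a d q))) / real (B ^ (2 * Suc d))
       + 4 * real A / real K"
    using B by (simp add: sum.distrib card_box add_divide_distrib power2_eq_square mult_ac flip: sum_divide_distrib)
  also have "(\<Sum>c\<in>box d B. \<Sum>p<B. \<Sum>q<B. mean K (\<lambda>n. G c (n + a d p) * G c (n + a d q)))
     = (\<Sum>c\<in>box (Suc d) B. mean K (\<lambda>n. \<Prod>E\<in>Pow {..<Suc d}. g (n + shift_sum (Suc d) a c E)))"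
    unfolding sum_box_Suc
  proof (intro sum.cong refl arg_cong[where f = "mean K"] ext)
    fix c :: "nat \<times> bool \<Rightarrow> nat" and p q n :: nat
    let ?c = "c((d, True) := q, (d, False) := p)"
    have 1: "shift_sum (Suc d) a ?c E = a d p + shift_sum d a c E" if "E \<in> Pow {..<d}" for E
      using that by (auto simp: shift_sum_def corner_sum_def intro!: sum.cong)
    have 2: "shift_sum (Suc d) a ?c (insert d E) = a d q + shift_sum d a c E" if "E \<in> Pow {..<d}" for E
      using that by (auto simp: shift_sum_def corner_sum_def intro!: sum.cong)
    show "G c (n + a d p) * G c (n + a d q) = (\<Prod>E\<in>Pow {..<Suc d}. g (n + shift_sum (Suc d) a ?c E))"
      unfolding prod_Pow_lessThan_Suc G_def prod.distrib [symmetric]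
      by (rule prod.cong) (simp_all add: 1 2 add.assoc)
  qed
  finally have "y\<^sup>2 \<le> (\<Sum>c\<in>box (Suc d) B. mean K (\<lambda>n. \<Prod>E\<in>Pow {..<Suc d}. g (n + shift_sum (Suc d) a c E)))
       / real (B ^ (2 * Suc d)) + 4 * real A / real K + 2 * e" by simp
  moreover have "y\<^sup>2 = \<bar>mean K g\<bar> ^ (2 ^ Suc d)"
    by (simp add: y_def mult.commute flip: power_mult)
  moreover have "4 * real A / real K + 2 * e = (2 ^ (Suc d + 2) - 4) * real A / real K"
    by (cases "K = 0") (simp_all add: e_def field_simps)
  moreover have "v / real (B ^ (2 * Suc d)) \<le> \<bar>v\<bar> / real (B ^ (2 * Suc d))" for v
    by (intro divide_right_mono abs_ge_self) simp
  ultimately show ?case by (smt (verit))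
qed

section \<open>Cancellation of the high digits\<close>

definition near_multiple :: "real \<Rightarrow> nat \<Rightarrow> real \<Rightarrow> bool" where
  "near_multiple \<delta> l x \<longleftrightarrow> (\<exists>M::int. \<bar>x - of_int M * 2 ^ l\<bar> \<le> \<delta> * 2 ^ l)"

lemma floor_stable:
  fixes u v :: real
  assumes far: "\<And>k::int. \<bar>u - of_int k\<bar> > \<delta>" and close: "\<bar>v - u - of_int m\<bar> \<le> \<delta>"
  shows "\<lfloor>v\<rfloor> = \<lfloor>u\<rfloor> + m"
proof (rule floor_unique)
  have "u - of_int \<lfloor>u\<rfloor> > \<delta>" using far[of "\<lfloor>u\<rfloor>"] by linarith
  then show "of_int (\<lfloor>u\<rfloor> + m) \<le> v" using close by simp
  have "of_int (\<lfloor>u\<rfloor> + 1) - u > \<delta>" using far[of "\<lfloor>u\<rfloor> + 1"] by linarith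
  then show "v < of_int (\<lfloor>u\<rfloor> + m) + 1" using close by simp
qed

text \<open>
  Adding an approximate multiple of \<open>2 ^ b\<close> adds the expected multiple of \<open>2 ^ (b - a)\<close> to the number formed by the
  digits from position \<open>a\<close> on, and no carry crosses position \<open>a\<close>, provided that \<open>x\<close> keeps a distance from the
  multiples of \<open>2 ^ a\<close>.
\<close>

lemma floor_scaled_stable:
  assumes far: "\<not> near_multiple \<delta> a x" and close: "\<bar>y - x - of_int M * 2 ^ b\<bar> \<le> \<delta> * 2 ^ a" and ab: "a \<le> b"
  shows "\<lfloor>y / 2 ^ a\<rfloor> = \<lfloor>x / 2 ^ a\<rfloor> + M * 2 ^ (b - a)"
proof (rule floor_stable)
  have b: "(2::real) ^ b = 2 ^ (b - a) * 2 ^ a" using ab by (simp flip: power_add)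
  show "\<bar>x / 2 ^ a - of_int k\<bar> > \<delta>" for k :: int
  proof -
    have "\<bar>x - of_int k * 2 ^ a\<bar> > \<delta> * 2 ^ a" using far by (auto simp: near_multiple_def not_le)
    moreover have "x - of_int k * 2 ^ a = (x / 2 ^ a - of_int k) * 2 ^ a" by (simp add: field_simps)
    ultimately show ?thesis by (simp add: abs_mult)
  qed
  have "y - x - of_int M * 2 ^ b = (y / 2 ^ a - x / 2 ^ a - of_int (M * 2 ^ (b - a))) * 2 ^ a"
    unfolding b by (simp add: field_simps)
  then show "\<bar>y / 2 ^ a - x / 2 ^ a - of_int (M * 2 ^ (b - a))\<bar> \<le> \<delta>"
    using close by (simp add: abs_mult)
qed

text \<open>
  The part of \<open>tm \<lfloor>x\<rfloor>\<close> contributed by the binary digits at the positions \<open>a, \<dots>, b - 1\<close>.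
\<close>

definition digit_block :: "nat \<Rightarrow> nat \<Rightarrow> real \<Rightarrow> real" where
  "digit_block a b x = tm (nat (\<lfloor>x / 2 ^ a\<rfloor> mod 2 ^ (b - a)))"

lemma tm_split_block:
  assumes x: "x \<ge> 0" and ab: "a \<le> b"
  shows "tm (nat \<lfloor>x / 2 ^ a\<rfloor>) = digit_block a b x * tm (nat \<lfloor>x / 2 ^ b\<rfloor>)"
proof -
  have "(2::real) ^ b = 2 ^ a * of_int (2 ^ (b - a))" using ab by (simp flip: power_add)
  then have "x / 2 ^ b = (x / 2 ^ a) / of_int (2 ^ (b - a))" by simp
  then have "\<lfloor>x / 2 ^ b\<rfloor> = \<lfloor>x / 2 ^ a\<rfloor> div 2 ^ (b - a)"
    by (simp only:) (rule floor_divide_real_eq_div, simp)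
  moreover have "0 \<le> \<lfloor>x / 2 ^ a\<rfloor>" using x by simp
  ultimately show ?thesis
    using tm_split[of "nat \<lfloor>x / 2 ^ a\<rfloor>" "b - a"]
    by (simp add: digit_block_def nat_div_distrib nat_mod_distrib nat_power_eq mult.commute)
qed

lemma tm_split_blocks:
  assumes "x \<ge> 0"
  shows "tm (nat \<lfloor>x / 2 ^ \<nu>\<rfloor>) =
    (\<Prod>i<p. digit_block (\<nu> + i * \<mu>) (\<nu> + Suc i * \<mu>) x) * tm (nat \<lfloor>x / 2 ^ (\<nu> + p * \<mu>)\<rfloor>)"
proof (induction p)
  case (Suc p)
  then show ?case
    using tm_split_block[OF assms, of "\<nu> + p * \<mu>" "\<nu> + Suc p * \<mu>"] by (simp add: mult.assoc)
qed simp

lemma digit_block_cong: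
  assumes "\<not> near_multiple \<delta> a x" "\<bar>y - x - of_int M * 2 ^ b\<bar> \<le> \<delta> * 2 ^ a" "a \<le> b"
  shows "digit_block a b y = digit_block a b x"
  using floor_scaled_stable[OF assms] by (simp add: digit_block_def)

text \<open>
  A sign that is insensitive to one of the directions occurs an even number of times in the product over the cube.
\<close>

lemma prod_Pow_eq_1:
  fixes \<phi> :: "nat set \<Rightarrow> real"
  assumes "j < d" and sq: "\<And>E. \<phi> E * \<phi> E = 1"
    and inv: "\<And>E. E \<in> Pow {..<d} \<Longrightarrow> j \<notin> E \<Longrightarrow> \<phi> (insert j E) = \<phi> E"
  shows "(\<Prod>E\<in>Pow {..<d}. \<phi> E) = 1"
proof -
  have "{..<d} = insert j ({..<d} - {j})" using assms by auto
  then have "(\<Prod>E\<in>Pow {..<d}. \<phi> E) = (\<Prod>E\<in>Pow ({..<d} - {j}). \<phi> E * \<phi> (insert j E))"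
    using prod_Pow_insert[of "{..<d} - {j}" j \<phi>] by simp
  also have "\<dots> = (\<Prod>E\<in>Pow ({..<d} - {j}). 1)"
  proof (rule prod.cong)
    fix E assume "E \<in> Pow ({..<d} - {j})"
    then have "E \<in> Pow {..<d}" "j \<notin> E" by auto
    then show "\<phi> E * \<phi> (insert j E) = 1" by (simp add: inv sq)
  qed simp
  finally show ?thesis by simp
qed

lemma shift_sum_insert:
  assumes "j < d" "j \<notin> E"
  shows "real (shift_sum d a c (insert j E)) - real (shift_sum d a c E)
       = real (a j (c (j, True))) - real (a j (c (j, False)))"
proof -
  have "real (shift_sum d a c E') = real (a j (c (j, j \<in> E'))) + (\<Sum>i\<in>{..<d} - {j}. real (a i (c (i, i \<in> E'))))" for E'
    unfolding shift_sum_def corner_sum_def of_nat_sum using assms by (intro sum.remove) auto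
  moreover have "(\<Sum>i\<in>{..<d} - {j}. real (a i (c (i, i \<in> insert j E)))) = (\<Sum>i\<in>{..<d} - {j}. real (a i (c (i, i \<in> E))))"
    by (rule sum.cong) auto
  ultimately show ?thesis using assms by simp
qed

lemma mod_add_no_overflow:
  fixes v q :: int
  assumes "v mod 2 ^ L + int s < 2 ^ L"
  shows "nat ((v + int s + q * 2 ^ L) mod 2 ^ L) = nat (v mod 2 ^ L) + s"
proof -
  have "(v + int s + q * 2 ^ L) mod 2 ^ L = (v mod 2 ^ L + int s) mod 2 ^ L"
    by (simp add: mod_simps)
  also have "\<dots> = v mod 2 ^ L + int s" using assms by (intro mod_pos_pos_trivial) auto
  finally show ?thesis by (simp add: nat_add_distrib)
qed

text \<open>
  The digits are cut into the lowest \<open>L\<close>, those from \<open>L\<close> to \<open>\<nu>\<close>, then \<open>p\<close> blocks of length \<open>\<mu>\<close>, and the rest. By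
  \<open>prod_Pow_eq_1\<close> it suffices to name for each part above \<open>L\<close> a direction in which it does not change: direction
  \<open>Suc i\<close> for the \<open>i\<close>-th block (assumption \<open>mid\<close>) and direction \<open>0\<close> for the other two (\<open>bot\<close> and \<open>top\<close>). The
  lowest digits see the shift indexed by \<open>b\<close> as a translation by \<open>b\<close>. The factor \<open>3\<close> in the hypotheses \<open>far\<close>
  and \<open>far0\<close> leaves room for two shifts and the deviations of \<open>x\<close> from linearity.
\<close>

theorem cube_product_digit_reduction:
  fixes x :: "nat \<Rightarrow> real"
  assumes d: "d = Suc p"
    and x0: "\<And>n. x n \<ge> 0"
    and lin: "\<And>n. n < 2 * K \<Longrightarrow> \<bar>x n - \<beta> - real n * \<alpha>\<bar> \<le> \<tau>"
    and \<alpha>: "\<alpha> \<ge> 0" and \<tau>: "\<tau> > 0" "real (d + 2) * \<tau> \<le> \<delta>"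
    and L: "real (d * B + 1) \<le> \<delta> * 2 ^ L" "L \<le> \<nu>"
    and a: "\<And>j b. j < d \<Longrightarrow> b < B \<Longrightarrow> a j b \<le> A" and A: "d * A \<le> K"
    and top: "\<And>b. b < B \<Longrightarrow> real (a 0 b) * \<alpha> \<le> \<delta> * 2 ^ (\<nu> + p * \<mu>)"
    and bot: "\<And>b. b < B \<Longrightarrow> \<exists>M::int. \<bar>real (a 0 b) * \<alpha> - real b - of_int M * 2 ^ \<nu>\<bar> \<le> \<tau>"
    and mid: "\<And>i b. i < p \<Longrightarrow> b < B \<Longrightarrow>
       \<exists>M::int. \<bar>real (a (Suc i) b) * \<alpha> - of_int M * 2 ^ (\<nu> + Suc i * \<mu>)\<bar> \<le> \<delta> * 2 ^ (\<nu> + i * \<mu>)"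
    and mid': "\<And>i b. i < p \<Longrightarrow> b < B \<Longrightarrow> \<exists>M::int. \<bar>real (a (Suc i) b) * \<alpha> - real b - of_int M * 2 ^ L\<bar> \<le> \<tau>"
    and c: "c \<in> box d B" and n: "n < K"
    and far: "\<And>E l. E \<in> Pow {..<d} \<Longrightarrow> l \<in> {0, L} \<union> (\<lambda>i. \<nu> + i * \<mu>) ` {..p} \<Longrightarrow>
       \<not> near_multiple (3 * \<delta>) l (x (n + shift_sum d a c E))"
    and far0: "\<And>l. l \<in> {0, L} \<Longrightarrow> \<not> near_multiple (3 * \<delta>) l (x n)"
  shows "(\<Prod>E\<in>Pow {..<d}. tm (nat \<lfloor>x (n + shift_sum d a c E)\<rfloor>))
       = (\<Prod>E\<in>Pow {..<d}. tm (nat (\<lfloor>x n\<rfloor> mod 2 ^ L) + corner_sum d (curry c) E))"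
proof -
  have cB: "c (j, b) < B" if "j < d" for j b using c that by (force simp: PiE_iff)
  have aA: "a j (c (j, b)) \<le> A" if "j < d" for j b using a cB that by blast
  define s where "s E = shift_sum d a c E" for E
  define z where "z E = x (n + s E)" for E
  have s_le: "n + s E < 2 * K" for E
  proof -
    have "s E \<le> (\<Sum>j<d. A)" unfolding s_def shift_sum_def corner_sum_def by (rule sum_mono) (simp add: aA)
    then show ?thesis using n A by simp
  qed
  have zx: "\<bar>z E - x n - real (s E) * \<alpha>\<bar> \<le> 2 * \<tau>" for E
    using lin[OF s_le[of E]] lin[of n] n by (simp add: z_def algebra_simps)
  have zz: "\<bar>z (insert j E) - z E - (real (a j (c (j, True))) * \<alpha> - real (a j (c (j, False))) * \<alpha>)\<bar> \<le> 2 * \<tau>"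
    if "j < d" "j \<notin> E" for j E
  proof -
    have "real (s (insert j E)) * \<alpha> - real (s E) * \<alpha> = real (a j (c (j, True))) * \<alpha> - real (a j (c (j, False))) * \<alpha>"
      using shift_sum_insert[OF that, of a c] unfolding s_def by (simp flip: left_diff_distrib)
    then show ?thesis
      using lin[OF s_le[of E]] lin[OF s_le[of "insert j E"]] by (simp add: z_def algebra_simps)
  qed
  have dd: "real (d + 2) * \<tau> = real d * \<tau> + 2 * \<tau>" by (simp add: algebra_simps)
  have d1: "1 * \<tau> \<le> real d * \<tau>" using \<tau> d by (intro mult_right_mono) auto
  have \<tau>\<delta>: "2 * \<tau> \<le> \<delta>" "0 < \<delta>" using \<tau> dd d1 by linarith+
  have up: "\<delta> \<le> \<delta> * 2 ^ l" for l :: nat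
    using \<tau>\<delta> by (simp add: mult_le_cancel_left1)
  \<comment> \<open>Modulo \<open>2 ^ L\<close> every shift is an integer up to an error \<open>\<tau>\<close>; the errors do not cross an integer because
     \<open>x n\<close> is not near one, and the sum of the shifts does not overflow \<open>L\<close> digits because
     \<open>x n\<close> is not near a multiple of \<open>2 ^ L\<close>.\<close>
  have low: "digit_block 0 L (z E) = tm (nat (\<lfloor>x n\<rfloor> mod 2 ^ L) + corner_sum d (curry c) E)" for E
  proof -
    have "\<exists>M::int. \<bar>real (a j (c (j, j \<in> E))) * \<alpha> - real (c (j, j \<in> E)) - of_int M * 2 ^ L\<bar> \<le> \<tau>" if j: "j < d" for j
    proof (cases j)
      case 0
      obtain M :: int where "\<bar>real (a 0 (c (0, 0 \<in> E))) * \<alpha> - real (c (0, 0 \<in> E)) - of_int M * 2 ^ \<nu>\<bar> \<le> \<tau>"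
        using bot[of "c (0, 0 \<in> E)"] cB j 0 by blast
      moreover have "of_int M * 2 ^ \<nu> = of_int (M * 2 ^ (\<nu> - L)) * (2::real) ^ L"
        using L by (simp flip: power_add)
      ultimately show ?thesis unfolding 0 by metis
    next
      case (Suc i)
      then show ?thesis using mid'[of i "c (j, j \<in> E)"] cB j d by simp
    qed
    then obtain M :: "nat \<Rightarrow> int" where
      M: "\<bar>real (a j (c (j, j \<in> E))) * \<alpha> - real (c (j, j \<in> E)) - of_int (M j) * 2 ^ L\<bar> \<le> \<tau>" if "j < d" for j
      by metis
    define Q where "Q = (\<Sum>j<d. M j)"
    have "real (s E) * \<alpha> - real (corner_sum d (curry c) E) - of_int Q * 2 ^ L
       = (\<Sum>j<d. real (a j (c (j, j \<in> E))) * \<alpha> - real (c (j, j \<in> E)) - of_int (M j) * 2 ^ L)"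
      by (simp add: s_def shift_sum_def corner_sum_def Q_def sum_subtractf sum_distrib_right)
    also have "\<bar>\<dots>\<bar> \<le> (\<Sum>j<d. \<tau>)"
      by (rule order_trans[OF sum_abs sum_mono]) (use M in auto)
    finally have "\<bar>z E - x n - of_int (int (corner_sum d (curry c) E) + Q * 2 ^ L) * 2 ^ 0\<bar> \<le> (3 * \<delta>) * 2 ^ 0"
      using zx[of E] \<tau> dd \<tau>\<delta> by simp
    from floor_scaled_stable[OF far0 this] 
    have fl: "\<lfloor>z E\<rfloor> = \<lfloor>x n\<rfloor> + int (corner_sum d (curry c) E) + Q * 2 ^ L" by simp
    have "corner_sum d (curry c) E \<le> (\<Sum>j<d. B)"
      unfolding corner_sum_def by (rule sum_mono) (use cB in \<open>auto simp: less_imp_le\<close>)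
    then have cs: "real (corner_sum d (curry c) E) \<le> real (d * B)" by (simp flip: of_nat_mult)
    have "\<lfloor>x n\<rfloor> mod 2 ^ L + int (corner_sum d (curry c) E) < 2 ^ L"
    proof -
      define q where "q = \<lfloor>x n\<rfloor> div 2 ^ L"
      define r where "r = \<lfloor>x n\<rfloor> mod 2 ^ L"
      have qr: "\<lfloor>x n\<rfloor> = q * 2 ^ L + r" "r < 2 ^ L"
        by (simp_all only: q_def r_def div_mult_mod_eq) simp
      have "\<bar>x n - of_int (q + 1) * 2 ^ L\<bar> > 3 * \<delta> * 2 ^ L"
        using far0[of L] unfolding near_multiple_def not_ex not_le by blast
      moreover have "x n < of_int (q * 2 ^ L + r) + 1" using qr(1) by linarith
      then have "x n < of_int (q * 2 ^ L + r + 1)" by simp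
      moreover have "of_int (q * 2 ^ L + r + 1) \<le> (of_int ((q + 1) * 2 ^ L) :: real)"
        unfolding of_int_le_iff using qr(2) by (simp add: algebra_simps)
      moreover have "of_int (q * 2 ^ L + r) \<le> x n" using qr(1) by linarith
      ultimately have "of_int (q + 1) * 2 ^ L - of_int (q * 2 ^ L + r) > 3 * (\<delta> * 2 ^ L)"
        by simp
      then have "2 ^ L - of_int r > \<delta> * 2 ^ L" using mult_pos_pos[OF \<tau>\<delta>(2), of "2 ^ L"]
        unfolding of_int_mult of_int_add of_int_power of_int_numeral of_int_1 by (simp add: algebra_simps)
      then have "of_int (r + int (corner_sum d (curry c) E)) < (of_int (2 ^ L) :: real)" using cs L by simp
      then show ?thesis unfolding of_int_less_iff r_def .
    qed
    from mod_add_no_overflow[OF this, of Q] show ?thesis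
      by (simp add: digit_block_def fl)
  qed
  \<comment> \<open>Direction \<open>0\<close> leaves the digits from \<open>L\<close> to \<open>\<nu>\<close> alone since it moves by \<open>b\<close> modulo \<open>2 ^ \<nu>\<close>, and the
     digits above the top since it moves by little in absolute value.\<close>
  have block_sq: "digit_block a b y * digit_block a b y = 1" for a b y by (simp add: digit_block_def)
  have lowmid: "(\<Prod>E\<in>Pow {..<d}. digit_block L \<nu> (z E)) = 1"
  proof (rule prod_Pow_eq_1[of 0])
    fix E assume E: "E \<in> Pow {..<d}" "0 \<notin> E"
    have b: "c (0, True) < B" "c (0, False) < B" using cB d by auto
    obtain M M' :: int where M:
      "\<bar>real (a 0 (c (0, True))) * \<alpha> - real (c (0, True)) - of_int M * 2 ^ \<nu>\<bar> \<le> \<tau>"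
      "\<bar>real (a 0 (c (0, False))) * \<alpha> - real (c (0, False)) - of_int M' * 2 ^ \<nu>\<bar> \<le> \<tau>"
      using bot b by blast
    have "1 * real B \<le> real d * real B" using d by (intro mult_right_mono) auto
    then have "real B + 4 * \<tau> \<le> 3 * \<delta> * 2 ^ L"
      using L(1) \<tau>\<delta> up[of L] unfolding of_nat_add of_nat_mult by linarith
    moreover have "\<bar>real (c (0, True)) - real (c (0, False))\<bar> \<le> real B" using b by linarith
    ultimately have "\<bar>z (insert 0 E) - z E - of_int (M - M') * 2 ^ \<nu>\<bar> \<le> 3 * \<delta> * 2 ^ L"
      using zz[of 0 E] E(2) M d by (simp add: left_diff_distrib)
    moreover have "\<not> near_multiple (3 * \<delta>) L (z E)" using far[OF E(1), of L] by (simp add: z_def s_def)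
    ultimately show "digit_block L \<nu> (z (insert 0 E)) = digit_block L \<nu> (z E)"
      using L(2) by (intro digit_block_cong)
  qed (use d block_sq in auto)
  have mids: "(\<Prod>E\<in>Pow {..<d}. digit_block (\<nu> + i * \<mu>) (\<nu> + Suc i * \<mu>) (z E)) = 1" if i: "i < p" for i
  proof (rule prod_Pow_eq_1[of "Suc i"])
    fix E assume E: "E \<in> Pow {..<d}" "Suc i \<notin> E"
    have b: "c (Suc i, True) < B" "c (Suc i, False) < B" using cB d i by auto
    obtain M M' :: int where M:
      "\<bar>real (a (Suc i) (c (Suc i, True))) * \<alpha> - of_int M * 2 ^ (\<nu> + Suc i * \<mu>)\<bar> \<le> \<delta> * 2 ^ (\<nu> + i * \<mu>)"
      "\<bar>real (a (Suc i) (c (Suc i, False))) * \<alpha> - of_int M' * 2 ^ (\<nu> + Suc i * \<mu>)\<bar> \<le> \<delta> * 2 ^ (\<nu> + i * \<mu>)"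
      using mid[OF i] b by blast
    have "\<bar>z (insert (Suc i) E) - z E - (of_int M - of_int M') * 2 ^ (\<nu> + Suc i * \<mu>)\<bar> \<le> 3 * \<delta> * 2 ^ (\<nu> + i * \<mu>)"
      using zz[of "Suc i" E] E(2) M d i \<tau>\<delta> up[of "\<nu> + i * \<mu>"] unfolding left_diff_distrib by linarith
    then have "\<bar>z (insert (Suc i) E) - z E - of_int (M - M') * 2 ^ (\<nu> + Suc i * \<mu>)\<bar> \<le> 3 * \<delta> * 2 ^ (\<nu> + i * \<mu>)"
      by simp
    note close = this
    have "\<nu> + i * \<mu> \<in> {0, L} \<union> (\<lambda>i. \<nu> + i * \<mu>) ` {..p}"
      using i by (intro UnI2 imageI) simp
    from far[OF E(1) this] have "\<not> near_multiple (3 * \<delta>) (\<nu> + i * \<mu>) (z E)"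
      by (simp add: z_def s_def)
    from digit_block_cong[OF this close] show "digit_block (\<nu> + i * \<mu>) (\<nu> + Suc i * \<mu>) (z (insert (Suc i) E)) = digit_block (\<nu> + i * \<mu>) (\<nu> + Suc i * \<mu>) (z E)"
      by simp
  qed (use d i block_sq in auto)
  have tops: "(\<Prod>E\<in>Pow {..<d}. tm (nat \<lfloor>z E / 2 ^ (\<nu> + p * \<mu>)\<rfloor>)) = 1"
  proof (rule prod_Pow_eq_1[of 0])
    fix E assume E: "E \<in> Pow {..<d}" "0 \<notin> E"
    have b: "c (0, True) < B" "c (0, False) < B" using cB d by auto
    have "0 \<le> real (a 0 (c (0, True))) * \<alpha>" "0 \<le> real (a 0 (c (0, False))) * \<alpha>" using \<alpha> by auto
    then have "\<bar>z (insert 0 E) - z E\<bar> \<le> 3 * \<delta> * 2 ^ (\<nu> + p * \<mu>)"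
      using zz[of 0 E] E(2) top[OF b(1)] top[OF b(2)] d \<tau>\<delta> up[of "\<nu> + p * \<mu>"] by linarith
    then have "\<bar>z (insert 0 E) - z E - of_int 0 * 2 ^ (\<nu> + p * \<mu>)\<bar> \<le> 3 * \<delta> * 2 ^ (\<nu> + p * \<mu>)"
      by simp
    then have "\<lfloor>z (insert 0 E) / 2 ^ (\<nu> + p * \<mu>)\<rfloor> = \<lfloor>z E / 2 ^ (\<nu> + p * \<mu>)\<rfloor> + 0 * 2 ^ (\<nu> + p * \<mu> - (\<nu> + p * \<mu>))"
      using far[OF E(1), of "\<nu> + p * \<mu>"] by (intro floor_scaled_stable) (auto simp: z_def s_def)
    then show "tm (nat \<lfloor>z (insert 0 E) / 2 ^ (\<nu> + p * \<mu>)\<rfloor>) = tm (nat \<lfloor>z E / 2 ^ (\<nu> + p * \<mu>)\<rfloor>)"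
      by simp
  qed (use d in auto)
  have "tm (nat \<lfloor>z E\<rfloor>) = digit_block 0 L (z E) * (digit_block L \<nu> (z E) *
     ((\<Prod>i<p. digit_block (\<nu> + i * \<mu>) (\<nu> + Suc i * \<mu>) (z E)) * tm (nat \<lfloor>z E / 2 ^ (\<nu> + p * \<mu>)\<rfloor>)))" for E
  proof -
    have z0: "z E \<ge> 0" by (simp add: z_def x0)
    show ?thesis
      using tm_split_block[OF z0, of 0 L] tm_split_block[OF z0, of L \<nu>] tm_split_blocks[OF z0, of \<nu> \<mu> p] L by simp
  qed
  then have "(\<Prod>E\<in>Pow {..<d}. tm (nat \<lfloor>z E\<rfloor>)) = (\<Prod>E\<in>Pow {..<d}. digit_block 0 L (z E)) *
     ((\<Prod>E\<in>Pow {..<d}. digit_block L \<nu> (z E)) *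
     ((\<Prod>i<p. \<Prod>E\<in>Pow {..<d}. digit_block (\<nu> + i * \<mu>) (\<nu> + Suc i * \<mu>) (z E)) *
      (\<Prod>E\<in>Pow {..<d}. tm (nat \<lfloor>z E / 2 ^ (\<nu> + p * \<mu>)\<rfloor>))))"
    by (simp add: prod.distrib prod.swap[of _ "Pow {..<d}"])
  also have "(\<Prod>i<p. \<Prod>E\<in>Pow {..<d}. digit_block (\<nu> + i * \<mu>) (\<nu> + Suc i * \<mu>) (z E)) = 1"
    by (rule prod.neutral) (use mids in auto)
  finally show ?thesis by (simp add: lowmid tops low flip: z_def s_def)
qed

section \<open>Means along almost linear sequences\<close>

text \<open>
  If two such points lay in the same residue class modulo \<open>h0\<close> at a distance of at most \<open>H h0\<close>, their difference
  would contradict the separation. Therefore the translates of the set of these points by multiples of \<open>h0\<close> are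
  disjoint. The step \<open>h0\<close> is needed for the highest level, where \<open>2 ^ l\<close> exceeds the slope by a constant factor and
  consecutive points are not separated.
\<close>

lemma count_near_of_separated:
  fixes x :: "nat \<Rightarrow> real"
  assumes lin: "\<And>n. n < K \<Longrightarrow> \<bar>x n - \<beta> - real n * \<alpha>\<bar> \<le> \<tau>"
    and h0: "h0 > 0" and \<tau>: "\<tau> \<le> \<delta>" "0 \<le> \<delta>"
    and sep: "\<And>h. 1 \<le> h \<Longrightarrow> h \<le> H \<Longrightarrow> \<not> near_multiple (8 * \<delta>) l (real (h * h0) * \<alpha>)"
  shows "card {n. n < K \<and> near_multiple (3 * \<delta>) l (x n)} * H \<le> K + H * h0"
proof -
  define X where "X = {n. n < K \<and> near_multiple (3 * \<delta>) l (x n)}"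
  have finX: "finite X" by (simp add: X_def)
  have \<tau>l: "\<tau> \<le> \<delta> * 2 ^ l"
    using \<tau> mult_left_mono[of 1 "2 ^ l" \<delta>] by simp
  have no_gap: False if n: "n \<in> X" "n' \<in> X" "n = n' + h * h0" "1 \<le> h" "h \<le> H" for n n' h
  proof -
    obtain M M' :: int where M: "\<bar>x n - of_int M * 2 ^ l\<bar> \<le> 3 * \<delta> * 2 ^ l" "\<bar>x n' - of_int M' * 2 ^ l\<bar> \<le> 3 * \<delta> * 2 ^ l"
      using n by (auto simp: X_def near_multiple_def)
    have "n < K" "n' < K" using n by (auto simp: X_def)
    note b = lin[OF \<open>n < K\<close>] lin[OF \<open>n' < K\<close>]
    have "real (h * h0) * \<alpha> = real n * \<alpha> - real n' * \<alpha>" using n(3) by (simp add: algebra_simps)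
    then have "\<bar>real (h * h0) * \<alpha> - (of_int M * 2 ^ l - of_int M' * 2 ^ l)\<bar> \<le> 3 * \<delta> * 2 ^ l + 3 * \<delta> * 2 ^ l + \<tau> + \<tau>"
      using M b by linarith
    also have "\<dots> \<le> 8 * \<delta> * 2 ^ l" using \<tau>l by linarith
    finally have "\<bar>real (h * h0) * \<alpha> - of_int (M - M') * 2 ^ l\<bar> \<le> 8 * \<delta> * 2 ^ l"
      by (simp add: left_diff_distrib)
    then have "near_multiple (8 * \<delta>) l (real (h * h0) * \<alpha>)" unfolding near_multiple_def by blast
    then show False using sep n by blast
  qed
  have "H * card X = (\<Sum>h<H. card ((\<lambda>n. n + h * h0) ` X))"
    by (simp add: card_image)
  also have "\<dots> = card (\<Union>h<H. (\<lambda>n. n + h * h0) ` X)"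
  proof (rule card_UN_disjoint [symmetric])
    have *: "(\<lambda>n. n + h * h0) ` X \<inter> (\<lambda>n. n + h' * h0) ` X = {}" if "h < h'" "h' < H" for h h'
    proof (rule ccontr)
      assume "\<not> ?thesis"
      then obtain n n' where nn: "n \<in> X" "n' \<in> X" "n + h * h0 = n' + h' * h0" by auto
      have "h' * h0 = (h' - h) * h0 + h * h0" using that by (simp add: diff_mult_distrib)
      then have "n = n' + (h' - h) * h0" using nn(3) by linarith
      moreover have "1 \<le> h' - h" "h' - h \<le> H" using that by linarith+
      ultimately show False by (rule no_gap[OF nn(1,2)])
    qed
    show "\<forall>i\<in>{..<H}. \<forall>j\<in>{..<H}. i \<noteq> j \<longrightarrow> (\<lambda>n. n + i * h0) ` X \<inter> (\<lambda>n. n + j * h0) ` X = {}"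
    proof (intro ballI impI)
      fix i j assume "i \<in> {..<H}" "j \<in> {..<H}" "i \<noteq> j"
      then show "(\<lambda>n. n + i * h0) ` X \<inter> (\<lambda>n. n + j * h0) ` X = {}"
        using *[of i j] *[of j i] by (cases i j rule: linorder_cases) auto
    qed
  qed (use finX in auto)
  also have "\<dots> \<le> card {..<K + H * h0}"
  proof (rule card_mono)
    show "(\<Union>h<H. (\<lambda>n. n + h * h0) ` X) \<subseteq> {..<K + H * h0}"
    proof clarsimp
      fix h n assume "h < H" "n \<in> X"
      then have "n < K" "h * h0 \<le> H * h0" by (auto simp: X_def)
      then show "n + h * h0 < K + H * h0" by linarith
    qed
  qed simp
  finally show ?thesis by (simp add: X_def mult.commute)
qed

text \<open>
  The van der Corput inequality reduces the mean to cubes. For all positions \<open>n\<close> and cubes that avoid the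
  exceptional set \<open>X\<close> the product is one that only depends on \<open>\<lfloor>x n\<rfloor> mod 2 ^ L\<close>; averaged over the cubes it is at most
  \<open>\<epsilon>\<close>. Each exceptional point spoils at most one position per corner, and one position by itself.
\<close>

theorem local_mean_bound:
  fixes x :: "nat \<Rightarrow> real"
  assumes d: "d = Suc p" and K: "K > 0" and B: "B > 0"
    and x0: "\<And>n. x n \<ge> 0"
    and lin: "\<And>n. n < 2 * K \<Longrightarrow> \<bar>x n - \<beta> - real n * \<alpha>\<bar> \<le> \<tau>"
    and \<alpha>: "\<alpha> \<ge> 0" and \<tau>: "\<tau> > 0" "real (d + 2) * \<tau> \<le> \<delta>"
    and L: "real (d * B + 1) \<le> \<delta> * 2 ^ L" "L \<le> \<nu>"
    and a: "\<And>j b. j < d \<Longrightarrow> b < B \<Longrightarrow> a j b \<le> A" and A: "d * A \<le> K"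
    and top: "\<And>b. b < B \<Longrightarrow> real (a 0 b) * \<alpha> \<le> \<delta> * 2 ^ (\<nu> + p * \<mu>)"
    and bot: "\<And>b. b < B \<Longrightarrow> \<exists>M::int. \<bar>real (a 0 b) * \<alpha> - real b - of_int M * 2 ^ \<nu>\<bar> \<le> \<tau>"
    and mid: "\<And>i b. i < p \<Longrightarrow> b < B \<Longrightarrow>
       \<exists>M::int. \<bar>real (a (Suc i) b) * \<alpha> - of_int M * 2 ^ (\<nu> + Suc i * \<mu>)\<bar> \<le> \<delta> * 2 ^ (\<nu> + i * \<mu>)"
    and mid': "\<And>i b. i < p \<Longrightarrow> b < B \<Longrightarrow> \<exists>M::int. \<bar>real (a (Suc i) b) * \<alpha> - real b - of_int M * 2 ^ L\<bar> \<le> \<tau>"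
    and X: "X = {n. n < 2 * K \<and> (\<exists>l\<in>{0, L} \<union> (\<lambda>i. \<nu> + i * \<mu>) ` {..p}. near_multiple (3 * \<delta>) l (x n))}"
    and decay: "\<And>w. \<bar>cube_sum d B (\<lambda>_. w)\<bar> \<le> \<epsilon> * real (B ^ (2 * d))"
  shows "\<bar>mean K (\<lambda>n. tm (nat \<lfloor>x n\<rfloor>))\<bar> ^ (2 ^ d)
     \<le> \<epsilon> + 2 * (2 ^ d + 1) * real (card X) / real K + 2 ^ (d + 2) * real A / real K"
proof -
  define g where "g n = tm (nat \<lfloor>x n\<rfloor>)" for n
  define P where "P c n = (\<Prod>E\<in>Pow {..<d}. g (n + shift_sum d a c E))" for c n
  define Q where "Q c n = (\<Prod>E\<in>Pow {..<d}. tm (nat (\<lfloor>x n\<rfloor> mod 2 ^ L) + corner_sum d (curry c) E))" for c n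
  have finX: "finite X" by (simp add: X)
  have cnt: "(\<Sum>n<K. of_bool (n + s \<in> X)) \<le> real (card X)" for s
  proof -
    have "(\<Sum>n<K. of_bool (n + s \<in> X)) = real (card {n\<in>{..<K}. n + s \<in> X})"
      by (simp add: Int_def)
    also have "card {n\<in>{..<K}. n + s \<in> X} = card ((\<lambda>n. n + s) ` {n\<in>{..<K}. n + s \<in> X})"
      by (simp add: card_image)
    also have "\<dots> \<le> card X" by (rule card_mono[OF finX]) auto
    finally show ?thesis by simp
  qed
  have PQ: "\<bar>P c n - Q c n\<bar> \<le> 2 * ((\<Sum>E\<in>Pow {..<d}. of_bool (n + shift_sum d a c E \<in> X)) + of_bool (n + 0 \<in> X))"
    if c: "c \<in> box d B" and n: "n < K" for c n
  proof (cases "(\<exists>E\<in>Pow {..<d}. n + shift_sum d a c E \<in> X) \<or> n \<in> X")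
    case True
    have "(\<Sum>E\<in>Pow {..<d}. of_bool (n + shift_sum d a c E \<in> X)) + of_bool (n + 0 \<in> X) \<ge> (1::real)"
    proof (cases "n \<in> X")
      case False
      then obtain E0 where "E0 \<in> Pow {..<d}" "n + shift_sum d a c E0 \<in> X" using True by blast
      then show ?thesis
        using member_le_sum[of E0 "Pow {..<d}" "\<lambda>E. of_bool (n + shift_sum d a c E \<in> X) :: real"] by simp
    qed (simp add: sum_nonneg)
    moreover have "\<bar>P c n\<bar> = 1" "\<bar>Q c n\<bar> = 1" by (simp_all add: P_def Q_def g_def abs_prod)
    moreover have "\<bar>P c n - Q c n\<bar> \<le> \<bar>P c n\<bar> + \<bar>Q c n\<bar>" by linarith
    ultimately have "\<bar>P c n - Q c n\<bar> \<le> 2 * 1" "2 * 1 \<le> 2 * ((\<Sum>E\<in>Pow {..<d}. of_bool (n + shift_sum d a c E \<in> X)) + of_bool (n + 0 \<in> X) :: real)"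
      by (simp_all only: mult_le_cancel_left_pos zero_less_numeral)
    then show ?thesis by (rule order_trans)
  next
    case False
    have cB: "c (j, b) < B" if "j < d" for j b using c that by (force simp: PiE_iff)
    have sK: "n + shift_sum d a c E < 2 * K" for E
    proof -
      have "shift_sum d a c E \<le> (\<Sum>j<d. A)"
        unfolding shift_sum_def corner_sum_def by (rule sum_mono) (use a cB in auto)
      then show ?thesis using n A by simp
    qed
    have "P c n = Q c n"
      unfolding P_def Q_def g_def
      by (rule cube_product_digit_reduction[OF d x0 lin \<alpha> \<tau> L a A top bot mid mid' c n])
         (use False sK n in \<open>auto simp: X\<close>)
    then show ?thesis by (simp add: sum_nonneg)
  qed
  have diff: "\<bar>mean K (P c) - mean K (Q c)\<bar> \<le> 2 * (2 ^ d + 1) * real (card X) / real K" if c: "c \<in> box d B" for c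
  proof -
    have "\<bar>(\<Sum>n<K. P c n) - (\<Sum>n<K. Q c n)\<bar> \<le> (\<Sum>n<K. \<bar>P c n - Q c n\<bar>)"
      unfolding sum_subtractf [symmetric] by (rule sum_abs)
    also have "\<dots> \<le> (\<Sum>n<K. 2 * ((\<Sum>E\<in>Pow {..<d}. of_bool (n + shift_sum d a c E \<in> X)) + of_bool (n + 0 \<in> X)))"
      by (rule sum_mono) (use PQ[OF c] in auto)
    also have "\<dots> = 2 * ((\<Sum>E\<in>Pow {..<d}. \<Sum>n<K. of_bool (n + shift_sum d a c E \<in> X)) + (\<Sum>n<K. of_bool (n + 0 \<in> X)))"
      unfolding sum_distrib_left [symmetric] sum.distrib by (subst sum.swap) (rule refl)
    also have "\<dots> \<le> 2 * ((\<Sum>E\<in>Pow {..<d}. real (card X)) + real (card X))"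
      by (intro mult_left_mono add_mono sum_mono cnt) auto
    also have "\<dots> = 2 * (2 ^ d + 1) * real (card X)" by (simp add: card_Pow algebra_simps)
    finally show ?thesis
      using K by (simp add: mean_def divide_right_mono flip: diff_divide_distrib)
  qed
  have Q: "\<bar>\<Sum>c\<in>box d B. mean K (Q c)\<bar> \<le> \<epsilon> * real (B ^ (2 * d))"
  proof -
    have "(\<Sum>c\<in>box d B. mean K (Q c)) = (\<Sum>n<K. cube_sum d B (\<lambda>_. nat (\<lfloor>x n\<rfloor> mod 2 ^ L))) / real K"
      unfolding mean_def cube_sum_def Q_def sum_divide_distrib [symmetric] by (subst sum.swap) (rule refl)
    also have "\<bar>\<dots>\<bar> \<le> (\<Sum>n<K. \<epsilon> * real (B ^ (2 * d))) / real K"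
      unfolding abs_divide abs_of_nat
      by (intro divide_right_mono order_trans[OF sum_abs] sum_mono decay) auto
    finally show ?thesis using K by simp
  qed
  have N0: "real (B ^ (2 * d)) > 0" using B by simp
  have "\<bar>\<Sum>c\<in>box d B. mean K (P c)\<bar> \<le> \<bar>\<Sum>c\<in>box d B. mean K (Q c)\<bar> + (\<Sum>c\<in>box d B. \<bar>mean K (P c) - mean K (Q c)\<bar>)"
    using sum_abs[of "\<lambda>c. mean K (P c) - mean K (Q c)" "box d B"] unfolding sum_subtractf by linarith
  also have "\<dots> \<le> \<epsilon> * real (B ^ (2 * d)) + (\<Sum>c\<in>box d B. 2 * (2 ^ d + 1) * real (card X) / real K)"
    by (intro add_mono Q sum_mono diff)
  also have "\<dots> = (\<epsilon> + 2 * (2 ^ d + 1) * real (card X) / real K) * real (B ^ (2 * d))"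
    by (simp add: card_box algebra_simps)
  finally have main: "\<bar>\<Sum>c\<in>box d B. mean K (P c)\<bar> / real (B ^ (2 * d)) \<le> \<epsilon> + 2 * (2 ^ d + 1) * real (card X) / real K"
    using N0 by (simp only: pos_divide_le_eq)
  have "\<bar>mean K g\<bar> ^ (2 ^ d) \<le> \<bar>\<Sum>c\<in>box d B. mean K (P c)\<bar> / real (B ^ (2 * d)) + (2 ^ (d + 2) - 4) * real A / real K"
    unfolding P_def using a by (intro iterated_van_der_Corput B K) (simp_all add: g_def)
  also have "(2 ^ (d + 2) - 4) * real A / real K \<le> 2 ^ (d + 2) * real A / real K"
    by (intro divide_right_mono mult_right_mono) auto
  finally show ?thesis using main by (simp add: g_def[abs_def])
qed

section \<open>Shifts with prescribed residues\<close>

text \<open>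
  The multiples of \<open>y\<close> move around the circle of length \<open>\<Lambda>\<close> in steps of length at most \<open>\<tau>\<close>, hence come within \<open>\<tau>\<close> of
  every point, and they do so within the first turn. The lower bound on the step limits the number of steps in a turn. A
  negative step reaches \<open>b\<close> from above, starting at \<open>\<Lambda>\<close>.
\<close>

lemma progression_hits_residue:
  fixes y \<Lambda> \<tau> \<kappa> :: real
  assumes lo: "\<bar>y - of_int M * \<Lambda>\<bar> > \<kappa> * \<Lambda>" and hi: "\<bar>y - of_int M * \<Lambda>\<bar> \<le> \<tau>"
    and \<kappa>: "\<kappa> > 0" "1 \<le> real R * \<kappa>" and b: "0 \<le> b" "b \<le> \<Lambda>" and \<Lambda>: "\<Lambda> > 0"
  shows "\<exists>r. r \<le> R \<and> (\<exists>M'::int. \<bar>real r * y - b - of_int M' * \<Lambda>\<bar> \<le> \<tau>)"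
proof -
  define \<eta> where "\<eta> = y - of_int M * \<Lambda>"
  define t where "t = (if \<eta> > 0 then b else \<Lambda> - b)"
  define r where "r = nat \<lfloor>t / \<bar>\<eta>\<bar>\<rfloor>"
  have \<eta>: "\<bar>\<eta>\<bar> > \<kappa> * \<Lambda>" "\<bar>\<eta>\<bar> \<le> \<tau>" using lo hi by (simp_all add: \<eta>_def)
  have \<eta>0: "\<bar>\<eta>\<bar> > 0" using \<eta>(1) \<kappa> \<Lambda> by (smt (verit) mult_pos_pos)
  have t: "0 \<le> t" "t \<le> \<Lambda>" using b by (auto simp: t_def)
  have "0 \<le> \<lfloor>t / \<bar>\<eta>\<bar>\<rfloor>" using t \<eta>0 by simp
  then have rr: "real r = of_int \<lfloor>t / \<bar>\<eta>\<bar>\<rfloor>" by (simp add: r_def)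
  then have "real r \<le> t / \<bar>\<eta>\<bar>" "t / \<bar>\<eta>\<bar> < real r + 1" by linarith+
  then have r: "real r * \<bar>\<eta>\<bar> \<le> t" "t < (real r + 1) * \<bar>\<eta>\<bar>" using \<eta>0 by (simp_all add: field_simps)
  have "real r * (\<kappa> * \<Lambda>) \<le> real r * \<bar>\<eta>\<bar>" using \<eta> by (intro mult_left_mono) auto
  also have "\<dots> \<le> 1 * \<Lambda>" using r t by simp
  also have "\<dots> \<le> (real R * \<kappa>) * \<Lambda>" using \<kappa> \<Lambda> by (intro mult_right_mono) auto
  finally have "real r * (\<kappa> * \<Lambda>) \<le> real R * (\<kappa> * \<Lambda>)" by (simp add: mult.assoc)
  then have "r \<le> R" using \<kappa> \<Lambda> by simp
  moreover have "\<exists>M'::int. \<bar>real r * y - b - of_int M' * \<Lambda>\<bar> \<le> \<tau>"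
  proof (cases "\<eta> > 0")
    case True
    have "real r * y - b - of_int (int r * M) * \<Lambda> = real r * \<eta> - b" by (simp add: \<eta>_def algebra_simps)
    moreover have "\<bar>real r * \<eta> - b\<bar> \<le> \<tau>" using True r \<eta> by (simp add: t_def algebra_simps)
    ultimately show ?thesis by metis
  next
    case False
    have "real r * y - b - of_int (int r * M - 1) * \<Lambda> = real r * \<eta> - b + \<Lambda>" by (simp add: \<eta>_def algebra_simps)
    moreover have "\<bar>real r * \<eta> - b + \<Lambda>\<bar> \<le> \<tau>" using False r \<eta> by (simp add: t_def algebra_simps)
    ultimately show ?thesis by metis
  qed
  ultimately show ?thesis by blast
qed

lemma Dirichlet_nat:
  fixes \<theta> :: real
  assumes "N > 0"
  obtains k :: nat and M :: int where "1 \<le> k" "k \<le> N" "\<bar>real k * \<theta> - of_int M\<bar> < 1 / real N"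
proof -
  obtain h k where "0 < k" "k \<le> int N" "\<bar>of_int k * \<theta> - of_int h\<bar> < 1 / real N"
    using Dirichlet_approx[OF assms, of \<theta>] by metis
  then show ?thesis by (intro that[of "nat k" h]) auto
qed

lemma Dirichlet_scaled:
  fixes y :: real
  assumes "N > 0"
  obtains k :: nat and M :: int where "1 \<le> k" "k \<le> N" "\<bar>real k * y - of_int M * 2 ^ l\<bar> \<le> 2 ^ l / real N"
proof -
  obtain k M where k: "1 \<le> k" "k \<le> N" "\<bar>real k * (y / 2 ^ l) - of_int M\<bar> < 1 / real N"
    using Dirichlet_nat[OF assms] by metis
  have "real k * y - of_int M * 2 ^ l = (real k * (y / 2 ^ l) - of_int M) * 2 ^ l" by (simp add: field_simps)
  then have "\<bar>real k * y - of_int M * 2 ^ l\<bar> = \<bar>real k * (y / 2 ^ l) - of_int M\<bar> * 2 ^ l" by (simp add: abs_mult)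
  also have "\<dots> \<le> 1 / real N * 2 ^ l" using k by (intro mult_right_mono) auto
  finally show ?thesis using that k by simp
qed

text \<open>
  Dirichlet's theorem makes some \<open>h \<alpha>\<close> a short step modulo \<open>2 ^ l\<close>, and the hypothesis on \<open>\<alpha>\<close> prevents it from being too
  short.
\<close>

lemma shifts_mod_one_level:
  fixes \<alpha> :: real
  assumes H: "H > 0" "2 ^ l / real H \<le> \<tau>" and \<kappa>: "\<kappa> > 0" "1 \<le> real R * \<kappa>" and B: "real B \<le> 2 ^ l"
    and good: "\<And>h. 1 \<le> h \<Longrightarrow> h \<le> H \<Longrightarrow> \<not> near_multiple \<kappa> l (real h * \<alpha>)"
  shows "\<exists>a. \<forall>b<B. a b \<le> R * H \<and> (\<exists>M::int. \<bar>real (a b) * \<alpha> - real b - of_int M * 2 ^ l\<bar> \<le> \<tau>)"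
proof -
  obtain h M where h: "1 \<le> h" "h \<le> H" "\<bar>real h * \<alpha> - of_int M * 2 ^ l\<bar> \<le> 2 ^ l / real H"
    using Dirichlet_scaled[OF H(1)] by metis
  have far: "\<bar>real h * \<alpha> - of_int M * 2 ^ l\<bar> > \<kappa> * 2 ^ l" for M :: int
    using good[OF h(1,2)] by (auto simp: near_multiple_def not_le)
  have "\<exists>r. r \<le> R \<and> (\<exists>M'::int. \<bar>real r * (real h * \<alpha>) - real b - of_int M' * 2 ^ l\<bar> \<le> \<tau>)" if "b < B" for b
    using h(3) H that B by (intro progression_hits_residue[where M = M, OF far _ \<kappa>]) auto
  then obtain r where r: "\<And>b. b < B \<Longrightarrow> r b \<le> R \<and> (\<exists>M'::int. \<bar>real (r b) * (real h * \<alpha>) - real b - of_int M' * 2 ^ l\<bar> \<le> \<tau>)"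
    by metis
  show ?thesis
    by (rule exI[of _ "\<lambda>b. r b * h"]) (use r h(2) in \<open>auto simp: mult.assoc intro: mult_le_mono\<close>)
qed

text \<open>
  Dirichlet's theorem is used twice: a first multiple \<open>k0\<close> is nearly \<open>0\<close> modulo \<open>2 ^ l\<close>, and a bounded multiple of it
  is a short step modulo \<open>2 ^ L\<close>. Few repetitions of this step reach all residues modulo \<open>2 ^ L\<close>, and they remain
  nearly \<open>0\<close> modulo \<open>2 ^ l\<close>.
\<close>

lemma shifts_mod_two_levels:
  fixes \<alpha> :: real
  assumes H: "H > 0" "2 ^ L / real H \<le> \<tau>" and Q: "Q > 0"
    and \<kappa>: "\<kappa> > 0" "1 \<le> real R * \<kappa>" and B: "real B \<le> 2 ^ L"
    and fine: "real R * (real H * (2 ^ l / real Q)) \<le> \<delta>"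
    and good: "\<And>k M. 1 \<le> k \<Longrightarrow> k \<le> H * Q \<Longrightarrow> \<bar>real k * \<alpha> - of_int (M::int) * 2 ^ l\<bar> \<le> real H * (2 ^ l / real Q)
       \<Longrightarrow> \<not> near_multiple \<kappa> L (real k * \<alpha>)"
  shows "\<exists>a. \<forall>b<B. a b \<le> R * (H * Q) \<and> (\<exists>M::int. \<bar>real (a b) * \<alpha> - of_int M * 2 ^ l\<bar> \<le> \<delta>)
     \<and> (\<exists>M::int. \<bar>real (a b) * \<alpha> - real b - of_int M * 2 ^ L\<bar> \<le> \<tau>)"
proof -
  obtain k0 M0 where k0: "1 \<le> k0" "k0 \<le> Q" "\<bar>real k0 * \<alpha> - of_int M0 * 2 ^ l\<bar> \<le> 2 ^ l / real Q"
    using Dirichlet_scaled[OF Q] by metis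
  obtain h M where h: "1 \<le> h" "h \<le> H" "\<bar>real h * (real k0 * \<alpha>) - of_int M * 2 ^ L\<bar> \<le> 2 ^ L / real H"
    using Dirichlet_scaled[OF H(1)] by metis
  define k where "k = h * k0"
  have k: "1 \<le> k" "k \<le> H * Q" using k0 h by (simp_all add: k_def mult_le_mono)
  have "real k * \<alpha> - of_int (int h * M0) * 2 ^ l = real h * (real k0 * \<alpha> - of_int M0 * 2 ^ l)"
    by (simp add: k_def algebra_simps)
  then have "\<bar>real k * \<alpha> - of_int (int h * M0) * 2 ^ l\<bar> = real h * \<bar>real k0 * \<alpha> - of_int M0 * 2 ^ l\<bar>"
    by (simp add: abs_mult)
  also have "\<dots> \<le> real H * (2 ^ l / real Q)" using h k0 by (intro mult_mono) auto
  finally have kl: "\<bar>real k * \<alpha> - of_int (int h * M0) * 2 ^ l\<bar> \<le> real H * (2 ^ l / real Q)" .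
  have far: "\<bar>real k * \<alpha> - of_int M * 2 ^ L\<bar> > \<kappa> * 2 ^ L" for M :: int
    using good[OF k kl] by (auto simp: near_multiple_def not_le)
  have "\<exists>r. r \<le> R \<and> (\<exists>M'::int. \<bar>real r * (real k * \<alpha>) - real b - of_int M' * 2 ^ L\<bar> \<le> \<tau>)" if "b < B" for b
    using h(3) H that B by (intro progression_hits_residue[where M = M, OF far _ \<kappa>]) (auto simp: k_def mult.assoc)
  then obtain r where r: "\<And>b. b < B \<Longrightarrow> r b \<le> R \<and> (\<exists>M'::int. \<bar>real (r b) * (real k * \<alpha>) - real b - of_int M' * 2 ^ L\<bar> \<le> \<tau>)"
    by metis
  have "\<bar>real (r b * k) * \<alpha> - of_int (int (r b) * (int h * M0)) * 2 ^ l\<bar> \<le> \<delta>" if "b < B" for b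
  proof -
    have "real (r b * k) * \<alpha> - of_int (int (r b) * (int h * M0)) * 2 ^ l = real (r b) * (real k * \<alpha> - of_int (int h * M0) * 2 ^ l)"
      by (simp add: algebra_simps)
    then have "\<bar>real (r b * k) * \<alpha> - of_int (int (r b) * (int h * M0)) * 2 ^ l\<bar> = real (r b) * \<bar>real k * \<alpha> - of_int (int h * M0) * 2 ^ l\<bar>"
      by (simp only: abs_mult abs_of_nat)
    also have "\<dots> \<le> real R * (real H * (2 ^ l / real Q))" using r[OF that] kl by (intro mult_mono) auto
    finally show ?thesis using fine by linarith
  qed
  moreover have "r b * k \<le> R * (H * Q)" if "b < B" for b using r[OF that] k by (intro mult_le_mono) auto
  moreover have "\<exists>M'::int. \<bar>real (r b * k) * \<alpha> - real b - of_int M' * 2 ^ L\<bar> \<le> \<tau>" if "b < B" for b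
    using r[OF that] by (simp add: mult.assoc)
  ultimately show ?thesis by (intro exI[of _ "\<lambda>b. r b * k"]) blast
qed

section \<open>Counting slopes with bad Diophantine behaviour\<close>

text \<open>
  What is used of the slopes \<open>c n powr (c - 1)\<close> for \<open>N \<le> n < 2 N\<close>. The quotient \<open>D / \<sigma>\<close> is of the order of \<open>N\<close>, so that
  up to boundary effects slopes are counted like points of a set of density \<open>1 / \<sigma>\<close>.
\<close>

locale slowly_increasing =
  fixes \<alpha> :: "nat \<Rightarrow> real" and S :: "nat set" and D \<sigma> :: real
  assumes finite_S: "finite S" and \<sigma>: "\<sigma> > 0" and D: "D > 0"
    and incr: "\<And>m n. m \<in> S \<Longrightarrow> n \<in> S \<Longrightarrow> m < n \<Longrightarrow> \<sigma> * (real n - real m) \<le> \<alpha> n - \<alpha> m"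
    and range: "\<And>n. n \<in> S \<Longrightarrow> D \<le> \<alpha> n \<and> \<alpha> n \<le> 2 * D"
begin

lemma card_interval:
  assumes "w \<ge> 0"
  shows "real (card {n \<in> S. \<bar>\<alpha> n - u\<bar> \<le> w}) \<le> 2 * w / \<sigma> + 1"
proof (cases "{n \<in> S. \<bar>\<alpha> n - u\<bar> \<le> w} = {}")
  case True
  then show ?thesis using assms \<sigma> by (simp only: card.empty) simp
next
  case False
  define T where "T = {n \<in> S. \<bar>\<alpha> n - u\<bar> \<le> w}"
  have T: "finite T" "T \<noteq> {}" using finite_S False by (auto simp: T_def)
  have M: "Max T \<in> T" "Min T \<in> T" using T by auto
  have le: "real (Max T) - real (Min T) \<le> 2 * w / \<sigma>"
  proof (cases "Min T < Max T")
    case True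
    have "\<sigma> * (real (Max T) - real (Min T)) \<le> \<alpha> (Max T) - \<alpha> (Min T)"
      using M True by (intro incr) (auto simp: T_def)
    also have "\<dots> \<le> 2 * w" using M by (auto simp: T_def abs_le_iff)
    finally show ?thesis using \<sigma> by (simp add: field_simps)
  next
    case False
    then show ?thesis using assms \<sigma> by (smt (verit) divide_nonneg_pos of_nat_le_iff not_less)
  qed
  have "T \<subseteq> {Min T..Max T}" using T by auto
  then have "card T \<le> card {Min T..Max T}" by (intro card_mono) auto
  then have "card T \<le> Suc (Max T) - Min T" by simp
  moreover have "Min T \<le> Max T" using T by simp
  ultimately have "real (card T) \<le> real (Max T) - real (Min T) + 1" by linarith
  then show ?thesis using le by (simp add: T_def)
qed

text \<open>
  The condition confines \<open>\<alpha> n\<close> to one interval of length \<open>2 \<rho> 2 ^ l / q\<close> for each multiple of \<open>2 ^ l\<close> in the range of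
  \<open>q \<alpha>\<close>.
\<close>

lemma card_near:
  assumes q: "q \<ge> 1" and \<rho>: "0 < \<rho>" "\<rho> < 1"
  shows "real (card {n \<in> S. near_multiple \<rho> l (q * \<alpha> n)}) \<le> (2 * q * D / 2 ^ l + 2) * (2 * \<rho> * 2 ^ l / (q * \<sigma>) + 1)"
proof -
  define m where "m = nat \<lfloor>2 * q * D / 2 ^ l + 1\<rfloor>"
  have pos: "0 \<le> 2 * q * D / 2 ^ l" using q D by simp
  have m: "real m \<le> 2 * q * D / 2 ^ l + 1"
    unfolding m_def using pos by (simp add: of_nat_nat)
  define T where "T M = {n \<in> S. \<bar>\<alpha> n - real M * 2 ^ l / q\<bar> \<le> \<rho> * 2 ^ l / q}" for M
  have sub: "{n \<in> S. near_multiple \<rho> l (q * \<alpha> n)} \<subseteq> (\<Union>M\<in>{..m}. T M)"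
  proof clarify
    fix n assume n: "n \<in> S" "near_multiple \<rho> l (q * \<alpha> n)"
    then obtain M :: int where M: "\<bar>q * \<alpha> n - of_int M * 2 ^ l\<bar> \<le> \<rho> * 2 ^ l" by (auto simp: near_multiple_def)
    have qa: "0 \<le> q * \<alpha> n" "q * \<alpha> n \<le> q * (2 * D)" using range[OF n(1)] q D by (auto intro: mult_left_mono)
    have r1: "\<rho> * 2 ^ l < 1 * 2 ^ l" using \<rho> by (intro mult_strict_right_mono) auto
    have "(of_int M + 1) * 2 ^ l > (0::real)" using M qa r1 unfolding distrib_right by linarith
    then have "of_int (M + 1) > (0::real)" by (simp add: zero_less_mult_iff)
    then have "M \<ge> 0" by linarith
    then obtain k where k: "M = int k" by (metis nonneg_int_cases)
    have "(2 * q * D / 2 ^ l + 1) * 2 ^ l = q * (2 * D) + 1 * 2 ^ l" by (simp add: field_simps)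
    moreover have "real k * 2 ^ l \<le> q * (2 * D) + 1 * 2 ^ l"
      using M qa r1 unfolding k of_int_of_nat_eq by linarith
    ultimately have "real k * 2 ^ l \<le> (2 * q * D / 2 ^ l + 1) * 2 ^ l" by simp
    then have "real k \<le> 2 * q * D / 2 ^ l + 1" by (simp only: mult_le_cancel_right_pos zero_less_power zero_less_numeral)
    then have "k \<le> m" unfolding m_def by (rule le_nat_floor)
    moreover have "\<alpha> n - real k * 2 ^ l / q = (q * \<alpha> n - of_int M * 2 ^ l) / q" using q k by (simp add: field_simps)
    then have "\<bar>\<alpha> n - real k * 2 ^ l / q\<bar> \<le> \<rho> * 2 ^ l / q" using M q by (simp add: abs_divide divide_right_mono)
    ultimately show "n \<in> (\<Union>M\<in>{..m}. T M)" using n by (auto simp: T_def)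
  qed
  have "card {n \<in> S. near_multiple \<rho> l (q * \<alpha> n)} \<le> card (\<Union>M\<in>{..m}. T M)"
    by (rule card_mono[OF _ sub]) (auto simp: T_def finite_S)
  also have "\<dots> \<le> (\<Sum>M\<in>{..m}. card (T M))" by (rule card_UN_le) simp
  finally have "real (card {n \<in> S. near_multiple \<rho> l (q * \<alpha> n)}) \<le> (\<Sum>M\<in>{..m}. real (card (T M)))"
    by (simp flip: of_nat_sum)
  also have "\<dots> \<le> (\<Sum>M\<in>{..m}. 2 * (\<rho> * 2 ^ l / q) / \<sigma> + 1)"
    unfolding T_def using \<rho> q by (intro sum_mono card_interval) auto
  also have "\<dots> = (real m + 1) * (2 * \<rho> * 2 ^ l / (q * \<sigma>) + 1)" using q by (simp add: field_simps)
  also have "\<dots> \<le> (2 * q * D / 2 ^ l + 2) * (2 * \<rho> * 2 ^ l / (q * \<sigma>) + 1)"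
    using m q \<sigma> \<rho> by (intro mult_right_mono) auto
  finally show ?thesis .
qed

text \<open>
  Around each multiple of \<open>2 ^ l\<close> in the range of \<open>k \<alpha>\<close> there are about \<open>\<omega> / 2 ^ L\<close> multiples of \<open>2 ^ L\<close>, as \<open>2 ^ l\<close> is itself
  a multiple of \<open>2 ^ L\<close>. Hence the main term is a product of the two densities \<open>\<kappa>\<close> and \<open>\<omega> / 2 ^ l\<close>. The assumption
  \<open>\<omega> < D\<close> excludes the multiple \<open>0\<close> of \<open>2 ^ l\<close>, for which there would be no saving if \<open>2 ^ l\<close> is large.
\<close>

lemma card_near_two_levels:
  assumes k: "k \<ge> 1" and \<kappa>: "0 < \<kappa>" "\<kappa> \<le> 1" and L: "L \<le> l" and ell: "3 * 2 ^ L \<le> \<omega>" "\<omega> < D"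
  shows "real (card {n \<in> S. (\<exists>M::int. \<bar>k * \<alpha> n - of_int M * 2 ^ l\<bar> \<le> \<omega>) \<and> near_multiple \<kappa> L (k * \<alpha> n)})
     \<le> 18 * \<kappa> * (D / \<sigma>) * (\<omega> / 2 ^ l) + 9 * k * D * (\<omega> / 2 ^ l)"
    (is "real (card ?Z) \<le> _")
proof -
  define m where "m = nat \<lfloor>3 * k * D / 2 ^ l\<rfloor>"
  define j where "j = \<lfloor>\<omega> / 2 ^ L + 1\<rfloor>"
  have kD: "1 * D \<le> k * D" using k D by (intro mult_right_mono) auto
  have lampos: "\<omega> > 0" using ell(1) zero_less_power[of "2::real" L] by linarith
  have m: "real m \<le> 3 * k * D / 2 ^ l"
    unfolding m_def using k D by (simp add: of_nat_nat)
  define T where "T M M' = {n \<in> S. \<bar>\<alpha> n - (real M * 2 ^ l + of_int M' * 2 ^ L) / k\<bar> \<le> \<kappa> * 2 ^ L / k}" for M :: nat and M' :: int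
  have sub: "?Z \<subseteq> (\<Union>MM\<in>{1..m} \<times> {-j..j}. T (fst MM) (snd MM))"
  proof clarify
    fix n M assume n: "n \<in> S" "near_multiple \<kappa> L (k * \<alpha> n)" and M: "\<bar>k * \<alpha> n - of_int M * 2 ^ l\<bar> \<le> \<omega>"
    obtain M0 :: int where M0: "\<bar>k * \<alpha> n - of_int M0 * 2 ^ L\<bar> \<le> \<kappa> * 2 ^ L" using n by (auto simp: near_multiple_def)
    have ka: "D \<le> k * \<alpha> n" "k * \<alpha> n \<le> k * (2 * D)"
    proof -
      have "k * D \<le> k * \<alpha> n" using range[OF n(1)] k by (intro mult_left_mono) auto
      then show "D \<le> k * \<alpha> n" using kD by linarith
      show "k * \<alpha> n \<le> k * (2 * D)" using range[OF n(1)] k by (intro mult_left_mono) auto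
    qed
    have "of_int M * 2 ^ l > (0::real)" using M ka ell by linarith
    then have "M > 0" by (simp add: zero_less_mult_iff)
    then obtain i where i: "M = int i" "i \<ge> 1" by (metis pos_int_cases Suc_leI One_nat_def)
    have "real i * 2 ^ l \<le> 3 * k * D" using M ka ell kD i by simp
    then have "real i \<le> 3 * k * D / 2 ^ l" by (simp add: field_simps)
    then have "i \<le> m" unfolding m_def by (rule le_nat_floor)
    define M' where "M' = M0 - M * 2 ^ (l - L)"
    have pw: "(2::real) ^ l = 2 ^ (l - L) * 2 ^ L" using L by (simp flip: power_add)
    have eq: "of_int M0 * 2 ^ L = real i * 2 ^ l + of_int M' * 2 ^ L"
      unfolding M'_def i pw by (simp add: algebra_simps)
    have k2: "\<kappa> * 2 ^ L \<le> 1 * 2 ^ L" using \<kappa> by (intro mult_right_mono) auto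
    have "(\<omega> / 2 ^ L + 1) * 2 ^ L = \<omega> + 1 * 2 ^ L" by (simp add: field_simps)
    moreover have "\<bar>of_int M' * 2 ^ L\<bar> \<le> \<omega> + 1 * 2 ^ L"
      using M M0 eq k2 unfolding i(1) of_int_of_nat_eq by linarith
    ultimately have "\<bar>of_int M' * 2 ^ L\<bar> \<le> (\<omega> / 2 ^ L + 1) * 2 ^ L" by simp
    then have "\<bar>of_int M'\<bar> * 2 ^ L \<le> (\<omega> / 2 ^ L + 1) * 2 ^ L" by (simp add: abs_mult)
    then have "\<bar>of_int M'\<bar> \<le> \<omega> / 2 ^ L + 1" by (simp only: mult_le_cancel_right_pos zero_less_power zero_less_numeral)
    then have "of_int \<bar>M'\<bar> \<le> \<omega> / 2 ^ L + 1" by simp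
    then have "\<bar>M'\<bar> \<le> j" unfolding j_def by (simp only: le_floor_iff)
    moreover have "\<alpha> n - (real i * 2 ^ l + of_int M' * 2 ^ L) / k = (k * \<alpha> n - of_int M0 * 2 ^ L) / k"
      using k eq by (simp add: field_simps)
    then have "\<bar>\<alpha> n - (real i * 2 ^ l + of_int M' * 2 ^ L) / k\<bar> \<le> \<kappa> * 2 ^ L / k"
      using M0 k by (simp add: abs_divide divide_right_mono)
    ultimately show "n \<in> (\<Union>MM\<in>{1..m} \<times> {-j..j}. T (fst MM) (snd MM))"
      using n i \<open>i \<le> m\<close> by (intro UN_I[of "(i, M')"]) (auto simp: T_def)
  qed
  have cj: "real (card {-j..j}) \<le> 3 * (\<omega> / 2 ^ L)"
  proof -
    have jj: "of_int j \<le> \<omega> / 2 ^ L + 1" "0 \<le> j" using lampos unfolding j_def by (simp_all add: le_floor_iff)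
    have "3 \<le> \<omega> / 2 ^ L" using ell by (simp add: field_simps)
    then show ?thesis using jj by simp
  qed
  have "card ?Z \<le> card (\<Union>MM\<in>{1..m} \<times> {-j..j}. T (fst MM) (snd MM))"
    by (rule card_mono[OF _ sub]) (auto simp: T_def finite_S)
  also have "\<dots> \<le> (\<Sum>MM\<in>{1..m} \<times> {-j..j}. card (T (fst MM) (snd MM)))" by (rule card_UN_le) simp
  finally have "real (card ?Z) \<le> (\<Sum>MM\<in>{1..m} \<times> {-j..j}. real (card (T (fst MM) (snd MM))))"
    by (simp flip: of_nat_sum)
  also have "\<dots> \<le> (\<Sum>MM\<in>{1..m} \<times> {-j..j}. 2 * (\<kappa> * 2 ^ L / k) / \<sigma> + 1)"
    unfolding T_def using \<kappa> k by (intro sum_mono card_interval) auto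
  also have "\<dots> = real m * real (card {-j..j}) * (2 * (\<kappa> * 2 ^ L / k) / \<sigma> + 1)"
    by (simp only: sum_constant card_cartesian_product card_atLeastAtMost of_nat_mult) simp
  also have "\<dots> \<le> (3 * k * D / 2 ^ l) * (3 * (\<omega> / 2 ^ L)) * (2 * (\<kappa> * 2 ^ L / k) / \<sigma> + 1)"
    using m cj \<kappa> k \<sigma> lampos D by (intro mult_mono mult_right_mono) auto
  also have "\<dots> = 18 * \<kappa> * (D / \<sigma>) * (\<omega> / 2 ^ l) + 9 * k * D * (\<omega> / 2 ^ l) / 2 ^ L"
    using k \<sigma> by (simp add: field_simps)
  also have "9 * k * D * (\<omega> / 2 ^ l) / 2 ^ L \<le> 9 * k * D * (\<omega> / 2 ^ l) / 1"
    using k D lampos by (intro divide_left_mono) auto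
  finally show ?thesis by simp
qed

end

section \<open>The local geometry of powers\<close>

lemma eventually_powr_dominates:
  fixes a b A :: real
  assumes "a < b"
  shows "\<forall>\<^sub>F N in sequentially. A * real N powr a \<le> real N powr b"
proof -
  have "(\<lambda>N. A * real N powr (a - b)) \<longlonglongrightarrow> A * 0"
    using assms by (intro tendsto_mult tendsto_const tendsto_neg_powr filterlim_real_sequentially) auto
  then have "\<forall>\<^sub>F N in sequentially. A * real N powr (a - b) < 1"
    by (rule order_tendstoD) simp
  then show ?thesis
    using eventually_gt_at_top[of 0]
  proof eventually_elim
    case (elim N)
    have "A * real N powr a = (A * real N powr (a - b)) * real N powr b"
      using elim by (simp add: powr_diff)
    also have "\<dots> \<le> 1 * real N powr b" using elim by (intro mult_right_mono) auto
    finally show ?case by simp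
  qed
qed

text \<open>
  Every requirement that holds for large \<open>N\<close> only is collected here, with one constant \<open>Z\<close> for all of them. The block
  length \<open>\<mu>\<close> is the least one for which the \<open>p\<close> blocks reach beyond the size \<open>C D\<close> of the slopes; then
  \<open>2 ^ \<mu>\<close> is of the order of \<open>D powr (1 / p)\<close>, and the condition on \<open>p\<close> says that this is a smaller power of \<open>N\<close> than
  \<open>K\<close>. The exponent \<open>(2 - c) / 4\<close> of \<open>K\<close> is less than \<open>1 - c / 2\<close>, so that \<open>n powr c\<close> is linear on blocks of length \<open>K\<close>,
  and less than \<open>2 - c\<close>, so that \<open>K D\<close> is small compared with \<open>N\<close>.
\<close>

lemma eventually_scales:
  fixes c C Z :: real and p \<nu> :: nat
  assumes c: "1 < c" "c < 2" and C: "C > 0" and Z: "Z \<ge> 1"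
    and p: "p \<ge> 1" "c - 1 < real p * ((2 - c) / 4)"
  shows "\<forall>\<^sub>F N in sequentially. \<forall>D K. D = c * real N powr (c - 1) \<longrightarrow> K = nat \<lfloor>real N powr ((2 - c) / 4)\<rfloor> \<longrightarrow>
     N > 0 \<and> K > 0 \<and> Z \<le> D \<and> Z * D \<le> real N \<and> Z * real K \<le> real N \<and> Z \<le> real K \<and>
     Z * real K ^ 2 * real N powr (c - 2) \<le> 1 \<and>
     (\<exists>\<mu>. C * D \<le> 2 ^ (\<nu> + p * \<mu>) \<and> 2 ^ (\<nu> + p * \<mu>) \<le> 2 ^ p * C * D \<and>
          Z * 2 ^ \<mu> \<le> real K \<and> Z \<le> 2 ^ \<mu> \<and> Z * D * 2 ^ \<mu> \<le> real N)"
proof -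
  define \<kappa> where "\<kappa> = (2 - c) / 4"
  have \<kappa>: "0 < \<kappa>" "2 * \<kappa> + (c - 2) < 0" "\<kappa> < 1" "c - 1 < 1" "c - 1 + \<kappa> < 1" "c - 1 < real p * \<kappa>"
    using c p by (auto simp: \<kappa>_def field_simps)
  have p0: "0 < c - 1" using c by simp
  note ev = eventually_powr_dominates
  have "\<forall>\<^sub>F N in sequentially. N > (0::nat)" by (rule eventually_gt_at_top)
  moreover note ev[of 0 "c - 1" "Z + Z ^ p * 2 ^ \<nu> / C + 2 ^ \<nu> / C"] ev[of "c - 1" 1 "Z * c"]
    ev[of \<kappa> 1 Z] ev[of 0 \<kappa> "2 * Z + 2"]
    ev[of "2 * \<kappa> + (c - 2)" 0 Z] ev[of "c - 1" "real p * \<kappa>" "(4 * Z) ^ p * (C * c)"]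
    ev[of "c - 1 + \<kappa>" 1 c]
  ultimately have "\<forall>\<^sub>F N in sequentially. N > 0 \<and>
     (Z + Z ^ p * 2 ^ \<nu> / C + 2 ^ \<nu> / C) * real N powr 0 \<le> real N powr (c - 1) \<and>
     (Z * c) * real N powr (c - 1) \<le> real N powr 1 \<and>
     Z * real N powr \<kappa> \<le> real N powr 1 \<and>
     (2 * Z + 2) * real N powr 0 \<le> real N powr \<kappa> \<and>
     Z * real N powr (2 * \<kappa> + (c - 2)) \<le> real N powr 0 \<and>
     (4 * Z) ^ p * (C * c) * real N powr (c - 1) \<le> real N powr (real p * \<kappa>) \<and>
     c * real N powr (c - 1 + \<kappa>) \<le> real N powr 1"
    using \<kappa> p0 by (intro eventually_conj) simp_all
  then show ?thesis
  proof eventually_elim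
    case (elim N)
    define D where "D = c * real N powr (c - 1)"
    define K where "K = nat \<lfloor>real N powr \<kappa>\<rfloor>"
    have N: "N > 0" using elim by auto
    then have N0: "real N powr 0 = 1" by simp
    have e1: "Z + Z ^ p * 2 ^ \<nu> / C + 2 ^ \<nu> / C \<le> real N powr (c - 1)" using elim unfolding N0 by simp
    have e4: "2 * Z + 2 \<le> real N powr \<kappa>" using elim unfolding N0 by simp
    have Dge: "real N powr (c - 1) \<le> D" using c mult_right_mono[of 1 c "real N powr (c - 1)"] by (simp add: D_def)
    have Zp: "0 \<le> Z ^ p * 2 ^ \<nu> / C" "0 < 2 ^ \<nu> / C" using Z C by auto
    have "Z \<le> D" "Z ^ p * 2 ^ \<nu> / C \<le> D" "2 ^ \<nu> / C < D" using e1 Dge Zp Z by linarith+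
    then have D: "Z \<le> D" "Z ^ p * 2 ^ \<nu> \<le> C * D" "2 ^ \<nu> < C * D" using C by (simp_all add: field_simps)
    have Kle: "real K \<le> real N powr \<kappa>" unfolding K_def by simp
    have Kgt: "real N powr \<kappa> - 1 < real K" unfolding K_def by linarith
    have K0: "Z \<le> real K" "real N powr \<kappa> \<le> 2 * real K" using Kgt e4 Z by linarith+
    have Kpos: "K > 0" using K0 Z by (cases K) auto
    have ZD: "Z * D \<le> real N" using elim N by (simp add: D_def mult.assoc)
    have "Z * real K \<le> Z * real N powr \<kappa>" using Z Kle by (intro mult_left_mono) auto
    also have "\<dots> \<le> real N" using elim by simp
    finally have ZK: "Z * real K \<le> real N" .
    have "Z * real K ^ 2 * real N powr (c - 2) \<le> Z * (real N powr \<kappa>) ^ 2 * real N powr (c - 2)"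
      using Z Kle by (intro mult_right_mono mult_left_mono power_mono) auto
    also have "\<dots> = Z * real N powr (2 * \<kappa> + (c - 2))"
      using N by (simp add: powr_add powr_power mult.assoc mult.commute)
    also have "\<dots> \<le> 1" using elim unfolding N0 by simp
    finally have lin: "Z * real K ^ 2 * real N powr (c - 2) \<le> 1" .
    define P where "P \<mu> \<longleftrightarrow> C * D \<le> 2 ^ (\<nu> + p * \<mu>)" for \<mu>
    have "\<exists>\<mu>. P \<mu>"
    proof -
      obtain m where "C * D < 2 ^ m" using real_arch_pow[of 2 "C * D"] by auto
      moreover have "(2::real) ^ m \<le> 2 ^ (\<nu> + p * m)" using p by (intro power_increasing) (auto simp: trans_le_add2)
      ultimately show ?thesis unfolding P_def by (intro exI[of _ m]) linarith
    qed
    then obtain \<mu> where \<mu>: "P \<mu>" "\<And>m. m < \<mu> \<Longrightarrow> \<not> P m" by (metis exists_least_iff)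
    have "\<mu> \<noteq> 0"
    proof
      assume "\<mu> = 0"
      then show False using \<mu>(1) D(3) by (simp add: P_def)
    qed
    then obtain m where m: "\<mu> = Suc m" by (cases \<mu>) auto
    have "2 ^ (\<nu> + p * m) < C * D" using \<mu>(2)[of m] m by (simp add: P_def not_le)
    then have up: "2 ^ (\<nu> + p * \<mu>) \<le> 2 ^ p * C * D"
      unfolding m by (simp add: power_add)
    have split: "(2::real) ^ (\<nu> + p * \<mu>) = 2 ^ \<nu> * (2 ^ \<mu>) ^ p" by (simp add: power_add mult.commute flip: power_mult)
    have "Z ^ p * 2 ^ \<nu> \<le> (2 ^ \<mu>) ^ p * 2 ^ \<nu>"
      using order_trans[OF D(2) \<mu>(1)[unfolded P_def split]] by (simp only: mult.commute)
    then have "Z ^ p \<le> (2 ^ \<mu>) ^ p" by (simp only: mult_le_cancel_right_pos zero_less_power zero_less_numeral)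
    then have Z\<mu>: "Z \<le> 2 ^ \<mu>" using p Z by (subst (asm) power_mono_iff) auto
    have "(2 ^ \<mu>) ^ p \<le> (2::real) ^ \<nu> * (2 ^ \<mu>) ^ p" by (simp add: mult_le_cancel_right1)
    also have "\<dots> \<le> 2 ^ p * (C * D)" using up unfolding split by (simp add: mult.assoc)
    finally have "(2 * Z) ^ p * (2 ^ \<mu>) ^ p \<le> (2 * Z) ^ p * (2 ^ p * (C * D))"
      using Z by (intro mult_left_mono) auto
    also have "\<dots> = (4 * Z) ^ p * (C * c) * real N powr (c - 1)"
      by (simp add: D_def power_mult_distrib mult_ac flip: power_mult_distrib[of 2 2]) 
    also have "\<dots> \<le> (real N powr \<kappa>) ^ p"
      using elim N by (simp add: powr_power mult.commute)
    finally have "(2 * Z * 2 ^ \<mu>) ^ p \<le> (real N powr \<kappa>) ^ p" by (simp add: power_mult_distrib)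
    then have "2 * Z * 2 ^ \<mu> \<le> real N powr \<kappa>" using p Z by (subst (asm) power_mono_iff) auto
    then have ZK2: "Z * 2 ^ \<mu> \<le> real K" using K0(2) by linarith
    have "Z * D * 2 ^ \<mu> = D * (Z * 2 ^ \<mu>)" by simp
    also have "\<dots> \<le> D * real N powr \<kappa>" using ZK2 Kle D Z by (intro mult_left_mono) auto
    also have "\<dots> = c * real N powr (c - 1 + \<kappa>)" by (simp add: D_def powr_add)
    also have "\<dots> \<le> real N" using elim by simp
    finally have "Z * D * 2 ^ \<mu> \<le> real N" .
    then show ?case
      using N Kpos D(1) ZD ZK K0(1) lin \<mu>(1) up ZK2 Z\<mu> unfolding P_def D_def K_def \<kappa>_def by blast
  qed
qed

lemma powr_second_order:
  fixes c x y :: real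
  assumes c: "1 < c" "c < 2" and x: "x > 0" and y: "y \<ge> 0"
  shows "\<bar>(x + y) powr c - x powr c - y * (c * x powr (c - 1))\<bar> \<le> 2 * y\<^sup>2 * x powr (c - 2)"
proof (cases "y = 0")
  case False
  then have y: "y > 0" using y by simp
  have "\<exists>z. x < z \<and> z < x + y \<and> (x + y) powr c - x powr c = (x + y - x) * (c * z powr (c - 1))"
    using x y by (intro MVT2) (auto intro!: derivative_eq_intros)
  then obtain z where z: "x < z" "z < x + y" "(x + y) powr c - x powr c = y * (c * z powr (c - 1))" by auto
  have "\<exists>w. x < w \<and> w < z \<and> z powr (c - 1) - x powr (c - 1) = (z - x) * ((c - 1) * w powr (c - 1 - 1))"
    using x z by (intro MVT2) (auto intro!: derivative_eq_intros)
  then obtain w where w: "x < w" "w < z" "z powr (c - 1) - x powr (c - 1) = (z - x) * ((c - 1) * w powr (c - 2))"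
    by (auto simp: algebra_simps)
  have wx: "w powr (c - 2) \<le> x powr (c - 2)" using w x c by (intro powr_mono2') auto
  have "(x + y) powr c - x powr c - y * (c * x powr (c - 1)) = y * c * (z powr (c - 1) - x powr (c - 1))"
    unfolding z(3) by (simp add: algebra_simps)
  also have "\<dots> = y * c * ((z - x) * ((c - 1) * w powr (c - 2)))" unfolding w(3) ..
  finally have eq: "(x + y) powr c - x powr c - y * (c * x powr (c - 1)) = y * c * ((z - x) * ((c - 1) * w powr (c - 2)))" .
  have "0 \<le> y * c * ((z - x) * ((c - 1) * w powr (c - 2)))" using y c z by auto
  moreover have "y * c * ((z - x) * ((c - 1) * w powr (c - 2))) \<le> y * 2 * (y * (1 * x powr (c - 2)))"
    using y c z wx by (intro mult_mono) auto
  ultimately show ?thesis unfolding eq by (simp add: power2_eq_square mult_ac)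
qed simp

lemma slope_increment:
  fixes c :: real
  assumes c: "1 < c" "c < 2" and N: "N > 0" and mn: "N \<le> m" "m < n" "n < 2 * N"
  shows "c * (c - 1) * real N powr (c - 2) / 2 * (real n - real m) \<le> c * real n powr (c - 1) - c * real m powr (c - 1)"
proof -
  have "\<exists>w. real m < w \<and> w < real n \<and> real n powr (c - 1) - real m powr (c - 1) = (real n - real m) * ((c - 1) * w powr (c - 1 - 1))"
    using mn N by (intro MVT2) (auto intro!: derivative_eq_intros)
  then obtain w where w: "real m < w" "w < real n" "real n powr (c - 1) - real m powr (c - 1) = (real n - real m) * ((c - 1) * w powr (c - 2))"
    by (auto simp: algebra_simps)
  have "real N powr (c - 2) / 2 \<le> 2 powr (c - 2) * real N powr (c - 2)"
  proof -
    have "2 powr (-1) \<le> (2::real) powr (c - 2)" using c by (intro powr_mono) auto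
    then have "1 / 2 \<le> (2::real) powr (c - 2)" by (simp add: powr_minus)
    then have "1 / 2 * real N powr (c - 2) \<le> 2 powr (c - 2) * real N powr (c - 2)" by (intro mult_right_mono) auto
    then show ?thesis by simp
  qed
  also have "\<dots> = (2 * real N) powr (c - 2)" by (simp add: powr_mult)
  also have "\<dots> \<le> w powr (c - 2)" using w mn N c by (intro powr_mono2') auto
  finally have "c * ((real n - real m) * ((c - 1) * (real N powr (c - 2) / 2))) \<le> c * ((real n - real m) * ((c - 1) * w powr (c - 2)))"
    using c mn by (intro mult_left_mono) auto
  also have "\<dots> = c * real n powr (c - 1) - c * real m powr (c - 1)"
    unfolding w(3) [symmetric] by (rule right_diff_distrib)
  finally show ?thesis by (simp add: mult_ac)
qed

lemma slowly_increasing_powr: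
  fixes c :: real
  assumes c: "1 < c" "c < 2" and N: "N > 0"
  shows "slowly_increasing (\<lambda>n. c * real n powr (c - 1)) {N..<2 * N} (c * real N powr (c - 1)) (c * (c - 1) * real N powr (c - 2) / 2)"
proof
  show "0 < c * (c - 1) * real N powr (c - 2) / 2" "0 < c * real N powr (c - 1)" using c N by auto
  show "c * (c - 1) * real N powr (c - 2) / 2 * (real n - real m) \<le> c * real n powr (c - 1) - c * real m powr (c - 1)"
    if "m \<in> {N..<2 * N}" "n \<in> {N..<2 * N}" "m < n" for m n
    using slope_increment[OF c N, of m n] that by simp
  show "c * real N powr (c - 1) \<le> c * real n powr (c - 1) \<and> c * real n powr (c - 1) \<le> 2 * (c * real N powr (c - 1))"
    if "n \<in> {N..<2 * N}" for n
  proof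
    have "real N powr (c - 1) \<le> real n powr (c - 1)" using that c by (intro powr_mono2) auto
    then show "c * real N powr (c - 1) \<le> c * real n powr (c - 1)" using c by simp
    have "real n powr (c - 1) \<le> (2 * real N) powr (c - 1)" using that c by (intro powr_mono2) auto
    also have "\<dots> = 2 powr (c - 1) * real N powr (c - 1)" by (simp add: powr_mult)
    also have "\<dots> \<le> 2 powr 1 * real N powr (c - 1)" using c by (intro mult_right_mono powr_mono) auto
    finally show "c * real n powr (c - 1) \<le> 2 * (c * real N powr (c - 1))" using c by simp
  qed
qed simp

section \<open>From good slopes to dyadic sums\<close>

lemma card_levels: "card ({0, L} \<union> (\<lambda>i. \<nu> + i * \<mu>) ` {..p}) \<le> p + 3"
proof -
  have "card ({0, L} \<union> (\<lambda>i. \<nu> + i * \<mu>) ` {..p}) \<le> card {0, L} + card ((\<lambda>i. \<nu> + i * \<mu>) ` {..p})"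
    by (rule card_Un_le)
  also have "card ((\<lambda>i. \<nu> + i * \<mu>) ` {..p}) \<le> p + 1"
    using card_image_le[of "{..p}" "\<lambda>i. \<nu> + i * \<mu>"] by simp
  also have "card {0, L} \<le> 2" by (simp add: card_insert_if)
  finally show ?thesis by simp
qed

text \<open>
  The three hypotheses on the slope provide the shifts of direction \<open>0\<close> (\<open>good_bot\<close>), those of the other directions
  (\<open>good_mid\<close>), and the rarity of carries (\<open>good_sep\<close>). The multiplier \<open>Q0 2 ^ \<mu>\<close> in \<open>good_mid\<close> is chosen such that the
  error at level \<open>\<nu> + Suc i * \<mu>\<close> is a small constant times \<open>2 ^ (\<nu> + i * \<mu>)\<close>.
\<close>

lemma mean_bound_of_good_slope:
  fixes x :: "nat \<Rightarrow> real" and \<alpha> \<beta> \<delta> \<tau> \<kappa> \<kappa>0 \<epsilon> :: real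
  assumes d: "d = Suc p" and K: "K > 0" and B: "B > 0"
    and x0: "\<And>n. x n \<ge> 0"
    and lin: "\<And>n. n < 2 * K \<Longrightarrow> \<bar>x n - \<beta> - real n * \<alpha>\<bar> \<le> \<tau>"
    and \<alpha>: "\<alpha> \<ge> 0" and \<tau>: "\<tau> > 0" "real (d + 2) * \<tau> \<le> \<delta>" and \<delta>: "\<delta> \<le> 1"
    and L: "real (d * B + 1) \<le> \<delta> * 2 ^ L" "L \<le> \<nu>"
    and H: "H > 0" "2 ^ L / real H \<le> \<tau>" and \<kappa>: "\<kappa> > 0" "1 \<le> real R * \<kappa>"
    and Q0: "Q0 > 0" "real R * (real H / real Q0) \<le> \<delta>"
    and H0: "H0 > 0" "2 ^ \<nu> / real H0 \<le> \<tau>" and \<kappa>0: "\<kappa>0 > 0" "1 \<le> real R0 * \<kappa>0"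
    and top: "real (R0 * H0) * \<alpha> \<le> \<delta> * 2 ^ (\<nu> + p * \<mu>)"
    and A: "A = R * (H * (Q0 * 2 ^ \<mu>)) + R0 * H0" "d * A \<le> K"
    and decay: "\<And>w. \<bar>cube_sum d B (\<lambda>_. w)\<bar> \<le> \<epsilon> * real (B ^ (2 * d))"
    and h0: "h0 > 0" and H1: "H1 > 0"
    and levels: "Lev = {0, L} \<union> (\<lambda>i. \<nu> + i * \<mu>) ` {..p}"
    and good_bot: "\<And>h. h \<in> {1..H0} \<Longrightarrow> \<not> near_multiple \<kappa>0 \<nu> (real h * \<alpha>)"
    and good_mid: "\<And>i k. i < p \<Longrightarrow> k \<in> {1..H * (Q0 * 2 ^ \<mu>)} \<Longrightarrow>
        \<not> ((\<exists>M::int. \<bar>real k * \<alpha> - of_int M * 2 ^ (\<nu> + Suc i * \<mu>)\<bar> \<le> real H * (2 ^ (\<nu> + Suc i * \<mu>) / real (Q0 * 2 ^ \<mu>)))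
           \<and> near_multiple \<kappa> L (real k * \<alpha>))"
    and good_sep: "\<And>l h. l \<in> Lev \<Longrightarrow> h \<in> {1..H1} \<Longrightarrow> \<not> near_multiple (8 * \<delta>) l (real (h * h0) * \<alpha>)"
  shows "\<bar>mean K (\<lambda>n. tm (nat \<lfloor>x n\<rfloor>))\<bar> ^ (2 ^ d)
     \<le> \<epsilon> + 2 * (2 ^ d + 1) * (real (p + 3) * (2 * real K / real H1 + real h0)) / real K
         + 2 ^ (d + 2) * real A / real K"
proof -
  have "1 * \<tau> \<le> real (d + 2) * \<tau>" using \<tau> by (intro mult_right_mono) auto
  then have \<tau>\<delta>: "\<tau> \<le> \<delta>" "0 \<le> \<delta>" using \<tau> by linarith+
  have BL: "real B \<le> 2 ^ L"
  proof -
    have "1 * real B \<le> real d * real B" using d by (intro mult_right_mono) auto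
    also have "\<dots> \<le> \<delta> * 2 ^ L" using L(1) by simp
    also have "\<dots> \<le> 1 * 2 ^ L" using \<delta> by (intro mult_right_mono) auto
    finally show ?thesis by simp
  qed
  have L\<nu>: "(2::real) ^ L \<le> 2 ^ \<nu>" using L(2) by (intro power_increasing) auto
  then have B\<nu>: "real B \<le> 2 ^ \<nu>" using BL by linarith
  have "\<exists>a. \<forall>b<B. a b \<le> R0 * H0 \<and> (\<exists>M::int. \<bar>real (a b) * \<alpha> - real b - of_int M * 2 ^ \<nu>\<bar> \<le> \<tau>)"
    using good_bot by (intro shifts_mod_one_level[OF H0 \<kappa>0 B\<nu>]) auto
  then obtain a0 where a0: "\<And>b. b < B \<Longrightarrow> a0 b \<le> R0 * H0"
    "\<And>b. b < B \<Longrightarrow> \<exists>M::int. \<bar>real (a0 b) * \<alpha> - real b - of_int M * 2 ^ \<nu>\<bar> \<le> \<tau>" by blast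
  have "\<exists>a. \<forall>b<B. a b \<le> R * (H * (Q0 * 2 ^ \<mu>))
     \<and> (\<exists>M::int. \<bar>real (a b) * \<alpha> - of_int M * 2 ^ (\<nu> + Suc i * \<mu>)\<bar> \<le> \<delta> * 2 ^ (\<nu> + i * \<mu>))
     \<and> (\<exists>M::int. \<bar>real (a b) * \<alpha> - real b - of_int M * 2 ^ L\<bar> \<le> \<tau>)" if i: "i < p" for i
  proof (rule shifts_mod_two_levels[OF H _ \<kappa> BL])
    show "Q0 * 2 ^ \<mu> > 0" using Q0 by simp
    have "real R * (real H * (2 ^ (\<nu> + Suc i * \<mu>) / real (Q0 * 2 ^ \<mu>))) = real R * (real H / real Q0) * 2 ^ (\<nu> + i * \<mu>)"
      by (simp add: power_add)
    also have "\<dots> \<le> \<delta> * 2 ^ (\<nu> + i * \<mu>)" using Q0 by (intro mult_right_mono) auto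
    finally show "real R * (real H * (2 ^ (\<nu> + Suc i * \<mu>) / real (Q0 * 2 ^ \<mu>))) \<le> \<delta> * 2 ^ (\<nu> + i * \<mu>)" .
    show "\<not> near_multiple \<kappa> L (real k * \<alpha>)" if "1 \<le> k" "k \<le> H * (Q0 * 2 ^ \<mu>)"
      "\<bar>real k * \<alpha> - of_int M * 2 ^ (\<nu> + Suc i * \<mu>)\<bar> \<le> real H * (2 ^ (\<nu> + Suc i * \<mu>) / real (Q0 * 2 ^ \<mu>))"
      for k and M :: int
      using good_mid[OF i, of k] that by (metis atLeastAtMost_iff)
  qed
  then obtain a' where a': "\<And>i b. i < p \<Longrightarrow> b < B \<Longrightarrow> a' i b \<le> R * (H * (Q0 * 2 ^ \<mu>))"
     "\<And>i b. i < p \<Longrightarrow> b < B \<Longrightarrow> \<exists>M::int. \<bar>real (a' i b) * \<alpha> - of_int M * 2 ^ (\<nu> + Suc i * \<mu>)\<bar> \<le> \<delta> * 2 ^ (\<nu> + i * \<mu>)"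
     "\<And>i b. i < p \<Longrightarrow> b < B \<Longrightarrow> \<exists>M::int. \<bar>real (a' i b) * \<alpha> - real b - of_int M * 2 ^ L\<bar> \<le> \<tau>"
    by metis
  define a where "a j = (case j of 0 \<Rightarrow> a0 | Suc i \<Rightarrow> a' i)" for j
  define X where "X = {n. n < 2 * K \<and> (\<exists>l\<in>Lev. near_multiple (3 * \<delta>) l (x n))}"
  have cardX: "real (card X) \<le> real (p + 3) * (2 * real K / real H1 + real h0)"
  proof -
    have finL: "finite Lev" by (simp add: levels)
    have cL: "card Lev \<le> p + 3" unfolding levels by (rule card_levels)
    have each: "real (card {n. n < 2 * K \<and> near_multiple (3 * \<delta>) l (x n)}) \<le> 2 * real K / real H1 + real h0" if l: "l \<in> Lev" for l
    proof -
      have "card {n. n < 2 * K \<and> near_multiple (3 * \<delta>) l (x n)} * H1 \<le> 2 * K + H1 * h0"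
        using good_sep[OF l] by (intro count_near_of_separated[OF lin h0 \<tau>\<delta>]) auto
      then have "real (card {n. n < 2 * K \<and> near_multiple (3 * \<delta>) l (x n)} * H1) \<le> real (2 * K + H1 * h0)"
        by (simp only: of_nat_le_iff)
      then show ?thesis using H1 by (simp add: field_simps)
    qed
    have "X = (\<Union>l\<in>Lev. {n. n < 2 * K \<and> near_multiple (3 * \<delta>) l (x n)})" by (auto simp: X_def)
    then have "card X \<le> (\<Sum>l\<in>Lev. card {n. n < 2 * K \<and> near_multiple (3 * \<delta>) l (x n)})"
      using card_UN_le[OF finL] by simp
    then have "real (card X) \<le> (\<Sum>l\<in>Lev. real (card {n. n < 2 * K \<and> near_multiple (3 * \<delta>) l (x n)}))"
      by (simp flip: of_nat_sum)
    also have "\<dots> \<le> (\<Sum>l\<in>Lev. 2 * real K / real H1 + real h0)" by (intro sum_mono each)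
    also have "\<dots> = real (card Lev) * (2 * real K / real H1 + real h0)" by simp
    also have "\<dots> \<le> real (p + 3) * (2 * real K / real H1 + real h0)"
      using cL by (intro mult_right_mono) (simp_all add: add_nonneg_nonneg)
    finally show ?thesis .
  qed
  have "\<bar>mean K (\<lambda>n. tm (nat \<lfloor>x n\<rfloor>))\<bar> ^ (2 ^ d)
     \<le> \<epsilon> + 2 * (2 ^ d + 1) * real (card X) / real K + 2 ^ (d + 2) * real A / real K"
  proof (rule local_mean_bound[OF d K B x0 lin \<alpha> \<tau> L, where a = a and A = A and \<mu> = \<mu>])
    show "a j b \<le> A" if "j < d" "b < B" for j b
      using that a0(1)[of b] a'(1)[of "j - 1" b] d by (cases j) (auto simp: a_def A)
    show "real (a 0 b) * \<alpha> \<le> \<delta> * 2 ^ (\<nu> + p * \<mu>)" if "b < B" for b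
    proof -
      have "real (a 0 b) * \<alpha> \<le> real (R0 * H0) * \<alpha>"
        using a0(1)[OF that] \<alpha> by (intro mult_right_mono) (auto simp: a_def simp del: of_nat_mult)
      then show ?thesis using top by simp
    qed
    show "X = {n. n < 2 * K \<and> (\<exists>l\<in>{0, L} \<union> (\<lambda>i. \<nu> + i * \<mu>) ` {..p}. near_multiple (3 * \<delta>) l (x n))}"
      by (simp only: X_def levels)
  qed (use A decay a0 a' in \<open>auto simp: a_def\<close>)
  also have "2 * (2 ^ d + 1) * real (card X) / real K \<le> 2 * (2 ^ d + 1) * (real (p + 3) * (2 * real K / real H1 + real h0)) / real K"
    by (intro divide_right_mono mult_left_mono cardX) auto
  finally show ?thesis by simp
qed

context slowly_increasing
begin

lemma card_Bex_le:
  assumes "finite I" and bd: "\<And>i. i \<in> I \<Longrightarrow> real (card {n \<in> S. P i n}) \<le> m"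
  shows "real (card {n \<in> S. \<exists>i\<in>I. P i n}) \<le> real (card I) * m"
proof -
  have "{n \<in> S. \<exists>i\<in>I. P i n} = (\<Union>i\<in>I. {n \<in> S. P i n})" by auto
  then have "card {n \<in> S. \<exists>i\<in>I. P i n} \<le> (\<Sum>i\<in>I. card {n \<in> S. P i n})"
    using card_UN_le[OF assms(1)] by simp
  then have "real (card {n \<in> S. \<exists>i\<in>I. P i n}) \<le> (\<Sum>i\<in>I. real (card {n \<in> S. P i n}))"
    by (simp flip: of_nat_sum)
  also have "\<dots> \<le> real (card I) * m" using sum_bounded_above[of I _ m] bd by simp
  finally show ?thesis .
qed

text \<open>
  By \<open>card_near\<close> each multiplier contributes a proportion of about \<open>\<rho>\<close>; the hypothesis on \<open>l\<close> ensures that the range of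
  the multiples of \<open>\<alpha>\<close> is not short compared with \<open>2 ^ l\<close>.
\<close>

lemma card_near_multiples:
  assumes h0: "h0 \<ge> 1" and \<rho>: "0 < \<rho>" "\<rho> < 1" and l: "2 ^ l \<le> real h0 * D"
  shows "real (card {n \<in> S. \<exists>h\<in>{1..H}. near_multiple \<rho> l (real (h * h0) * \<alpha> n)})
     \<le> real H * (8 * \<rho> * (D / \<sigma>) + 2 * real (H * h0) * D + 2)"
proof -
  have "real (card {n \<in> S. near_multiple \<rho> l (real (h * h0) * \<alpha> n)}) \<le> 8 * \<rho> * (D / \<sigma>) + 2 * real (H * h0) * D + 2"
    if h: "h \<in> {1..H}" for h
  proof -
    define q where "q = real (h * h0)"
    have hh: "1 \<le> h * h0" "1 * h0 \<le> h * h0" "h * h0 \<le> H * h0" using h h0 by (auto intro: mult_le_mono)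
    then have q: "1 \<le> q" "real h0 \<le> q" "q \<le> real (H * h0)"
      unfolding q_def by (metis of_nat_le_iff of_nat_1, metis of_nat_le_iff mult_1, metis of_nat_le_iff)
    have "real (card {n \<in> S. near_multiple \<rho> l (q * \<alpha> n)}) \<le> (2 * q * D / 2 ^ l + 2) * (2 * \<rho> * 2 ^ l / (q * \<sigma>) + 1)"
      by (rule card_near[OF q(1) \<rho>])
    also have "\<dots> = 4 * \<rho> * (D / \<sigma>) + 2 * q * D / 2 ^ l + 4 * \<rho> * (2 ^ l / (q * \<sigma>)) + 2"
      using q(1) \<sigma> by (simp add: field_simps)
    also have "\<dots> \<le> 4 * \<rho> * (D / \<sigma>) + 2 * real (H * h0) * D + 4 * \<rho> * (D / \<sigma>) + 2"
    proof -
      have "2 * q * D / 2 ^ l \<le> 2 * q * D / 1" using q D by (intro divide_left_mono) auto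
      also have "\<dots> \<le> 2 * real (H * h0) * D" using q D by simp
      finally have 1: "2 * q * D / 2 ^ l \<le> 2 * real (H * h0) * D" .
      have "2 ^ l \<le> q * D" using l mult_right_mono[OF q(2), of D] D by linarith
      then have "2 ^ l / (q * \<sigma>) \<le> q * D / (q * \<sigma>)" using q \<sigma> by (intro divide_right_mono) auto
      then have "2 ^ l / (q * \<sigma>) \<le> D / \<sigma>" using q by simp
      then have "4 * \<rho> * (2 ^ l / (q * \<sigma>)) \<le> 4 * \<rho> * (D / \<sigma>)" using \<rho> by (intro mult_left_mono) auto
      then show ?thesis using 1 by linarith
    qed
    also have "\<dots> = 8 * \<rho> * (D / \<sigma>) + 2 * real (H * h0) * D + 2" by simp
    finally show ?thesis unfolding q_def .
  qed
  from card_Bex_le[OF _ this, of "{1..H}"] show ?thesis by simp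
qed

text \<open>
  There are \<open>H Q\<close> multipliers, and for each of them the first condition has probability of order \<open>H / Q\<close>. Thus
  \<open>Q\<close> cancels in the main term, which is of order \<open>\<kappa>\<close>.
\<close>

lemma card_near_two_levels_multiples:
  assumes \<kappa>: "0 < \<kappa>" "\<kappa> \<le> 1" and L: "L \<le> l" and Q: "Q > 0"
    and ell: "3 * 2 ^ L \<le> real H * (2 ^ l / real Q)" "real H * (2 ^ l / real Q) < D"
  shows "real (card {n \<in> S. \<exists>k\<in>{1..H * Q}.
       (\<exists>M::int. \<bar>real k * \<alpha> n - of_int M * 2 ^ l\<bar> \<le> real H * (2 ^ l / real Q)) \<and> near_multiple \<kappa> L (real k * \<alpha> n)})
     \<le> 18 * \<kappa> * (D / \<sigma>) * real (H ^ 2) + 9 * real (H ^ 3) * (real Q * D)"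
proof -
  define m where "m = 18 * \<kappa> * (D / \<sigma>) * (real H / real Q) + 9 * real (H * Q) * D * (real H / real Q)"
  have "real (card {n \<in> S. (\<exists>M::int. \<bar>real k * \<alpha> n - of_int M * 2 ^ l\<bar> \<le> real H * (2 ^ l / real Q)) \<and> near_multiple \<kappa> L (real k * \<alpha> n)}) \<le> m"
    if k: "k \<in> {1..H * Q}" for k
  proof -
    have eq: "real H * (2 ^ l / real Q) / 2 ^ l = real H / real Q" by simp
    have "real (card {n \<in> S. (\<exists>M::int. \<bar>real k * \<alpha> n - of_int M * 2 ^ l\<bar> \<le> real H * (2 ^ l / real Q)) \<and> near_multiple \<kappa> L (real k * \<alpha> n)})
      \<le> 18 * \<kappa> * (D / \<sigma>) * (real H / real Q) + 9 * real k * D * (real H / real Q)"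
      using card_near_two_levels[of "real k" \<kappa> L l "real H * (2 ^ l / real Q)", unfolded eq] k \<kappa> L ell by simp
    also have "9 * real k * D * (real H / real Q) \<le> 9 * real (H * Q) * D * (real H / real Q)"
      using k D by (intro mult_right_mono mult_left_mono) (auto simp del: of_nat_mult)
    finally show ?thesis by (simp add: m_def)
  qed
  from card_Bex_le[OF _ this, of "{1..H * Q}"]
  have "real (card {n \<in> S. \<exists>k\<in>{1..H * Q}.
       (\<exists>M::int. \<bar>real k * \<alpha> n - of_int M * 2 ^ l\<bar> \<le> real H * (2 ^ l / real Q)) \<and> near_multiple \<kappa> L (real k * \<alpha> n)}) \<le> real (H * Q) * m"
    by simp
  also have "\<dots> = 18 * \<kappa> * (D / \<sigma>) * real (H ^ 2) + 9 * real (H ^ 3) * (real Q * D)"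
    using Q \<sigma> by (simp add: m_def field_simps power2_eq_square power3_eq_cube)
  finally show ?thesis .
qed

end

text \<open>
  Averaging the translates of the sum by \<open>0, \<dots>, K - 1\<close> changes it by at most \<open>2 K\<close>.
\<close>

lemma sum_le_sum_of_local_means:
  assumes g: "\<And>n. \<bar>g n\<bar> \<le> 1" and K: "K > 0"
  shows "\<bar>\<Sum>n\<in>{N..<2 * N}. g n\<bar> \<le> (\<Sum>n\<in>{N..<2 * N}. \<bar>mean K (\<lambda>k. g (n + k))\<bar>) + 2 * real K"
proof -
  have shift: "(\<Sum>n\<in>{N..<2 * N}. g (n + k)) = (\<Sum>n<N. g (N + n + k))" for k
    by (rule sum.reindex_bij_witness[of _ "\<lambda>n. N + n" "\<lambda>n. n - N"]) auto
  have dk: "\<bar>(\<Sum>n\<in>{N..<2 * N}. g (n + k)) - (\<Sum>n\<in>{N..<2 * N}. g n)\<bar> \<le> 2 * real K" if "k < K" for k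
  proof -
    have "\<bar>(\<Sum>n<N. g (N + (n + k))) - (\<Sum>n<N. g (N + n))\<bar> \<le> 2 * real k"
      by (rule sum_shift_diff) (rule g)
    then show ?thesis using that shift[of k] shift[of 0] by (simp add: add.assoc)
  qed
  define Z where "Z = (\<Sum>n\<in>{N..<2 * N}. g n)"
  have "(\<Sum>n\<in>{N..<2 * N}. mean K (\<lambda>k. g (n + k))) = (\<Sum>k<K. \<Sum>n\<in>{N..<2 * N}. g (n + k)) / real K"
    unfolding mean_def sum_divide_distrib [symmetric] by (subst sum.swap) (rule refl)
  then have "(\<Sum>n\<in>{N..<2 * N}. mean K (\<lambda>k. g (n + k))) - Z = (\<Sum>k<K. (\<Sum>n\<in>{N..<2 * N}. g (n + k)) - Z) / real K"
    using K by (simp add: sum_subtractf diff_divide_distrib)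
  also have "\<bar>\<dots>\<bar> \<le> (\<Sum>k<K. 2 * real K) / real K"
    unfolding abs_divide abs_of_nat Z_def
    by (intro divide_right_mono order_trans[OF sum_abs sum_mono] dk) auto
  also have "\<dots> = 2 * real K" using K by simp
  finally have "\<bar>(\<Sum>n\<in>{N..<2 * N}. mean K (\<lambda>k. g (n + k))) - Z\<bar> \<le> 2 * real K" .
  moreover have "\<bar>\<Sum>n\<in>{N..<2 * N}. mean K (\<lambda>k. g (n + k))\<bar> \<le> (\<Sum>n\<in>{N..<2 * N}. \<bar>mean K (\<lambda>k. g (n + k))\<bar>)"
    by (rule sum_abs)
  ultimately show ?thesis unfolding Z_def by linarith
qed

text \<open>
  Induction by halving \<open>M\<close>. An odd \<open>M\<close> costs an additional \<open>1\<close>, which the hypothesis on \<open>N0\<close> absorbs.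
\<close>

lemma sum_small_of_dyadic_sums_small:
  fixes g :: "nat \<Rightarrow> real"
  assumes g: "\<And>n. \<bar>g n\<bar> \<le> 1" and eps: "\<epsilon> > 0" "1 \<le> \<epsilon> * real N0"
    and dyad: "\<And>N. N \<ge> N0 \<Longrightarrow> \<bar>\<Sum>n\<in>{N..<2 * N}. g n\<bar> \<le> \<epsilon> * real N"
  shows "\<bar>\<Sum>n<M. g n\<bar> \<le> 2 * real N0 + 3 * \<epsilon> * real M"
proof (induction M rule: less_induct)
  case (less M)
  show ?case
  proof (cases "M < 2 * N0")
    case True
    have "\<bar>\<Sum>n<M. g n\<bar> \<le> (\<Sum>n<M. \<bar>g n\<bar>)" by (rule sum_abs)
    also have "\<dots> \<le> real (card {..<M}) * 1" by (rule sum_bounded_above) (use g in auto)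
    also have "\<dots> \<le> 2 * real N0" using True by simp
    finally show ?thesis using eps by (smt (verit) mult_nonneg_nonneg of_nat_0_le_iff)
  next
    case False
    define N where "N = M div 2"
    have N0: "N0 > 0" using eps by (cases N0) auto
    have N: "N0 \<le> N" "N < M" "2 * N \<le> M" "M \<le> 2 * N + 1" using False N0 by (auto simp: N_def)
    have "\<bar>\<Sum>n<M. g n\<bar> \<le> \<bar>\<Sum>n<2 * N. g n\<bar> + 1"
    proof (cases "M = 2 * N")
      case False
      then have "M = Suc (2 * N)" using N by simp
      then show ?thesis using g[of "2 * N"] by simp
    qed simp
    also have "(\<Sum>n<2 * N. g n) = (\<Sum>n<N. g n) + (\<Sum>n\<in>{N..<2 * N}. g n)"
      by (simp add: lessThan_atLeast0 sum.atLeastLessThan_concat)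
    also have "\<bar>\<dots>\<bar> + 1 \<le> (2 * real N0 + 3 * \<epsilon> * real N) + \<epsilon> * real N + 1"
      using less.IH[OF N(2)] dyad[OF N(1)] by linarith
    also have "\<dots> \<le> 2 * real N0 + 3 * \<epsilon> * real M"
    proof -
      have "\<epsilon> * real N0 \<le> \<epsilon> * real N" using N eps by (intro mult_left_mono) auto
      moreover have "\<epsilon> * (2 * real N) \<le> \<epsilon> * real M" using N eps by (intro mult_left_mono) auto
      ultimately show ?thesis using eps by linarith
    qed
    finally show ?thesis by simp
  qed
qed

section \<open>Choice of the parameters and conclusion\<close>

lemma ex_power_of_2_ge: "\<exists>l::nat. x \<le> (2::real) ^ l"
  using real_arch_pow[of 2 x] by (auto intro: less_imp_le)

lemma ex_pos_nat_ge: "\<exists>n::nat. n > 0 \<and> x \<le> real n"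
proof -
  obtain n where "x < real n" using reals_Archimedean2 by blast
  then show ?thesis by (intro exI[of _ "Suc n"]) simp
qed

text \<open>
  The parameters have to be chosen in this order: \<open>p\<close> from \<open>c\<close>; the box size \<open>B\<close> from the decay of the cube sums; the
  separation \<open>H1\<close> and then the tolerance \<open>\<delta>\<close>, where \<open>1 / H1\<close> bounds the frequency of carries and \<open>H1 \<delta>\<close> the
  proportion of slopes lost; the number \<open>L\<close> of digits that survive; then \<open>H\<close>, \<open>\<kappa>\<close>, \<open>R\<close>, \<open>Q0\<close> for the directions attached to
  blocks; the position \<open>\<nu>\<close> where the blocks start, far enough above \<open>L\<close> for \<open>card_near_two_levels\<close>; \<open>H0\<close>, \<open>\<kappa>0\<close>, \<open>R0\<close> for
  direction \<open>0\<close>; and \<open>C\<close>, the factor by which the top level has to exceed the slopes so that the shifts in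
  direction \<open>0\<close> do not reach it, together with the step \<open>h0\<close> that compensates for this factor. All of them are
  constants; only \<open>K\<close>, \<open>D\<close> and \<open>\<mu>\<close> grow with \<open>N\<close>.
\<close>

lemma dyadic_sums_small:
  fixes c \<epsilon> :: real
  assumes c: "1 < c" "c < 2" and eps: "0 < \<epsilon>" "\<epsilon> \<le> 1"
  shows "\<forall>\<^sub>F N in sequentially. \<bar>\<Sum>n\<in>{N..<2 * N}. tm (nat \<lfloor>real n powr c\<rfloor>)\<bar> \<le> \<epsilon> * real N"
proof -
  define s where "s = 2 / (c - 1)"
  have s: "s > 0" using c by (simp add: s_def)
  obtain p where p: "p > 0" "(c - 1) / ((2 - c) / 4) + 1 \<le> real p" using ex_pos_nat_ge by blast
  then have p': "p \<ge> 1" "c - 1 < real p * ((2 - c) / 4)"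
  proof -
    have "(c - 1) / ((2 - c) / 4) < real p" using p by linarith
    then show "c - 1 < real p * ((2 - c) / 4)" using c by (simp add: pos_divide_less_eq)
  qed (use p in simp)
  define d where "d = Suc p"
  have d2: "d \<ge> 2" using p by (simp add: d_def)
  define \<epsilon>1 where "\<epsilon>1 = (\<epsilon> / 4) ^ (2 ^ d) / 3"
  have \<epsilon>1: "\<epsilon>1 > 0" "\<epsilon>1 \<le> 1"
  proof -
    show "\<epsilon>1 > 0" using eps by (simp add: \<epsilon>1_def)
    have "(\<epsilon> / 4) ^ (2 ^ d) \<le> 1" using eps by (intro power_le_one) auto
    then show "\<epsilon>1 \<le> 1" unfolding \<epsilon>1_def by linarith
  qed
  obtain l0 where l0: "\<And>w. \<bar>cube_sum d (2 ^ l0) (\<lambda>_. w)\<bar> \<le> \<epsilon>1 * real ((2 ^ l0) ^ (2 * d))"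
    using cube_sum_decay[OF d2 \<epsilon>1(1)] by blast
  define B :: nat where "B = 2 ^ l0"
  have B: "B > 0" by (simp add: B_def)
  define V :: real where "V = 2 * (2 ^ d + 1) * real (p + 3)"
  have V: "V > 0" unfolding V_def by (intro mult_pos_pos add_pos_pos) auto
  obtain H1 :: nat where H1: "H1 > 0" "4 * V / \<epsilon>1 \<le> real H1" using ex_pos_nat_ge by blast
  define \<delta> where "\<delta> = min (1 / 16) (\<epsilon> / (1024 * real (p + 3) * real H1 * s))"
  have pos1: "1024 * real (p + 3) * real H1 * s > 0" using H1 s by simp
  have \<delta>: "\<delta> > 0" "\<delta> \<le> 1 / 16" "real (p + 3) * (real H1 * (64 * \<delta> * s)) \<le> \<epsilon> / 16"
  proof -
    show "\<delta> \<le> 1 / 16" unfolding \<delta>_def by (rule min.cobounded1)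
    show "\<delta> > 0" unfolding \<delta>_def min_less_iff_conj using eps pos1 by (intro conjI divide_pos_pos) auto
    have "\<delta> \<le> \<epsilon> / (1024 * real (p + 3) * real H1 * s)" by (simp add: \<delta>_def)
    then have "\<delta> * (1024 * real (p + 3) * real H1 * s) \<le> \<epsilon>" using pos1 by (simp only: pos_le_divide_eq)
    then show "real (p + 3) * (real H1 * (64 * \<delta> * s)) \<le> \<epsilon> / 16" by (simp add: mult_ac)
  qed
  define \<tau> where "\<tau> = \<delta> / real (d + 2)"
  have \<tau>: "\<tau> > 0" "real (d + 2) * \<tau> \<le> \<delta>" using \<delta> by (simp_all add: \<tau>_def)
  obtain L where "real (d * B + 1) / \<delta> \<le> 2 ^ L" using ex_power_of_2_ge by blast
  then have L: "real (d * B + 1) \<le> \<delta> * 2 ^ L" using \<delta>(1) by (simp only: pos_divide_le_eq mult.commute)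
  obtain H :: nat where H: "H > 0" "2 ^ L / \<tau> \<le> real H" using ex_pos_nat_ge by blast
  then have H': "2 ^ L / real H \<le> \<tau>" using \<tau> by (simp add: field_simps)
  define \<kappa> where "\<kappa> = min 1 (\<epsilon> / (288 * real p * s * real (H ^ 2)))"
  have pos2: "288 * real p * s * real (H ^ 2) > 0" using p s H by simp
  have \<kappa>: "\<kappa> > 0" "\<kappa> \<le> 1" "real p * (18 * \<kappa> * s * real (H ^ 2)) \<le> \<epsilon> / 16"
  proof -
    show "\<kappa> > 0" "\<kappa> \<le> 1" using eps pos2 by (auto simp: \<kappa>_def)
    have "\<kappa> \<le> \<epsilon> / (288 * real p * s * real (H ^ 2))" by (simp add: \<kappa>_def)
    then have "\<kappa> * (288 * real p * s * real (H ^ 2)) \<le> \<epsilon>" using pos2 by (simp only: pos_le_divide_eq)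
    then show "real p * (18 * \<kappa> * s * real (H ^ 2)) \<le> \<epsilon> / 16" by (simp add: mult_ac)
  qed
  obtain R :: nat where R: "R > 0" "1 / \<kappa> \<le> real R" using ex_pos_nat_ge by blast
  then have R': "1 \<le> real R * \<kappa>" using \<kappa> by (simp add: field_simps)
  obtain Q0 :: nat where Q0: "Q0 > 0" "real R * real H / \<delta> \<le> real Q0" using ex_pos_nat_ge by blast
  then have Q0': "real R * (real H / real Q0) \<le> \<delta>" using \<delta> by (simp add: field_simps)
  obtain \<nu>0 where \<nu>0: "3 * 2 ^ L * real Q0 / real H \<le> 2 ^ \<nu>0" using ex_power_of_2_ge by blast
  define \<nu> where "\<nu> = L + \<nu>0"
  have \<nu>: "L \<le> \<nu>" "3 * 2 ^ L \<le> real H * 2 ^ \<nu> / real Q0"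
  proof -
    have "(2::real) ^ \<nu>0 \<le> 2 ^ \<nu>" by (simp add: \<nu>_def)
    then have "3 * 2 ^ L * real Q0 / real H \<le> 2 ^ \<nu>" using \<nu>0 by linarith
    then show "3 * 2 ^ L \<le> real H * 2 ^ \<nu> / real Q0" using H Q0 by (simp add: field_simps)
  qed (simp add: \<nu>_def)
  obtain H0 :: nat where H0: "H0 > 0" "2 ^ \<nu> / \<tau> \<le> real H0" using ex_pos_nat_ge by blast
  then have H0': "2 ^ \<nu> / real H0 \<le> \<tau>" using \<tau> by (simp add: field_simps)
  define \<kappa>0 where "\<kappa>0 = min (1 / 2) (\<epsilon> / (128 * real H0 * s))"
  have pos3: "128 * real H0 * s > 0" using H0 s by simp
  have \<kappa>0: "\<kappa>0 > 0" "\<kappa>0 < 1" "real H0 * (8 * \<kappa>0 * s) \<le> \<epsilon> / 16"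
  proof -
    show "\<kappa>0 > 0" "\<kappa>0 < 1" using eps pos3 by (auto simp: \<kappa>0_def)
    have "\<kappa>0 \<le> \<epsilon> / (128 * real H0 * s)" by (simp add: \<kappa>0_def)
    then have "\<kappa>0 * (128 * real H0 * s) \<le> \<epsilon>" using pos3 by (simp only: pos_le_divide_eq)
    then show "real H0 * (8 * \<kappa>0 * s) \<le> \<epsilon> / 16" by (simp add: mult_ac)
  qed
  obtain R0 :: nat where R0: "R0 > 0" "1 / \<kappa>0 \<le> real R0" using ex_pos_nat_ge by blast
  then have R0': "1 \<le> real R0 * \<kappa>0" using \<kappa>0 by (simp add: field_simps)
  define C where "C = 2 * real (R0 * H0) / \<delta>"
  have C: "C > 0" using R0 H0 \<delta> by (simp add: C_def)
  obtain h0 :: nat where h0: "h0 > 0" "2 ^ p * C \<le> real h0" using ex_pos_nat_ge by blast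
  define A0 where "A0 = R * (H * Q0) + R0 * H0"
  \<comment> \<open>The requirements on \<open>Z\<close> in the order of the list: size of the shifts, boundary terms in counting
     carries, linearity on blocks, the strict bound in \<open>card_near_two_levels\<close>, \<open>2 ^ \<nu> \<le> D\<close>, the lower order
     terms for the three kinds of bad slopes, and the boundary terms of \<open>sum_le_sum_of_local_means\<close>.\<close>
  define z1 where "z1 = 2 ^ (d + 2) * real A0 / \<epsilon>1"
  define z2 where "z2 = 2 * V * real h0 / \<epsilon>1"
  define z3 where "z3 = 8 / \<tau>"
  define z4 where "z4 = real H * 2 ^ p * C / real Q0 + 1"
  define z5 where "z5 = (2::real) ^ \<nu>"
  define z6 where "z6 = real (p + 3) * (real H1 * (2 * real (H1 * h0) + 2)) * 16 / \<epsilon>"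
  define z7 where "z7 = real H0 * (2 * real (H0 * 1) + 2) * 16 / \<epsilon>"
  define z8 where "z8 = real p * (9 * real (H ^ 3) * real Q0) * 16 / \<epsilon>"
  define z9 where "z9 = 16 / \<epsilon>"
  define Z where "Z = 1 + z1 + z2 + z3 + z4 + z5 + z6 + z7 + z8 + z9"
  have z0: "0 \<le> z1" "0 \<le> z2" "0 \<le> z3" "0 \<le> z4" "0 \<le> z5" "0 \<le> z6" "0 \<le> z7" "0 \<le> z8" "0 \<le> z9"
    using \<epsilon>1 V \<tau> C eps
    by (simp_all add: z1_def z2_def z3_def z4_def z5_def z6_def z7_def z8_def z9_def)
  then have Z: "1 \<le> Z" "z1 \<le> Z" "z2 \<le> Z" "z3 \<le> Z" "z4 \<le> Z" "z5 \<le> Z" "z6 \<le> Z" "z7 \<le> Z" "z8 \<le> Z" "z9 \<le> Z"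
    unfolding Z_def by linarith+
  show ?thesis
    using eventually_scales[OF c C Z(1) p', of \<nu>]
  proof eventually_elim
    case (elim N)
    define D where "D = c * real N powr (c - 1)"
    define K where "K = nat \<lfloor>real N powr ((2 - c) / 4)\<rfloor>"
    obtain \<mu> where \<mu>: "C * D \<le> 2 ^ (\<nu> + p * \<mu>)" "2 ^ (\<nu> + p * \<mu>) \<le> 2 ^ p * C * D"
      "Z * 2 ^ \<mu> \<le> real K" "Z \<le> 2 ^ \<mu>" "Z * D * 2 ^ \<mu> \<le> real N"
      using elim D_def K_def by blast
    have NK: "N > 0" "K > 0" "Z \<le> D" "Z * D \<le> real N" "Z * real K \<le> real N" "Z \<le> real K"
       "Z * real K ^ 2 * real N powr (c - 2) \<le> 1"
      using elim D_def K_def by blast+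
    have D1: "D \<ge> 1" using NK Z by linarith
    define \<sigma> where "\<sigma> = c * (c - 1) * real N powr (c - 2) / 2"
    have D\<sigma>: "D / \<sigma> = s * real N"
    proof -
      have "real N powr (c - 1) = real N powr (c - 2) * real N"
        using NK(1) powr_add[of "real N" "c - 2" 1] by simp
      moreover have "real N powr (c - 2) > 0" using NK(1) by simp
      ultimately show ?thesis using c by (simp add: D_def \<sigma>_def s_def)
    qed
    define \<alpha> where "\<alpha> n = c * real n powr (c - 1)" for n :: nat
    define S where "S = {N..<2 * N}"
    interpret slowly_increasing \<alpha> S D \<sigma>
      unfolding \<alpha>_def[abs_def] S_def D_def \<sigma>_def by (rule slowly_increasing_powr[OF c NK(1)])
    define Lev where "Lev = {0, L} \<union> (\<lambda>i. \<nu> + i * \<mu>) ` {..p}"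
    have le_top: "l \<le> \<nu> + p * \<mu>" if "l \<in> Lev" for l using that \<nu>(1) by (auto simp: Lev_def)
    have cardLev: "card Lev \<le> p + 3" unfolding Lev_def by (rule card_levels)
    define Q where "Q = Q0 * 2 ^ \<mu>"
    define bad1 where "bad1 = {n \<in> S. \<exists>h\<in>{1..H0}. near_multiple \<kappa>0 \<nu> (real (h * 1) * \<alpha> n)}"
    define bad2 where "bad2 = {n \<in> S. \<exists>l\<in>Lev. \<exists>h\<in>{1..H1}. near_multiple (8 * \<delta>) l (real (h * h0) * \<alpha> n)}"
    define bad3 where "bad3 = {n \<in> S. \<exists>i\<in>{..<p}. \<exists>k\<in>{1..H * Q}.
       (\<exists>M::int. \<bar>real k * \<alpha> n - of_int M * 2 ^ (\<nu> + Suc i * \<mu>)\<bar> \<le> real H * (2 ^ (\<nu> + Suc i * \<mu>) / real Q)) \<and> near_multiple \<kappa> L (real k * \<alpha> n)}"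
    have b1: "real (card bad1) \<le> \<epsilon> / 8 * real N"
    proof -
      have "2 ^ \<nu> \<le> real 1 * D" using NK Z by (simp add: z5_def)
      then have "real (card bad1) \<le> real H0 * (8 * \<kappa>0 * (D / \<sigma>) + 2 * real (H0 * 1) * D + 2)"
        unfolding bad1_def using \<kappa>0 by (intro card_near_multiples) auto
      also have "\<dots> \<le> real H0 * (8 * \<kappa>0 * s) * real N + real H0 * (2 * real (H0 * 1) + 2) * D"
        using D1 mult_left_mono[of 1 D "2 * real H0"] unfolding D\<sigma> by (simp add: algebra_simps)
      also have "real H0 * (8 * \<kappa>0 * s) * real N \<le> \<epsilon> / 16 * real N" using \<kappa>0 by (intro mult_right_mono) auto
      also have "real H0 * (2 * real (H0 * 1) + 2) * D = \<epsilon> / 16 * (z7 * D)" using eps by (simp add: z7_def)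
      also have "z7 * D \<le> real N" using NK mult_right_mono[OF Z(8), of D] D1 by linarith
      finally show ?thesis using eps by (simp add: mult_left_mono)
    qed
    have b2: "real (card bad2) \<le> \<epsilon> / 8 * real N"
    proof -
      have "real (card {n \<in> S. \<exists>h\<in>{1..H1}. near_multiple (8 * \<delta>) l (real (h * h0) * \<alpha> n)})
          \<le> real H1 * (8 * (8 * \<delta>) * (D / \<sigma>) + 2 * real (H1 * h0) * D + 2)" if l: "l \<in> Lev" for l
      proof (rule card_near_multiples)
        have "(2::real) ^ l \<le> 2 ^ (\<nu> + p * \<mu>)" using le_top[OF l] by (intro power_increasing) auto
        also have "\<dots> \<le> 2 ^ p * C * D" by (rule \<mu>(2))
        also have "\<dots> \<le> real h0 * D" using h0 D1 by (intro mult_right_mono) auto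
        finally show "2 ^ l \<le> real h0 * D" .
      qed (use h0 \<delta> in auto)
      then have "real (card bad2) \<le> real (card Lev) * (real H1 * (8 * (8 * \<delta>) * (D / \<sigma>) + 2 * real (H1 * h0) * D + 2))"
        unfolding bad2_def by (intro card_Bex_le) (auto simp: Lev_def)
      also have "\<dots> \<le> real (p + 3) * (real H1 * (8 * (8 * \<delta>) * (D / \<sigma>) + 2 * real (H1 * h0) * D + 2))"
        using cardLev \<delta> D1 \<sigma> by (intro mult_right_mono mult_nonneg_nonneg add_nonneg_nonneg) auto
      also have "\<dots> = real (p + 3) * (real H1 * (64 * \<delta> * s)) * real N + real (p + 3) * (real H1 * (2 * real (H1 * h0) * D + 2))"
        unfolding D\<sigma> by (simp add: algebra_simps)
      also have "real (p + 3) * (real H1 * (2 * real (H1 * h0) * D + 2)) \<le> real (p + 3) * (real H1 * (2 * real (H1 * h0) * D + 2 * D))"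
        using D1 by (intro mult_left_mono add_left_mono) auto
      also have "\<dots> = \<epsilon> / 16 * (z6 * D)" using eps by (simp add: z6_def field_simps)
      also have "real (p + 3) * (real H1 * (64 * \<delta> * s)) * real N \<le> \<epsilon> / 16 * real N" using \<delta>(3) by (intro mult_right_mono) auto
      also have "z6 * D \<le> real N" using NK mult_right_mono[OF Z(7), of D] D1 by linarith
      finally show ?thesis using eps by (simp add: mult_left_mono)
    qed
    have QR: "real Q = real Q0 * 2 ^ \<mu>" by (simp add: Q_def)
    have b3: "real (card bad3) \<le> \<epsilon> / 8 * real N"
    proof -
      have "real (card {n \<in> S. \<exists>k\<in>{1..H * Q}.
       (\<exists>M::int. \<bar>real k * \<alpha> n - of_int M * 2 ^ (\<nu> + Suc i * \<mu>)\<bar> \<le> real H * (2 ^ (\<nu> + Suc i * \<mu>) / real Q)) \<and> near_multiple \<kappa> L (real k * \<alpha> n)})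
        \<le> 18 * \<kappa> * (D / \<sigma>) * real (H ^ 2) + 9 * real (H ^ 3) * (real Q * D)" if i: "i \<in> {..<p}" for i
      proof (rule card_near_two_levels_multiples)
        have e: "real H * (2 ^ (\<nu> + Suc i * \<mu>) / real Q) = real H * 2 ^ (\<nu> + i * \<mu>) / real Q0"
          unfolding QR by (simp add: power_add)
        have "3 * 2 ^ L \<le> real H * 2 ^ \<nu> / real Q0" by (rule \<nu>(2))
        also have "\<dots> \<le> real H * 2 ^ (\<nu> + i * \<mu>) / real Q0"
          by (intro divide_right_mono mult_left_mono power_increasing) auto
        finally show "3 * 2 ^ L \<le> real H * (2 ^ (\<nu> + Suc i * \<mu>) / real Q)" unfolding e .
        have "Suc i * \<mu> \<le> p * \<mu>" using i by (intro mult_le_mono) auto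
        then have "(2::real) ^ (\<nu> + Suc i * \<mu>) \<le> 2 ^ (\<nu> + p * \<mu>)" by (intro power_increasing) auto
        also have "\<dots> \<le> 2 ^ p * C * D" by (rule \<mu>(2))
        finally have "real H * (2 ^ (\<nu> + Suc i * \<mu>) / real Q) \<le> real H * (2 ^ p * C * D / real Q)"
          by (intro mult_left_mono divide_right_mono) auto
        also have "\<dots> = (z4 - 1) * D / 2 ^ \<mu>" by (simp add: z4_def QR field_simps)
        also have "\<dots> < D"
        proof -
          have "z4 - 1 < 2 ^ \<mu>" using \<mu>(4) Z(5) by linarith
          then have "(z4 - 1) * D < 2 ^ \<mu> * D" using D1 by (intro mult_strict_right_mono) auto
          then show ?thesis by (simp add: field_simps)
        qed
        finally show "real H * (2 ^ (\<nu> + Suc i * \<mu>) / real Q) < D" .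
      qed (use \<kappa> \<nu> Q0 in \<open>auto simp: Q_def\<close>)
      then have "real (card bad3) \<le> real (card {..<p}) * (18 * \<kappa> * (D / \<sigma>) * real (H ^ 2) + 9 * real (H ^ 3) * (real Q * D))"
        unfolding bad3_def by (intro card_Bex_le) auto
      also have "\<dots> = real p * (18 * \<kappa> * s * real (H ^ 2)) * real N + \<epsilon> / 16 * (z8 * D * 2 ^ \<mu>)"
        unfolding D\<sigma> QR using eps by (simp add: z8_def algebra_simps)
      also have "real p * (18 * \<kappa> * s * real (H ^ 2)) * real N \<le> \<epsilon> / 16 * real N" using \<kappa> by (intro mult_right_mono) auto
      also have "z8 * D * 2 ^ \<mu> \<le> Z * D * 2 ^ \<mu>" using Z(9) D1 by (intro mult_right_mono) auto
      also have "\<dots> \<le> real N" by (rule \<mu>(5))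
      finally show ?thesis using eps by (simp add: mult_left_mono)
    qed
    define A where "A = R * (H * (Q0 * 2 ^ \<mu>)) + R0 * H0"
    have A: "2 ^ (d + 2) * real A / \<epsilon>1 \<le> real K"
    proof -
      have "R0 * H0 * 1 \<le> R0 * H0 * 2 ^ \<mu>" by (intro mult_le_mono2) simp
      then have "A \<le> A0 * 2 ^ \<mu>" by (simp add: A_def A0_def algebra_simps)
      then have "real A \<le> real (A0 * 2 ^ \<mu>)" by (simp only: of_nat_le_iff)
      then have "real A \<le> real A0 * 2 ^ \<mu>" by simp
      then have "2 ^ (d + 2) * real A / \<epsilon>1 \<le> 2 ^ (d + 2) * (real A0 * 2 ^ \<mu>) / \<epsilon>1"
        using \<epsilon>1 by (intro divide_right_mono mult_left_mono) auto
      also have "\<dots> = z1 * 2 ^ \<mu>" by (simp add: z1_def)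
      also have "\<dots> \<le> Z * 2 ^ \<mu>" using Z by (intro mult_right_mono) auto
      finally show ?thesis using \<mu>(3) by linarith
    qed
    have dA: "d * A \<le> K"
    proof -
      have "real d \<le> 2 ^ (d + 2)" 
      proof -
        have "d \<le> 2 ^ (d + 2)" using less_exp[of "d + 2"] by linarith
        then have "real d \<le> real (2 ^ (d + 2))" by (simp only: of_nat_le_iff)
        then show ?thesis by simp
      qed
      then have "real d * real A * \<epsilon>1 \<le> 2 ^ (d + 2) * real A * 1" using \<epsilon>1 by (intro mult_mono) auto
      then have "real d * real A \<le> 2 ^ (d + 2) * real A / \<epsilon>1" using \<epsilon>1 by (simp add: field_simps)
      then have "real (d * A) \<le> real K" using A by simp
      then show ?thesis by (simp only: of_nat_le_iff)
    qed
    define loc where "loc n = mean K (\<lambda>k. tm (nat \<lfloor>real (n + k) powr c\<rfloor>))" for n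
    have loc1: "\<bar>loc n\<bar> \<le> 1" for n unfolding loc_def by (rule abs_mean_le_1) simp
    have good: "\<bar>loc n\<bar> \<le> \<epsilon> / 4" if n: "n \<in> S" "n \<notin> bad1" "n \<notin> bad2" "n \<notin> bad3" for n
    proof -
      have nN: "N \<le> n" "n > 0" using n NK by (auto simp: S_def)
      have "\<bar>loc n\<bar> ^ (2 ^ d) \<le> \<epsilon>1 + 2 * (2 ^ d + 1) * (real (p + 3) * (2 * real K / real H1 + real h0)) / real K
         + 2 ^ (d + 2) * real A / real K"
        unfolding loc_def
      proof (rule mean_bound_of_good_slope[where \<alpha> = "\<alpha> n" and \<beta> = "real n powr c" and \<mu> = \<mu> and Lev = Lev and p = p,
            OF d_def NK(2) B _ _ _ \<tau> _ L \<nu>(1) H(1) H' \<kappa>(1) R' Q0(1) Q0' H0(1) H0' \<kappa>0(1) R0' _ A_def dA _ h0(1) H1(1) Lev_def])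
        show "0 \<le> real (n + k) powr c" for k by simp
        show "\<bar>real (n + k) powr c - real n powr c - real k * \<alpha> n\<bar> \<le> \<tau>" if k: "k < 2 * K" for k
        proof -
          have "\<bar>(real n + real k) powr c - real n powr c - real k * (c * real n powr (c - 1))\<bar> \<le> 2 * (real k)\<^sup>2 * real n powr (c - 2)"
            using nN by (intro powr_second_order c) auto
          also have "\<dots> \<le> 2 * (2 * real K)\<^sup>2 * real N powr (c - 2)"
            using k nN NK(1) c by (intro mult_mono mult_left_mono power_mono powr_mono2') auto
          also have "\<dots> = \<tau> * (z3 * real K ^ 2 * real N powr (c - 2))" using \<tau> by (simp add: z3_def power_mult_distrib)
          also have "\<dots> \<le> \<tau> * (Z * real K ^ 2 * real N powr (c - 2))" using Z \<tau> by (intro mult_left_mono mult_right_mono) auto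
          also have "\<dots> \<le> \<tau> * 1" using NK \<tau> by (intro mult_left_mono) auto
          finally show ?thesis by (simp add: \<alpha>_def)
        qed
        show "0 \<le> \<alpha> n" using c by (simp add: \<alpha>_def)
        show "\<delta> \<le> 1" using \<delta> by simp
        have "real (R0 * H0) * \<alpha> n \<le> real (R0 * H0) * (2 * D)" using range[OF n(1)] by (intro mult_left_mono) auto
        also have "\<dots> = \<delta> * (C * D)" using \<delta> by (simp add: C_def)
        also have "\<dots> \<le> \<delta> * 2 ^ (\<nu> + p * \<mu>)" using \<mu>(1) \<delta> by (intro mult_left_mono) auto
        finally show "real (R0 * H0) * \<alpha> n \<le> \<delta> * 2 ^ (\<nu> + p * \<mu>)" .
        show "\<bar>cube_sum d B (\<lambda>_. w)\<bar> \<le> \<epsilon>1 * real (B ^ (2 * d))" for w unfolding B_def by (rule l0)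
        show "\<not> near_multiple \<kappa>0 \<nu> (real h * \<alpha> n)" if "h \<in> {1..H0}" for h
          using n that by (auto simp: bad1_def)
        show "\<not> ((\<exists>M::int. \<bar>real k * \<alpha> n - of_int M * 2 ^ (\<nu> + Suc i * \<mu>)\<bar> \<le> real H * (2 ^ (\<nu> + Suc i * \<mu>) / real (Q0 * 2 ^ \<mu>)))
           \<and> near_multiple \<kappa> L (real k * \<alpha> n))" if "i < p" "k \<in> {1..H * (Q0 * 2 ^ \<mu>)}" for i k
          using n that unfolding bad3_def Q_def by blast
        show "\<not> near_multiple (8 * \<delta>) l (real (h * h0) * \<alpha> n)" if "l \<in> Lev" "h \<in> {1..H1}" for l h
          using n that unfolding bad2_def by blast
      qed
      also have "2 * (2 ^ d + 1) * (real (p + 3) * (2 * real K / real H1 + real h0)) / real K = 2 * V / real H1 + V * real h0 / real K"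
        using NK(2) H1 by (simp add: V_def field_simps)
      also have "2 * V / real H1 \<le> \<epsilon>1 / 2" using H1 \<epsilon>1 by (simp add: field_simps)
      also have "V * real h0 / real K \<le> \<epsilon>1 / 2"
      proof -
        have "2 * V * real h0 / \<epsilon>1 \<le> real K" using Z NK unfolding z2_def by linarith
        then show ?thesis using NK(2) \<epsilon>1 by (simp add: field_simps)
      qed
      also have "2 ^ (d + 2) * real A / real K \<le> \<epsilon>1"
        using A NK(2) \<epsilon>1 by (simp add: field_simps)
      finally have "\<bar>loc n\<bar> ^ (2 ^ d) \<le> (\<epsilon> / 4) ^ (2 ^ d)" by (simp add: \<epsilon>1_def)
      then show ?thesis using eps by (subst (asm) power_mono_iff) auto
    qed
    have "\<bar>\<Sum>n\<in>S. tm (nat \<lfloor>real n powr c\<rfloor>)\<bar> \<le> (\<Sum>n\<in>S. \<bar>loc n\<bar>) + 2 * real K"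
      unfolding S_def loc_def by (rule sum_le_sum_of_local_means) (use NK in auto)
    also have "(\<Sum>n\<in>S. \<bar>loc n\<bar>) \<le> (\<Sum>n\<in>S. \<epsilon> / 4 + of_bool (n \<in> bad1) + of_bool (n \<in> bad2) + of_bool (n \<in> bad3))"
    proof (rule sum_mono)
      fix n assume "n \<in> S"
      then show "\<bar>loc n\<bar> \<le> \<epsilon> / 4 + of_bool (n \<in> bad1) + of_bool (n \<in> bad2) + of_bool (n \<in> bad3)"
        using good[of n] loc1[of n] eps by (cases "n \<in> bad1"; cases "n \<in> bad2"; cases "n \<in> bad3") auto
    qed
    also have "\<dots> = \<epsilon> / 4 * real N + real (card bad1) + real (card bad2) + real (card bad3)"
    proof -
      have cnt: "(\<Sum>n\<in>S. of_bool (n \<in> T)) = real (card T)" if "T \<subseteq> S" for T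
        using that finite_S by (simp add: Int_absorb1)
      have "bad1 \<subseteq> S" "bad2 \<subseteq> S" "bad3 \<subseteq> S" by (auto simp: bad1_def bad2_def bad3_def)
      then show ?thesis unfolding sum.distrib by (simp only: cnt) (simp add: S_def)
    qed
    also have "2 * real K = \<epsilon> / 8 * (z9 * real K)" using eps by (simp add: z9_def)
    also have "z9 * real K \<le> Z * real K" using Z by (intro mult_right_mono) auto
    also have "\<dots> \<le> real N" by (rule NK)
    finally have "\<bar>\<Sum>n\<in>S. tm (nat \<lfloor>real n powr c\<rfloor>)\<bar> \<le> \<epsilon> / 4 * real N + real (card bad1) + real (card bad2) + real (card bad3) + \<epsilon> / 8 * real N"
      using eps by (simp add: mult_left_mono)
    also have "\<dots> \<le> \<epsilon> * real N" using b1 b2 b3 eps by (simp add: field_simps)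
    finally show ?case by (simp add: S_def)
  qed
qed

lemma mean_tm_tendsto_0:
  fixes c :: real
  assumes c: "1 < c" "c < 2"
  shows "(\<lambda>N. mean N (\<lambda>n. tm (nat \<lfloor>real n powr c\<rfloor>))) \<longlonglongrightarrow> 0"
proof (rule LIMSEQ_I)
  fix e :: real assume e: "e > 0"
  define \<epsilon> where "\<epsilon> = min 1 (e / 6)"
  have \<epsilon>: "0 < \<epsilon>" "\<epsilon> \<le> 1" "6 * \<epsilon> \<le> e" using e by (auto simp: \<epsilon>_def)
  obtain N1 where N1: "\<And>N. N \<ge> N1 \<Longrightarrow> \<bar>\<Sum>n\<in>{N..<2 * N}. tm (nat \<lfloor>real n powr c\<rfloor>)\<bar> \<le> \<epsilon> * real N"
    using dyadic_sums_small[OF c \<epsilon>(1,2)] unfolding eventually_sequentially by blast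
  obtain N2 :: nat where N2: "N2 > 0" "1 / \<epsilon> \<le> real N2" using ex_pos_nat_ge by blast
  define N0 where "N0 = max N1 N2"
  have "1 \<le> \<epsilon> * real N0"
  proof -
    have "1 / \<epsilon> \<le> real N0" using N2 by (simp add: N0_def)
    then show ?thesis using \<epsilon> by (simp add: field_simps)
  qed
  then have bd: "\<bar>\<Sum>n<M. tm (nat \<lfloor>real n powr c\<rfloor>)\<bar> \<le> 2 * real N0 + 3 * \<epsilon> * real M" for M
    using N1 \<epsilon> by (intro sum_small_of_dyadic_sums_small) (auto simp: N0_def)
  obtain M0 :: nat where M0: "M0 > 0" "2 * real N0 / \<epsilon> \<le> real M0" using ex_pos_nat_ge by blast
  have "norm (mean M (\<lambda>n. tm (nat \<lfloor>real n powr c\<rfloor>)) - 0) < e" if M: "M \<ge> M0" for M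
  proof -
    have Mp: "real M > 0" using M M0 by simp
    have "2 * real N0 / \<epsilon> \<le> real M" using M M0 by linarith
    then have "2 * real N0 \<le> \<epsilon> * real M" using \<epsilon> by (simp add: field_simps)
    then have "\<bar>\<Sum>n<M. tm (nat \<lfloor>real n powr c\<rfloor>)\<bar> \<le> 4 * \<epsilon> * real M" using bd[of M] by linarith
    then have "\<bar>mean M (\<lambda>n. tm (nat \<lfloor>real n powr c\<rfloor>))\<bar> \<le> 4 * \<epsilon>"
      using Mp by (simp add: mean_def abs_divide field_simps)
    then show ?thesis using \<epsilon> by simp
  qed
  then show "\<exists>no. \<forall>M\<ge>no. norm (mean M (\<lambda>n. tm (nat \<lfloor>real n powr c\<rfloor>)) - 0) < e" by blast
qed

theorem theorem1p2:
  fixes c :: real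
  assumes "1 < c" and "c < 2"
  shows "\<forall>b\<in>{0, 1}.
    (\<lambda>N. 1 / real N * real (card {n. n < N \<and> thue_morse (nat \<lfloor>real n powr c\<rfloor>) = b}))
      \<longlonglongrightarrow> 1 / 2"
proof
  fix b :: nat assume b: "b \<in> {0, 1}"
  define u :: real where "u = (if b = 0 then 1 else -1)"
  define x where "x n = nat \<lfloor>real n powr c\<rfloor>" for n :: nat
  have ind: "of_bool (thue_morse m = b) = (1 + u * tm m) / 2" for m
    using b by (auto simp: u_def thue_morse_def tm_def)
  have eq: "1 / real N * real (card {n. n < N \<and> thue_morse (x n) = b})
      = 1 / 2 + u / 2 * mean N (\<lambda>n. tm (x n))" if N: "N > 0" for N
  proof -
    have "{n. n < N \<and> thue_morse (x n) = b} = {..<N} \<inter> {n. thue_morse (x n) = b}" by auto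
    then have "real (card {n. n < N \<and> thue_morse (x n) = b}) = (\<Sum>n<N. of_bool (thue_morse (x n) = b))"
      by simp
    also have "\<dots> = (\<Sum>n<N. 1 / 2 + u / 2 * tm (x n))" by (simp add: ind add_divide_distrib)
    also have "\<dots> = real N / 2 + u / 2 * (\<Sum>n<N. tm (x n))" by (simp add: sum.distrib sum_distrib_left)
    finally show ?thesis using N by (simp add: mean_def field_simps)
  qed
  have "(\<lambda>N. 1 / 2 + u / 2 * mean N (\<lambda>n. tm (x n))) \<longlonglongrightarrow> 1 / 2 + u / 2 * 0"
    unfolding x_def by (intro tendsto_intros mean_tm_tendsto_0 assms)
  moreover have "\<forall>\<^sub>F N in sequentially. 1 / 2 + u / 2 * mean N (\<lambda>n. tm (x n))
      = 1 / real N * real (card {n. n < N \<and> thue_morse (x n) = b})"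
    using eventually_gt_at_top[of 0] by eventually_elim (rule eq [symmetric])
  ultimately show "(\<lambda>N. 1 / real N * real (card {n. n < N \<and> thue_morse (nat \<lfloor>real n powr c\<rfloor>) = b})) \<longlonglongrightarrow> 1 / 2"
    unfolding x_def by (simp add: Lim_transform_eventually)
qed

end
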